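(* $SO(1,n)_0$ is the only connected Lie subgroup of $O(1,n)$ which acts irreducibly.
   Context: $O(1,n)$ is the group of linear isometries of the Lorentzian space $\mathbb{R}^{1,n}$, i.e. of $\mathbb{R}^{n+1}$ with the inner product $-x_0y_0+x_1y_1+\dots+x_ny_n$, and $SO(1,n)_0$ is the connected component of the identity of $O(1,n)$. "Lie subgroup" is meant in the weak sense of an immersed submanifold, not necessarily embedded. "Acts irreducibly" means that there is no invariant real linear subspace of $\mathbb{R}^{1,n}$ other than $\{0\}$ and the whole space.
   Formalization: That SO(1,n)_0 itself acts irreducibly is asserted only for n ≠ 1, since SO(1,1)_0 preserves the two null lines of R^{1,1}; that no other connected Lie subgroup of O(1,n) acts irreducibly is asserted for every n. *)

theory Defs
  imports "HOL-Analysis.Analysis"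
begin

(* Lorentzian space R^{1,n} is real^'m for an index type 'm with a distinguished index 0,
   so n = CARD('m) - 1; linear endomorphisms are matrices. *)

definition lorentz :: "real^'m::{finite,zero} \<Rightarrow> real^'m::{finite,zero} \<Rightarrow> real" where
  "lorentz x y = - (x $ 0 * y $ 0) + (\<Sum>i\<in>UNIV - {0}. x $ i * y $ i)"

(* O(1,n); isometries are invertible because the form is nondegenerate. *)
definition O1 :: "(real^'m::{finite,zero}^'m::{finite,zero}) set" where
  "O1 = {A. \<forall>x y. lorentz (A *v x) (A *v y) = lorentz x y}"

definition SO1_0 :: "(real^'m::{finite,zero}^'m::{finite,zero}) set" where
  "SO1_0 = connected_component_set O1 (mat 1)"

(* For n = 1 (that is, CARD('m) = 2) SO(1,1)_0 preserves the two null lines,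
   so it does not act irreducibly. *)
definition acts_irreducibly :: "(real^'m^'m) set \<Rightarrow> bool" where
  "acts_irreducibly G \<longleftrightarrow>
     (\<forall>S. subspace S \<and> (\<forall>A\<in>G. \<forall>x\<in>S. A *v x \<in> S) \<longrightarrow> S = {0} \<or> S = UNIV)"

(* Continuously differentiable k times; meant for open S. *)
primrec Ck_on :: "nat \<Rightarrow> 'a::euclidean_space set \<Rightarrow> ('a \<Rightarrow> 'b::euclidean_space) \<Rightarrow> bool" where
  "Ck_on 0 S f \<longleftrightarrow> continuous_on S f"
| "Ck_on (Suc k) S f \<longleftrightarrow>
     (\<forall>x\<in>S. f differentiable (at x)) \<and> (\<forall>v. Ck_on k S (\<lambda>x. frechet_derivative f (at x) v))"

(* C^infinity on an arbitrary subset: local extendability to a smooth function on an open set. *)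
definition smooth_on :: "'a::euclidean_space set \<Rightarrow> ('a \<Rightarrow> 'b::euclidean_space) \<Rightarrow> bool" where
  "smooth_on A f \<longleftrightarrow>
     (\<forall>x\<in>A. \<exists>V g. open V \<and> x \<in> V \<and> (\<forall>k. Ck_on k V g) \<and> (\<forall>y\<in>V \<inter> A. g y = f y))"

(* A chart is given by its inverse, a parametrization: a pair (W, p) where W is open in the
   model vector space and p maps W onto the domain of the chart. *)
type_synonym ('e, 'a) parametrization = "'e set \<times> ('e \<Rightarrow> 'a)"

(* The model vector space is a subspace E of a Euclidean space, rather than a type,
   so that the dimension of the manifold can be quantified over. *)
definition smooth_manifold ::
  "'e::euclidean_space set \<Rightarrow> 'a topology \<Rightarrow> ('e, 'a) parametrization set \<Rightarrow> bool" where
  "smooth_manifold E T \<A> \<longleftrightarrow>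
     subspace E \<and> Hausdorff_space T \<and> second_countable T \<and>
     topspace T = (\<Union>(W, p)\<in>\<A>. p ` W) \<and>
     (\<forall>(W, p)\<in>\<A>. openin (top_of_set E) W \<and> openin T (p ` W) \<and>
        homeomorphic_map (top_of_set W) (subtopology T (p ` W)) p) \<and>
     (\<forall>(W, p)\<in>\<A>. \<forall>(W', p')\<in>\<A>.
        smooth_on {x \<in> W. p x \<in> p' ` W'} (\<lambda>x. inv_into W' p' (p x)))"

definition smooth_map ::
  "'a topology \<Rightarrow> ('e::euclidean_space, 'a) parametrization set \<Rightarrow>
   'b topology \<Rightarrow> ('f::euclidean_space, 'b) parametrization set \<Rightarrow> ('a \<Rightarrow> 'b) \<Rightarrow> bool" where
  "smooth_map T \<A> T' \<A>' f \<longleftrightarrow>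
     continuous_map T T' f \<and>
     (\<forall>(W, p)\<in>\<A>. \<forall>(W', p')\<in>\<A>'.
        smooth_on {x \<in> W. f (p x) \<in> p' ` W'} (\<lambda>x. inv_into W' p' (f (p x))))"

definition product_atlas ::
  "('e, 'a) parametrization set \<Rightarrow> ('f, 'b) parametrization set \<Rightarrow>
   ('e \<times> 'f, 'a \<times> 'b) parametrization set" where
  "product_atlas \<A> \<B> = {(W \<times> W', map_prod p p') | W p W' p'. (W, p) \<in> \<A> \<and> (W', p') \<in> \<B>}"

(* The inclusion of the manifold into the ambient Euclidean space is a smooth immersion.
   W is open in E, so the derivative within W is determined on E. *)
definition inclusion_is_immersion ::
  "'e::euclidean_space set \<Rightarrow> ('e, 'a::euclidean_space) parametrization set \<Rightarrow> bool" where
  "inclusion_is_immersion E \<A> \<longleftrightarrow>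
     (\<forall>(W, p)\<in>\<A>. smooth_on W p \<and>
        (\<forall>x\<in>W. \<exists>D. (p has_derivative D) (at x within W) \<and> inj_on D E))"

(* T may be strictly finer than the subspace topology of G.  The immersion is into the space of
   all matrices, of which O(1,n) is an embedded submanifold.  Model spaces inside that
   space suffice, since an immersion cannot lower the dimension. *)
definition lie_subgroup_structure ::
  "(real^'m::{finite,zero}^'m::{finite,zero}) set \<Rightarrow> (real^'m::{finite,zero}^'m::{finite,zero}) set \<Rightarrow> (real^'m::{finite,zero}^'m::{finite,zero}) topology \<Rightarrow>
   (real^'m::{finite,zero}^'m::{finite,zero}, real^'m::{finite,zero}^'m::{finite,zero}) parametrization set \<Rightarrow> bool" where
  "lie_subgroup_structure G E T \<A> \<longleftrightarrow>
     G \<subseteq> O1 \<and> mat 1 \<in> G \<and> (\<forall>A\<in>G. \<forall>B\<in>G. A ** B \<in> G) \<and> (\<forall>A\<in>G. matrix_inv A \<in> G) \<and>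
     topspace T = G \<and> smooth_manifold E T \<A> \<and> inclusion_is_immersion E \<A> \<and>
     smooth_map (prod_topology T T) (product_atlas \<A> \<A>) T \<A> (\<lambda>(A, B). A ** B) \<and>
     smooth_map T \<A> T \<A> matrix_inv"

definition connected_lie_subgroup :: "(real^'m::{finite,zero}^'m::{finite,zero}) set \<Rightarrow> bool" where
  "connected_lie_subgroup G \<longleftrightarrow>
     (\<exists>E T \<A>. lie_subgroup_structure G E T \<A> \<and> connected_space T)"

end

theory Submission
  imports Defs
begin

text \<open>
  Write \<open>\<langle>x, y\<rangle>\<close> for the Lorentz form, \<open>so(1,n)\<close> for the matrices that are skew for it, and
  \<open>(a \<and> b) x = \<langle>a, x\<rangle> b - \<langle>b, x\<rangle> a\<close> for the elementary ones among them.

  \<^emph>\<open>Reduction to Lie algebras.\<close>  Let \<open>G\<close> be a connected Lie subgroup and \<open>g\<close> the space of velocities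
  at \<open>1\<close> of curves in \<open>G\<close>.  Because the charts of \<open>G\<close> are immersions, \<open>g\<close> is a linear space, and it is
  stable under conjugation by \<open>G\<close>; differentiating the conjugation shows that it is a subalgebra of
  \<open>so(1,n)\<close>.  A uniqueness argument for a linear differential equation, together with connectedness,
  shows that every \<open>g\<close>-stable subspace of \<open>\<real>\<^sup>1\<^sup>,\<^sup>n\<close> is \<open>G\<close>-stable, so \<open>g\<close> acts irreducibly if \<open>G\<close> does.
  If \<open>g = so(1,n)\<close>, then invariance of domain makes \<open>G\<close> a neighbourhood of \<open>1\<close> in \<open>O(1,n)\<close>, and
  connectedness gives \<open>G = SO(1,n)\<^sub>0\<close>.  What remains is algebra: an irreducible subalgebra \<open>g\<close> of
  \<open>so(1,n)\<close> is all of \<open>so(1,n)\<close> (\<open>irreducible_subalgebra_eq_so1\<close>).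

  \<^emph>\<open>A boost in \<open>g\<close>.\<close>  Let \<open>n \<ge> 1\<close>; for \<open>n = 0\<close> the algebra \<open>so(1,n)\<close> is zero.  Some element of \<open>g\<close> has a nonzero real eigenvalue
  (\<open>irreducible_exists_eigenvector\<close>).  Otherwise every element kills a causal vector, which forces
  \<open>tr X\<^sup>2 \<le> 0\<close> on \<open>g\<close>.  If the trace form is degenerate on \<open>g\<close>, its radical is an ideal that consists of
  nilpotent matrices \<open>n \<and> w\<close> with \<open>n\<close> null; they share one null line, and \<open>g\<close> preserves it.  If it is
  definite, take the Casimir element \<open>C = \<Sum> X\<^sub>i\<^sup>2\<close> of an orthonormal basis.  It commutes with \<open>g\<close>.
  Minimising \<open>\<Sum> \<langle>X\<^sub>i x, X\<^sub>i x\<rangle>\<close> over the hyperboloid \<open>\<langle>x, x\<rangle> = -1\<close> (\<open>causal_minimum\<close>) yields a common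
  null eigenvector of the \<open>X\<^sub>i\<close>, which irreducibility excludes, or a timelike eigenvector of \<open>C\<close> with
  eigenvalue \<open>c \<ge> 0\<close>.  By irreducibility \<open>C = c\<close>, but \<open>tr C = - dim g < 0\<close>.

  \<^emph>\<open>From a boost to everything.\<close>  Let \<open>h \<in> g\<close> have a nonzero real eigenvalue.  It has null eigenvectors
  \<open>p\<close> and \<open>q\<close> for opposite eigenvalues, and it is the sum of a multiple of the boost \<open>p \<and> q\<close> and a
  commuting rotation.  In suitable coordinates \<open>ad h\<close> is a normal operator whose symmetric part is a multiple of
  \<open>ad (p \<and> q)\<close>, so \<open>g\<close> is stable under \<open>ad (p \<and> q)\<close> and is graded by its three eigenvalues,
  which are \<open>0\<close> and two opposite numbers.  With \<open>E\<close> the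
  orthogonal complement of \<open>p\<close> and \<open>q\<close>, the outer pieces are \<open>p \<and> P\<close> and \<open>q \<and> M\<close> for subspaces \<open>P\<close>, \<open>M\<close>
  of \<open>E\<close>.  Irreducibility makes both nonzero, brackets show \<open>P = M\<close>, and then the span of \<open>p\<close>, \<open>q\<close>
  and \<open>P\<close> is stable, so \<open>P = E\<close>; brackets now generate all of \<open>so(1,n)\<close>
  (\<open>boost_invariant_irreducible_eq_so1\<close>).

  \<^emph>\<open>The group itself.\<close>  \<open>SO(1,n)\<^sub>0\<close> is made a manifold modelled on \<open>so(1,n)\<close> by translates of the
  Cayley transform, which is rational, so that all smoothness claims follow from that of the matrix
  inverse.  A subspace stable under \<open>SO(1,n)\<^sub>0\<close> is stable under \<open>so(1,n)\<close>; if it contains \<open>x \<noteq> 0\<close> it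
  contains the hyperplane orthogonal to \<open>x\<close>, and for \<open>n \<noteq> 1\<close> such a subspace cannot be proper.
\<close>

type_synonym 'm square_matrix = "((real, 'm) vec, 'm) vec"

section \<open>The Lorentz form\<close>

lemma lorentz_eq_inner: "lorentz x y = x \<bullet> y - 2 * x $ 0 * y $ 0"
proof -
  have "x \<bullet> y = (\<Sum>i\<in>UNIV. x $ i * y $ i)"
    by (simp add: inner_vec_def)
  also have "\<dots> = x $ 0 * y $ 0 + (\<Sum>i\<in>UNIV - {0}. x $ i * y $ i)"
    by (rule sum.remove) auto
  finally show ?thesis by (simp add: lorentz_def)
qed

lemma lorentz_commute: "lorentz x y = lorentz y x"
  by (simp add: lorentz_eq_inner inner_commute)

lemma lorentz_add_left: "lorentz (x + y) z = lorentz x z + lorentz y z"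
  and lorentz_add_right: "lorentz z (x + y) = lorentz z x + lorentz z y"
  and lorentz_diff_left: "lorentz (x - y) z = lorentz x z - lorentz y z"
  and lorentz_diff_right: "lorentz z (x - y) = lorentz z x - lorentz z y"
  and lorentz_scaleR_left: "lorentz (r *\<^sub>R x) z = r * lorentz x z"
  and lorentz_scaleR_right: "lorentz z (r *\<^sub>R x) = r * lorentz z x"
  and lorentz_minus_left: "lorentz (- x) z = - lorentz x z"
  and lorentz_minus_right: "lorentz z (- x) = - lorentz z x"
  and lorentz_zero_left: "lorentz 0 z = 0"
  and lorentz_zero_right: "lorentz z 0 = 0"
  by (simp_all add: lorentz_eq_inner inner_add inner_diff inner_simps algebra_simps)

lemmas lorentz_simps = lorentz_add_left lorentz_add_right lorentz_diff_left lorentz_diff_right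
  lorentz_scaleR_left lorentz_scaleR_right lorentz_minus_left lorentz_minus_right
  lorentz_zero_left lorentz_zero_right

lemma lorentz_sum_left: "lorentz (\<Sum>i\<in>I. f i) z = (\<Sum>i\<in>I. lorentz (f i) z)"
  by (induction I rule: infinite_finite_induct) (simp_all add: lorentz_simps)

lemma lorentz_axis: "lorentz (axis i 1) x = (if i = 0 then - x $ 0 else x $ i)"
proof -
  have "axis i 1 \<bullet> x = x $ i" "axis i (1::real) $ 0 = (if i = 0 then 1 else 0)"
    by (simp add: inner_axis') (simp add: axis_def)
  then show ?thesis by (simp add: lorentz_eq_inner)
qed

lemma lorentz_nondegenerate:
  assumes "\<And>y. lorentz x y = 0"
  shows "x = 0"
proof -
  have "x $ 0 = 0"
    using assms[of "axis 0 1"] lorentz_commute[of x "axis 0 1"] lorentz_axis[of 0 x] by simp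
  then show ?thesis
    using assms[of x] by (simp add: lorentz_eq_inner)
qed

lemma lorentz_eqI:
  assumes "\<And>z. lorentz x z = lorentz y z"
  shows "x = y"
  using lorentz_nondegenerate[of "x - y"] assms by (simp add: lorentz_simps)

lemma causal_component_0:
  assumes "x \<noteq> 0" "lorentz x x \<le> 0"
  shows "x $ 0 \<noteq> 0"
proof
  assume "x $ 0 = 0"
  then have "lorentz x x = x \<bullet> x" by (simp add: lorentz_eq_inner)
  then show False using assms inner_gt_zero_iff[of x] by linarith
qed

text \<open>
  Subtracting from \<open>y\<close> the multiple of \<open>x\<close> that has the same time component leaves a spatial vector,
  and this does not increase \<open>\<langle>y, y\<rangle>\<close> because \<open>x\<close> is causal and orthogonal to \<open>y\<close>.
\<close>

lemma causal_orthogonal: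
  assumes x: "x \<noteq> 0" "lorentz x x \<le> 0" and y: "lorentz x y = 0"
  shows causal_orthogonal_nonneg: "lorentz y y \<ge> 0"
    and causal_orthogonal_null: "lorentz y y = 0 \<Longrightarrow> \<exists>r. y = r *\<^sub>R x"
proof -
  define r where "r = y $ 0 / x $ 0"
  define z where "z = y - r *\<^sub>R x"
  have "z $ 0 = 0"
    using causal_component_0[OF x] by (simp add: z_def r_def)
  then have "z \<bullet> z = lorentz z z"
    by (simp add: lorentz_eq_inner)
  also have "\<dots> = lorentz y y + r\<^sup>2 * lorentz x x"
    using y lorentz_commute[of y x] by (simp add: z_def lorentz_simps power2_eq_square)
  also have "\<dots> \<le> lorentz y y"
    using x(2) by (simp add: mult_nonneg_nonpos)
  finally have z: "z \<bullet> z \<le> lorentz y y" .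
  show "lorentz y y \<ge> 0"
    using z inner_ge_zero[of z] by linarith
  show "\<exists>r. y = r *\<^sub>R x" if "lorentz y y = 0"
  proof -
    have "z \<bullet> z = 0" using z that inner_ge_zero[of z] by linarith
    then show ?thesis by (auto simp: z_def)
  qed
qed

lemma spacelike_if_component_0:
  assumes "x $ 0 = 0" "x \<noteq> 0"
  shows "lorentz x x > 0"
  using assms by (simp add: lorentz_eq_inner)

section \<open>The Lie algebra so(1,n)\<close>

definition so1 :: "('m::{finite,zero} square_matrix) set" where
  "so1 = {X. \<forall>x y. lorentz (X *v x) y = - lorentz x (X *v y)}"

lemma so1_skew: "X \<in> so1 \<Longrightarrow> lorentz (X *v x) y = - lorentz x (X *v y)"
  by (simp add: so1_def)

lemma so1_orthogonal: "X \<in> so1 \<Longrightarrow> lorentz x (X *v x) = 0"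
  using so1_skew[of X x x] lorentz_commute[of x "X *v x"] by simp

lemma so1_orthogonal': "X \<in> so1 \<Longrightarrow> lorentz (X *v x) x = 0"
  using so1_orthogonal[of X x] lorentz_commute[of x "X *v x"] by simp

lemma matrix_vector_mult_scaleR_left: "(r *\<^sub>R A) *v (x :: real^'n) = r *\<^sub>R (A *v x)"
  by (simp add: scaleR_matrix_vector_assoc)

lemma matrix_vector_mult_minus_left: "(- A) *v (x :: real^'n) = - (A *v x)"
  using matrix_vector_mult_diff_rdistrib[of 0 A x] by simp

lemma matrix_vector_mult_minus_right: "A *v (- x :: real^'n) = - (A *v x)"
  using matrix_vector_mult_diff_distrib[of A 0 x] by simp

lemmas matvec_simps = matrix_vector_mult_scaleR_left matrix_vector_mult_minus_left
  matrix_vector_mult_minus_right matrix_vector_mult_add_rdistrib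
  matrix_vector_mult_diff_rdistrib matrix_vector_right_distrib matrix_vector_mult_diff_distrib
  matrix_vector_mult_scaleR matrix_vector_mul_assoc[symmetric]

lemma bounded_bilinear_matrix_mult:
  "bounded_bilinear ((**) :: real^'n^'m \<Rightarrow> real^'p^'n \<Rightarrow> real^'p^'m)"
proof -
  have "bilinear ((**) :: real^'n^'m \<Rightarrow> real^'p^'n \<Rightarrow> real^'p^'m)"
    unfolding bilinear_def
    by (auto intro!: linearI simp: matrix_eq matvec_simps)
  then show ?thesis by (simp add: bilinear_conv_bounded_bilinear)
qed

lemmas matrix_mult_simps =
  bounded_bilinear.add_left[OF bounded_bilinear_matrix_mult]
  bounded_bilinear.add_right[OF bounded_bilinear_matrix_mult]
  bounded_bilinear.diff_left[OF bounded_bilinear_matrix_mult]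
  bounded_bilinear.diff_right[OF bounded_bilinear_matrix_mult]
  bounded_bilinear.minus_left[OF bounded_bilinear_matrix_mult]
  bounded_bilinear.minus_right[OF bounded_bilinear_matrix_mult]
  bounded_bilinear.zero_left[OF bounded_bilinear_matrix_mult]
  bounded_bilinear.zero_right[OF bounded_bilinear_matrix_mult]
  bounded_bilinear.scaleR_left[OF bounded_bilinear_matrix_mult]
  bounded_bilinear.scaleR_right[OF bounded_bilinear_matrix_mult]

lemma matrix_vector_mult_sum_left: "(\<Sum>i\<in>I. A i) *v (x :: real^'n) = (\<Sum>i\<in>I. A i *v x)"
  by (induction I rule: infinite_finite_induct) (simp_all add: matvec_simps)

lemma subspace_so1: "subspace so1"
  by (auto simp: subspace_def so1_def lorentz_simps matvec_simps)

definition commutator :: "real^'m^'m \<Rightarrow> real^'m^'m \<Rightarrow> real^'m^'m" where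
  "commutator X Y = X ** Y - Y ** X"

lemma commutator_mult_vec: "commutator X Y *v x = X *v (Y *v x) - Y *v (X *v x)"
  by (simp add: commutator_def matvec_simps)

lemma commutator_so1:
  assumes "X \<in> so1" "Y \<in> so1"
  shows "commutator X Y \<in> so1"
  using assms by (auto simp: so1_def commutator_mult_vec lorentz_simps)

definition wedge :: "real^'m::{finite,zero} \<Rightarrow> real^'m::{finite,zero} \<Rightarrow> 'm::{finite,zero} square_matrix" where
  "wedge a b = matrix (\<lambda>x. lorentz a x *\<^sub>R b - lorentz b x *\<^sub>R a)"

lemma wedge_mult_vec: "wedge a b *v x = lorentz a x *\<^sub>R b - lorentz b x *\<^sub>R a"
proof -
  have "linear (\<lambda>x. lorentz a x *\<^sub>R b - lorentz b x *\<^sub>R a)"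
    by (intro linearI) (simp_all add: lorentz_simps algebra_simps)
  then show ?thesis
    unfolding wedge_def linear_matrix_vector_mul_eq[symmetric] by (rule matrix_works)
qed

lemma wedge_so1: "wedge a b \<in> so1"
  by (simp add: so1_def wedge_mult_vec lorentz_simps lorentz_commute)

lemma wedge_simps:
  "wedge (a + a') b = wedge a b + wedge a' b"
  "wedge a (b + b') = wedge a b + wedge a b'"
  "wedge (a - a') b = wedge a b - wedge a' b"
  "wedge a (b - b') = wedge a b - wedge a b'"
  "wedge (r *\<^sub>R a) b = r *\<^sub>R wedge a b"
  "wedge a (r *\<^sub>R b) = r *\<^sub>R wedge a b"
  "wedge (- a) b = - wedge a b"
  "wedge a (- b) = - wedge a b"
  "wedge 0 b = 0"
  "wedge a 0 = 0"
  by (simp_all add: matrix_eq wedge_mult_vec lorentz_simps matvec_simps algebra_simps)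

lemma wedge_swap: "wedge b a = - wedge a b"
  by (simp add: matrix_eq wedge_mult_vec matvec_simps)

lemma commutator_wedge:
  assumes "X \<in> so1"
  shows "commutator X (wedge a b) = wedge (X *v a) b + wedge a (X *v b)"
  using so1_skew[OF assms]
  by (simp add: matrix_eq commutator_mult_vec wedge_mult_vec lorentz_simps matvec_simps)

text \<open>
  The \<open>x \<mapsto> \<langle>e, x\<rangle> X e\<close> halves of the wedges add up to \<open>X\<close> by expansion in the standard basis, and
  skewness turns the other halves into a second copy of \<open>X\<close>.
\<close>

lemma so1_eq_sum_wedge:
  assumes "X \<in> so1"
  shows "X = (1/2) *\<^sub>R (\<Sum>i\<in>UNIV. lorentz (axis i 1) (axis i 1) *\<^sub>R wedge (axis i 1) (X *v axis i 1))"
proof -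
  have expand: "(\<Sum>i\<in>UNIV. (lorentz (axis i 1) (axis i 1) * lorentz (axis i 1) x) *\<^sub>R axis i 1) = x"
    for x :: "real^'m::{finite,zero}"
    by (subst basis_expansion[symmetric, of x], rule sum.cong[OF refl])
      (simp add: lorentz_axis scalar_mult_eq_scaleR)
  show ?thesis
  proof (subst matrix_eq, intro allI)
    fix x
    have 1: "(\<Sum>i\<in>UNIV. (lorentz (axis i 1) (axis i 1) * lorentz (axis i 1) x) *\<^sub>R (X *v axis i 1)) = X *v x"
      (is "?L = _")
    proof -
      have "?L = X *v (\<Sum>i\<in>UNIV. (lorentz (axis i 1) (axis i 1) * lorentz (axis i 1) x) *\<^sub>R axis i 1)"
        by (simp add: linear_sum[OF matrix_vector_mul_linear] matvec_simps)
      then show ?thesis by (simp add: expand)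
    qed
    have 2: "(\<Sum>i\<in>UNIV. (lorentz (axis i 1) (axis i 1) * lorentz (X *v axis i 1) x) *\<^sub>R axis i 1) = - (X *v x)"
      using expand[of "X *v x"] so1_skew[OF assms] by (simp add: sum_negf)
    show "X *v x = (1/2) *\<^sub>R (\<Sum>i\<in>UNIV. lorentz (axis i 1) (axis i 1) *\<^sub>R wedge (axis i 1) (X *v axis i 1)) *v x"
      using 1 2
      by (simp add: matrix_vector_mult_sum_left matvec_simps wedge_mult_vec sum_subtractf
          scaleR_diff_right)
  qed
qed

section \<open>A variational principle on the hyperboloid\<close>

lemma continuous_on_lorentz [continuous_intros]:
  assumes "continuous_on S f" "continuous_on S g"
  shows "continuous_on S (\<lambda>x. lorentz (f x) (g x))"
  unfolding lorentz_eq_inner using assms by (intro continuous_intros)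

lemma continuous_on_matrix_vector_mult [continuous_intros]:
  assumes "continuous_on S f"
  shows "continuous_on S (\<lambda>x. A *v (f x :: real^'n))"
  by (rule bounded_linear.continuous_on[OF matrix_vector_mul_bounded_linear assms])

text \<open>
  Put \<open>Q(x) = \<Sum> \<langle>X\<^sub>i x, X\<^sub>i x\<rangle>\<close>, which is nonnegative on causal vectors since \<open>X\<^sub>i x\<close> is orthogonal
  to \<open>x\<close>, and let \<open>c\<close> be the infimum of \<open>Q(x) / -\<langle>x, x\<rangle>\<close> over timelike \<open>x\<close>.  On the compact set of causal
  unit vectors \<open>Q(x) + c \<langle>x, x\<rangle>\<close> then has minimum \<open>0\<close>.  At a null minimiser each \<open>X\<^sub>i x\<close> is null and
  orthogonal to \<open>x\<close>, hence a multiple of \<open>x\<close>; at a timelike minimiser the first variation vanishes,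
  which is the eigenvalue equation.
\<close>

lemma causal_minimum:
  fixes X :: "'i \<Rightarrow> 'm::{finite,zero} square_matrix"
  assumes fin: "finite I" and X: "\<And>i. i \<in> I \<Longrightarrow> X i \<in> so1"
  shows "(\<exists>v. v \<noteq> 0 \<and> lorentz v v = 0 \<and> (\<forall>i\<in>I. \<exists>r. X i *v v = r *\<^sub>R v)) \<or>
         (\<exists>x c. lorentz x x < 0 \<and> 0 \<le> c \<and> (\<Sum>i\<in>I. X i *v (X i *v x)) = c *\<^sub>R x)"
proof -
  define Q where "Q x = (\<Sum>i\<in>I. lorentz (X i *v x) (X i *v x))" for x
  define K :: "((real, 'm) vec) set" where "K = sphere 0 1 \<inter> {x. lorentz x x \<le> 0}"
  define R where "R = (\<lambda>x. Q x / - lorentz x x) ` {x \<in> K. lorentz x x < 0}"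
  define c where "c = Inf R"
  define f where "f x = Q x + c * lorentz x x" for x
  have Q_nonneg: "lorentz (X i *v x) (X i *v x) \<ge> 0" if "x \<noteq> 0" "lorentz x x \<le> 0" "i \<in> I" for i x
    using causal_orthogonal_nonneg[OF that(1,2)] so1_orthogonal[OF X[OF that(3)]] by blast
  have "compact K"
    unfolding K_def
    by (intro compact_Int_closed compact_sphere closed_Collect_le continuous_intros)
  have K0: "x \<noteq> 0" "lorentz x x \<le> 0" if "x \<in> K" for x
    using that by (auto simp: K_def)
  have Q_K: "Q x \<ge> 0" if "x \<in> K" for x
    unfolding Q_def using Q_nonneg K0[OF that] by (intro sum_nonneg) auto
  have e0: "axis 0 1 \<in> K" "lorentz (axis 0 1 :: (real, 'm) vec) (axis 0 1) = -1"
    by (auto simp: K_def lorentz_axis)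
  have "R \<noteq> {}" using e0 by (auto simp: R_def)
  have R_nonneg: "0 \<le> r" if "r \<in> R" for r
    using that Q_K by (auto simp: R_def intro!: divide_nonneg_nonpos)
  then have bdd: "bdd_below R" by (intro bdd_belowI)
  have c: "0 \<le> c"
    unfolding c_def using \<open>R \<noteq> {}\<close> R_nonneg by (rule cInf_greatest)
  have f_K: "f x \<ge> 0" if "x \<in> K" for x
  proof (cases "lorentz x x < 0")
    case True
    then have "Q x / - lorentz x x \<in> R" using that by (auto simp: R_def)
    then have "c \<le> Q x / - lorentz x x" unfolding c_def using bdd by (rule cInf_lower)
    then have "c * (- lorentz x x) \<le> Q x"
      using True by (subst (asm) pos_le_divide_eq) auto
    then show ?thesis by (simp add: f_def)
  next
    case False
    then show ?thesis using Q_K[OF that] K0(2)[OF that] by (simp add: f_def)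
  qed
  have "continuous_on K f" unfolding f_def Q_def by (intro continuous_intros)
  then obtain x where x: "x \<in> K" and min: "\<And>y. y \<in> K \<Longrightarrow> f x \<le> f y"
    using continuous_attains_inf[OF \<open>compact K\<close>, of f] e0 by blast
  have "f x = 0"
  proof (rule ccontr)
    assume "f x \<noteq> 0"
    then have pos: "f x > 0" using f_K[OF x] by simp
    have "c + f x \<le> r" if "r \<in> R" for r
    proof -
      from that obtain y where y: "y \<in> K" "lorentz y y < 0" "r = Q y / - lorentz y y"
        by (auto simp: R_def)
      have "\<bar>y $ 0\<bar> \<le> 1"
        using component_le_norm_cart[of y 0] y(1) by (simp add: K_def)
      then have "(y $ 0)\<^sup>2 \<le> 1" by (simp add: abs_square_le_1)
      moreover have "y \<bullet> y = 1" using y(1) by (simp add: K_def norm_eq_1)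
      ultimately have "- lorentz y y \<le> 1" by (simp add: lorentz_eq_inner power2_eq_square)
      then have "f x * (- lorentz y y) \<le> f x * 1"
        using pos by (intro mult_left_mono) auto
      then have "f x * (- lorentz y y) \<le> f y" using min[OF y(1)] by simp
      then have "(c + f x) * (- lorentz y y) \<le> Q y"
        by (simp add: f_def[of y] algebra_simps)
      then show ?thesis
        unfolding y(3) using y(2) by (subst pos_le_divide_eq) auto
    qed
    then have "c + f x \<le> c"
      using cInf_greatest[OF \<open>R \<noteq> {}\<close>] c_def by blast
    then show False using pos by simp
  qed
  show ?thesis
  proof (cases "lorentz x x < 0")
    case False
    then have null: "lorentz x x = 0" using K0[OF x] by simp
    then have "Q x = 0" using \<open>f x = 0\<close> by (simp add: f_def)
    then have "lorentz (X i *v x) (X i *v x) = 0" if "i \<in> I" for i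
      using that Q_nonneg K0[OF x] fin unfolding Q_def by (subst (asm) sum_nonneg_eq_0_iff) auto
    then have "\<exists>r. X i *v x = r *\<^sub>R x" if "i \<in> I" for i
      using that causal_orthogonal_null[OF K0[OF x]] so1_orthogonal[OF X[OF that]] by blast
    then show ?thesis using null K0[OF x] by blast
  next
    case True
    have f_timelike: "f y \<ge> 0" if "lorentz y y < 0" for y
    proof -
      have "y \<noteq> 0" using that by (auto simp: lorentz_simps)
      then have "(1 / norm y) *\<^sub>R y \<in> K"
        using that by (simp add: K_def lorentz_simps divide_nonpos_nonneg)
      then have "f ((1 / norm y) *\<^sub>R y) \<ge> 0" by (rule f_K)
      also have "f ((1 / norm y) *\<^sub>R y) = (1 / norm y)\<^sup>2 * f y"
        by (simp add: f_def Q_def lorentz_simps matvec_simps power2_eq_square algebra_simps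
            sum_distrib_left sum_distrib_right)
      finally show ?thesis using \<open>y \<noteq> 0\<close> by (simp add: zero_le_mult_iff)
    qed
    \<comment> \<open>the timelike cone is open, so the minimum \<open>x\<close> of \<open>f\<close> is interior and its first variation vanishes\<close>
    have var: "(\<Sum>i\<in>I. lorentz (X i *v x) (X i *v z)) + c * lorentz x z = 0" (is "?b = 0") for z
    proof -
      have expand: "f (x + t *\<^sub>R z) = f z * t\<^sup>2 + 2 * ?b * t" for t
      proof -
        have "f (x + t *\<^sub>R z) = f x + f z * t\<^sup>2 + 2 * ?b * t"
          using lorentz_commute[of z x] lorentz_commute[of "X _ *v z" "X _ *v x"]
          by (simp add: f_def Q_def lorentz_simps matvec_simps power2_eq_square algebra_simps
              sum.distrib sum_distrib_left sum_distrib_right)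
        then show ?thesis using \<open>f x = 0\<close> by simp
      qed
      have "open ((\<lambda>t. lorentz (x + t *\<^sub>R z) (x + t *\<^sub>R z)) -` {..<0})"
        by (intro open_vimage continuous_intros)
      moreover have "0 \<in> (\<lambda>t. lorentz (x + t *\<^sub>R z) (x + t *\<^sub>R z)) -` {..<0}"
        using True by simp
      ultimately obtain d where "d > 0"
        "ball 0 d \<subseteq> (\<lambda>t. lorentz (x + t *\<^sub>R z) (x + t *\<^sub>R z)) -` {..<0}"
        by (rule openE)
      then have d: "d > 0" "\<And>t. \<bar>t\<bar> < d \<Longrightarrow> lorentz (x + t *\<^sub>R z) (x + t *\<^sub>R z) < 0"
        by (auto simp: subset_iff dist_real_def)
      have "((\<lambda>t. f z * t\<^sup>2 + 2 * ?b * t) has_real_derivative 2 * ?b) (at 0)"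
        by (auto intro!: derivative_eq_intros)
      then have "2 * ?b = 0"
      proof (rule DERIV_local_min[OF _ d(1)], intro allI impI)
        fix t :: real assume "\<bar>0 - t\<bar> < d"
        then have "0 \<le> f (x + t *\<^sub>R z)" using d(2)[of t] f_timelike by simp
        then show "f z * 0\<^sup>2 + 2 * ?b * 0 \<le> f z * t\<^sup>2 + 2 * ?b * t" by (simp add: expand)
      qed
      then show ?thesis by simp
    qed
    have "(\<Sum>i\<in>I. X i *v (X i *v x)) = c *\<^sub>R x"
    proof (rule lorentz_eqI)
      fix z
      have "(\<Sum>i\<in>I. lorentz (X i *v (X i *v x)) z) = - (\<Sum>i\<in>I. lorentz (X i *v x) (X i *v z))"
        unfolding sum_negf[symmetric] by (intro sum.cong refl so1_skew X)
      then show "lorentz (\<Sum>i\<in>I. X i *v (X i *v x)) z = lorentz (c *\<^sub>R x) z"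
        using var[of z] by (simp add: lorentz_sum_left lorentz_simps)
    qed
    then show ?thesis using True c by blast
  qed
qed

text \<open>
  This is the variational principle for a single matrix: if \<open>X\<^sup>2 x = c x\<close> with \<open>x\<close> timelike and \<open>c > 0\<close>,
  then \<open>X x + \<surd>c x\<close> is an eigenvector for \<open>\<surd>c\<close>.
\<close>

lemma so1_eigenvector_or_causal_kernel:
  assumes X: "X \<in> so1"
  shows "(\<exists>v r. v \<noteq> 0 \<and> r \<noteq> 0 \<and> X *v v = r *\<^sub>R v) \<or>
         (\<exists>v. v \<noteq> 0 \<and> lorentz v v \<le> 0 \<and> X *v v = 0)"
proof -
  consider (null) v r where "v \<noteq> 0" "lorentz v v = 0" "X *v v = r *\<^sub>R v"
    | (timelike) x c where "lorentz x x < 0" "0 \<le> c" "X *v (X *v x) = c *\<^sub>R x"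
    using causal_minimum[of "{()}" "\<lambda>_. X"] X by auto
  then show ?thesis
  proof cases
    case null
    then show ?thesis by (cases "r = 0") auto
  next
    case timelike
    then have "x \<noteq> 0" by (auto simp: lorentz_simps)
    show ?thesis
    proof (cases "c = 0")
      case True
      have "lorentz (X *v x) (X *v x) = 0"
        using so1_skew[OF X, of x "X *v x"] timelike True by (simp add: lorentz_simps)
      then obtain r where r: "X *v x = r *\<^sub>R x"
        using causal_orthogonal_null[OF \<open>x \<noteq> 0\<close> _ so1_orthogonal[OF X]] timelike(1) by force
      then have "r * lorentz x x = 0"
        using so1_orthogonal[OF X, of x] by (simp add: lorentz_simps)
      then have "X *v x = 0" using r timelike(1) by auto
      then show ?thesis using \<open>x \<noteq> 0\<close> timelike(1) by force
    next
      case False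
      define v where "v = X *v x + sqrt c *\<^sub>R x"
      have "lorentz v x = sqrt c * lorentz x x"
        using so1_orthogonal'[OF X, of x] by (simp add: v_def lorentz_simps)
      then have "v \<noteq> 0" using timelike False by (auto simp: lorentz_simps)
      moreover have "X *v v = sqrt c *\<^sub>R v"
        using timelike by (simp add: v_def matvec_simps scaleR_add_right)
      moreover have "sqrt c \<noteq> 0" using False by simp
      ultimately show ?thesis by blast
    qed
  qed
qed

section \<open>The trace form on elements without real eigenvalues\<close>

lemma trace_eq_sum_axis: "trace A = (\<Sum>i\<in>UNIV. (A *v axis i 1) \<bullet> axis i 1)"
  for A :: "real^'n^'n"
  by (simp add: trace_def matrix_vector_mult_basis inner_axis column_def)

lemma trace_mult_wedge:
  fixes M :: "'m::{finite,zero} square_matrix"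
  shows "trace (M ** wedge a b) = lorentz a (M *v b) - lorentz b (M *v a)"
proof -
  have "(\<Sum>i\<in>UNIV. lorentz a (axis i 1) * y $ i) = lorentz a y" for a y :: "(real, 'm) vec"
  proof -
    have "lorentz (axis i 1) a * y $ i = lorentz (y $ i *\<^sub>R axis i 1) a" for i
      by (simp add: lorentz_simps)
    then have "(\<Sum>i\<in>UNIV. lorentz (axis i 1) a * y $ i) = lorentz (\<Sum>i\<in>UNIV. y $ i *s axis i 1) a"
      by (simp add: lorentz_sum_left scalar_mult_eq_scaleR)
    then show ?thesis by (simp only: basis_expansion lorentz_commute[of a])
  qed
  then show ?thesis
    by (simp add: trace_eq_sum_axis matvec_simps wedge_mult_vec inner_diff_left inner_axis
        sum_subtractf)
qed

text \<open>
  Such an \<open>X\<close> is skew also for the Euclidean inner product, so \<open>tr X\<^sup>2\<close> is minus its squared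
  Frobenius norm.
\<close>

lemma trace_square_nonpos_if_fixes_axis:
  assumes X: "X \<in> so1" and kernel: "X *v axis 0 1 = 0"
  shows "trace (X ** X) \<le> 0" and "trace (X ** X) = 0 \<Longrightarrow> X = 0"
proof -
  have "(X *v x) $ 0 = 0" for x
    using so1_skew[OF X, of "axis 0 1" x] kernel by (simp add: lorentz_simps lorentz_axis)
  then have skew: "(X *v x) \<bullet> y = - (x \<bullet> (X *v y))" for x y
    using so1_skew[OF X, of x y] by (simp add: lorentz_eq_inner)
  have tr: "trace (X ** X) = - (\<Sum>i\<in>UNIV. (X *v axis i 1) \<bullet> (X *v axis i 1))"
    by (simp add: trace_eq_sum_axis matvec_simps skew sum_negf)
  then show "trace (X ** X) \<le> 0" by (simp add: sum_nonneg)
  assume "trace (X ** X) = 0"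
  then have "X *v axis i 1 = 0" for i
    unfolding tr by (simp add: sum_nonneg_eq_0_iff)
  then show "X = 0"
    by (simp add: matrix_vector_mult_basis column_def vec_eq_iff)
qed

text \<open>
  Normalise the causal kernel vector to \<open>e + u\<close> with \<open>e\<close> the time axis and \<open>u\<close> spatial, \<open>|u| \<le> 1\<close>, and
  put \<open>b = X e\<close>.  For \<open>u \<noteq> 0\<close> and \<open>a = e + u / |u|\<^sup>2\<close> the matrix \<open>D = X + a \<and> b\<close> kills both \<open>e\<close> and \<open>u\<close>,
  and the cross terms vanish in
  \<open>tr X\<^sup>2 = tr D\<^sup>2 - 2 (|u|\<^sup>-\<^sup>2 - 1) |b|\<^sup>2\<close>.  Both summands are nonpositive, and they vanish together only if
  \<open>D = 0\<close> and, in addition, \<open>|u| = 1\<close> or \<open>b = 0\<close>; then \<open>X\<close> is zero or the wedge of the null vector \<open>a\<close> with \<open>- b\<close>.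
\<close>

lemma trace_square_causal_kernel:
  fixes X :: "'m::{finite,zero} square_matrix"
  assumes X: "X \<in> so1" and v: "v \<noteq> 0" "lorentz v v \<le> 0" "X *v v = 0"
  shows trace_square_nonpos: "trace (X ** X) \<le> 0"
    and trace_square_eq_0: "trace (X ** X) = 0 \<Longrightarrow> X \<noteq> 0 \<Longrightarrow>
      \<exists>n w. X = wedge n w \<and> n \<noteq> 0 \<and> lorentz n n = 0 \<and> lorentz n w = 0 \<and> lorentz w w > 0"
proof -
  define e :: "(real, 'm) vec" where "e = axis 0 1"
  define b where "b = X *v e"
  define u where "u = (1 / v $ 0) *\<^sub>R v - e"
  have v0: "v $ 0 \<noteq> 0" using causal_component_0 v by blast
  have e: "lorentz e e = -1" "lorentz e x = - x $ 0" for x by (simp_all add: e_def lorentz_axis)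
  have u0: "u $ 0 = 0" using v0 by (simp add: u_def e_def)
  have eu: "e + u = (1 / v $ 0) *\<^sub>R v" by (simp add: u_def)
  have Xu: "X *v u = - b" by (simp add: u_def b_def matvec_simps v)
  have b0: "lorentz e b = 0" using so1_orthogonal[OF X] by (simp add: b_def)
  have bu: "lorentz b u = 0"
    using so1_skew[OF X, of e u] Xu b0 by (simp add: b_def lorentz_simps)
  have "lorentz (e + u) (e + u) \<le> 0"
    using v(2) unfolding eu by (simp add: lorentz_simps divide_nonpos_nonneg)
  then have uu: "lorentz u u \<le> 1"
    using u0 e lorentz_commute[of u e] by (simp add: lorentz_simps)
  have "trace (X ** X) \<le> 0 \<and> (trace (X ** X) = 0 \<longrightarrow> X \<noteq> 0 \<longrightarrow>
      (\<exists>n w. X = wedge n w \<and> n \<noteq> 0 \<and> lorentz n n = 0 \<and> lorentz n w = 0 \<and> lorentz w w > 0))"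
  proof (cases "u = 0")
    case True
    then have "b = 0" using Xu by simp
    then show ?thesis
      using trace_square_nonpos_if_fixes_axis[OF X] by (auto simp: b_def e_def)
  next
    case False
    define s where "s = 1 / lorentz u u"
    have "lorentz u u > 0" using spacelike_if_component_0 u0 False by blast
    then have s: "s \<ge> 1" "s * lorentz u u = 1" using uu by (simp_all add: s_def)
    define a where "a = e + s *\<^sub>R u"
    define D where "D = X + wedge a b"
    have "lorentz a a = -1 + s * (s * lorentz u u)"
      using u0 e lorentz_commute[of u e] by (simp add: a_def lorentz_simps)
    then have aa: "lorentz a a = s - 1" using s(2) by simp
    have ab: "lorentz a b = 0" using b0 bu lorentz_commute[of u b] by (simp add: a_def lorentz_simps)
    have D: "D \<in> so1" using subspace_add[OF subspace_so1 X wedge_so1] by (simp add: D_def)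
    have ae: "lorentz a e = -1" and au: "lorentz a u = 1"
      using u0 e lorentz_commute[of u e] s(2) by (simp_all add: a_def lorentz_simps)
    have De: "D *v e = 0"
      using ae b0 lorentz_commute[of b e] by (simp add: D_def b_def[symmetric] matvec_simps wedge_mult_vec)
    have Du: "D *v u = 0"
      using au bu Xu by (simp add: D_def matvec_simps wedge_mult_vec)
    have Da: "D *v a = 0" by (simp add: a_def matvec_simps De Du)
    have "lorentz a (D *v b) = 0" using so1_skew[OF D, of a b] Da by (simp add: lorentz_simps)
    then have cross: "trace (D ** wedge a b) = 0" "trace (wedge a b ** D) = 0"
      using Da by (simp_all add: trace_mult_wedge lorentz_simps trace_mul_sym[of "wedge a b"])
    have "X = D - wedge a b" by (simp add: D_def)
    then have "trace (X ** X) = trace ((D - wedge a b) ** D) - trace ((D - wedge a b) ** wedge a b)"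
      by (simp add: matrix_mult_simps trace_sub)
    also have "\<dots> = trace (D ** D) + trace (wedge a b ** wedge a b)"
      by (simp add: matrix_mult_simps trace_sub cross)
    also have "trace (wedge a b ** wedge a b) = - 2 * (s - 1) * lorentz b b"
      using ab lorentz_commute[of b a] by (simp add: trace_mult_wedge wedge_mult_vec lorentz_simps aa algebra_simps)
    finally have tr: "trace (X ** X) = trace (D ** D) - 2 * ((s - 1) * lorentz b b)" by (simp add: algebra_simps)
    note trD = trace_square_nonpos_if_fixes_axis[OF D De[unfolded e_def]]
    have b_comp: "b $ 0 = 0" using b0 e by simp
    have "lorentz b b \<ge> 0" using b_comp by (simp add: lorentz_eq_inner)
    then have le: "trace (D ** D) \<le> 0" "(s - 1) * lorentz b b \<ge> 0"
      using trD(1) s by (auto simp: mult_nonneg_nonneg)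
    show ?thesis
    proof (intro conjI impI)
      show "trace (X ** X) \<le> 0" using tr le by linarith
      assume "trace (X ** X) = 0" "X \<noteq> 0"
      then have "trace (D ** D) = 0" "(s - 1) * lorentz b b = 0" using tr le by linarith+
      then have "D = 0" using trD by blast
      then have Xab: "X = wedge a (- b)"
        using wedge_simps(6)[of a "-1" b] by (simp add: D_def add_eq_0_iff2)
      then have "b \<noteq> 0" using \<open>X \<noteq> 0\<close> by (auto simp: matrix_eq wedge_mult_vec lorentz_simps)
      then have bb: "lorentz b b > 0" using spacelike_if_component_0 b_comp by blast
      then have "lorentz a a = 0" using \<open>(s - 1) * lorentz b b = 0\<close> aa by simp
      moreover have "a \<noteq> 0" using ae by (auto simp: lorentz_simps)
      ultimately show "\<exists>n w. X = wedge n w \<and> n \<noteq> 0 \<and> lorentz n n = 0 \<and> lorentz n w = 0 \<and> lorentz w w > 0"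
        using Xab ab bb by (intro exI[of _ a] exI[of _ "- b"]) (simp add: lorentz_simps)
    qed
  qed
  then show "trace (X ** X) \<le> 0"
    "trace (X ** X) = 0 \<Longrightarrow> X \<noteq> 0 \<Longrightarrow>
      \<exists>n w. X = wedge n w \<and> n \<noteq> 0 \<and> lorentz n n = 0 \<and> lorentz n w = 0 \<and> lorentz w w > 0"
    by blast+
qed

section \<open>Existence of an element with a real eigenvalue\<close>

text \<open>
  Gram--Schmidt for a form that is positive definite on \<open>S\<close> only, as the negative of the trace form will be on a subalgebra.
\<close>

lemma exists_orthonormal_basis_bilinear:
  fixes \<beta> :: "'a::euclidean_space \<Rightarrow> 'a \<Rightarrow> real"
  assumes "bilinear \<beta>" and sym: "\<And>x y. \<beta> x y = \<beta> y x"
    and "subspace S" and "\<And>x. x \<in> S \<Longrightarrow> x \<noteq> 0 \<Longrightarrow> \<beta> x x > 0"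
  shows "\<exists>B. finite B \<and> B \<subseteq> S \<and> (\<forall>b\<in>B. \<beta> b b = 1) \<and> (\<forall>y\<in>S. y = (\<Sum>b\<in>B. \<beta> y b *\<^sub>R b))"
  using assms(3,4)
proof (induction "dim S" arbitrary: S rule: less_induct)
  case less
  note bil = bilinear_ladd[OF assms(1)] bilinear_radd[OF assms(1)] bilinear_lmul[OF assms(1)]
    bilinear_rmul[OF assms(1)] bilinear_lsub[OF assms(1)] bilinear_rsub[OF assms(1)]
    bilinear_lzero[OF assms(1)] bilinear_rzero[OF assms(1)]
  show ?case
  proof (cases "S = {0}")
    case True
    then show ?thesis by (intro exI[of _ "{}"]) auto
  next
    case False
    then obtain x0 where x0: "x0 \<in> S" "x0 \<noteq> 0"
      using subspace_0[OF less.prems(1)] by blast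
    define x where "x = (1 / sqrt (\<beta> x0 x0)) *\<^sub>R x0"
    have "\<beta> x0 x0 > 0" using less.prems(2) x0 by blast
    then have x: "x \<in> S" "\<beta> x x = 1"
      using x0 subspace_scale[OF less.prems(1)] by (auto simp: x_def bil)
    define T where "T = {y \<in> S. \<beta> x y = 0}"
    have T: "subspace T"
      using less.prems(1) by (auto simp: T_def subspace_def bil)
    have "x \<notin> T" "T \<subseteq> S" using x by (auto simp: T_def)
    then have "T \<subset> S" using x by blast
    then have "dim T < dim S"
      using T less.prems(1) by (metis dim_psubset span_eq_iff)
    then obtain B where B: "finite B" "B \<subseteq> T" "\<forall>b\<in>B. \<beta> b b = 1"
      "\<And>y. y \<in> T \<Longrightarrow> y = (\<Sum>b\<in>B. \<beta> y b *\<^sub>R b)"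
      using less.hyps[OF _ T] less.prems(2) by (auto simp: T_def)
    have xB: "\<beta> x b = 0" if "b \<in> B" for b using that B(2) by (auto simp: T_def)
    have "x \<notin> B" using xB x by force
    have expand: "y = (\<Sum>b\<in>insert x B. \<beta> y b *\<^sub>R b)" if "y \<in> S" for y
    proof -
      have "y - \<beta> y x *\<^sub>R x \<in> T"
        using that x less.prems(1) sym[of x y]
        by (auto simp: T_def bil subspace_diff subspace_scale)
      then have "y - \<beta> y x *\<^sub>R x = (\<Sum>b\<in>B. \<beta> (y - \<beta> y x *\<^sub>R x) b *\<^sub>R b)"
        by (rule B(4))
      also have "\<dots> = (\<Sum>b\<in>B. \<beta> y b *\<^sub>R b)"
        by (rule sum.cong) (auto simp: bil xB)
      finally show ?thesis
        using B(1) \<open>x \<notin> B\<close> by (simp add: algebra_simps)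
    qed
    have "B \<subseteq> S" using B(2) by (auto simp: T_def)
    then show ?thesis
      using B x expand by (intro exI[of _ "insert x B"]) auto
  qed
qed

lemma irreducible_no_common_eigenvector:
  assumes irr: "acts_irreducibly (g :: (real^'m^'m) set)" and card: "CARD('m) \<ge> 2" and "v \<noteq> 0"
    and eig: "\<And>X. X \<in> g \<Longrightarrow> \<exists>r. X *v v = r *\<^sub>R v"
  shows False
proof -
  have "X *v x \<in> span {v}" if "X \<in> g" "x \<in> span {v}" for X x
    using eig[OF that(1)] that(2) by (auto simp: span_singleton matvec_simps)
  then have "span {v} = {0} \<or> span {v} = UNIV"
    using irr subspace_span[of "{v}"] unfolding acts_irreducibly_def by blast
  then have "span {v} = UNIV" using \<open>v \<noteq> 0\<close> span_base[of v "{v}"] by auto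
  then have "dim (UNIV :: (real^'m) set) = dim {v}" by (metis dim_span)
  then show False using card \<open>v \<noteq> 0\<close> by (simp add: dim_insert)
qed

lemma trace_scaleR: "trace (r *\<^sub>R A) = r * trace A" for A :: "real^'n^'n"
  by (simp add: trace_def sum_distrib_left)

lemma trace_sum: "trace (\<Sum>i\<in>I. A i) = (\<Sum>i\<in>I. trace (A i))" for A :: "'i \<Rightarrow> real^'n^'n"
  by (induction I rule: infinite_finite_induct) (simp_all add: trace_0[unfolded mat_0] trace_add)

lemma bilinear_trace_form: "bilinear (\<lambda>X Y :: real^'n^'n. - trace (X ** Y))"
  unfolding bilinear_def
  by (intro conjI allI linearI) (simp_all add: matrix_mult_simps trace_add trace_scaleR)

text \<open>
  Invariance of the trace form under the adjoint action.
\<close>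

lemma trace_commutator:
  "trace (commutator Y X ** Z) = - trace (X ** commutator Y Z)"
  for X :: "real^'n^'n"
proof -
  have "trace (Y ** X ** Z) = trace (X ** Z ** Y)"
    using trace_mul_sym[of Y "X ** Z"] by (simp add: matrix_mul_assoc)
  then show ?thesis
    by (simp add: commutator_def matrix_mult_simps trace_sub matrix_mul_assoc)
qed

text \<open>
  For an orthonormal basis \<open>B\<close> of \<open>g\<close> with respect to \<open>- tr (X Y)\<close> the Casimir element \<open>C = \<Sum> b\<^sup>2\<close> commutes
  with \<open>g\<close>, because the matrix of \<open>ad Y\<close> in the basis \<open>B\<close> is antisymmetric.  Its trace is \<open>- card B\<close>,
  whereas the variational principle and irreducibility give \<open>C = c\<close> with \<open>c \<ge> 0\<close>.  So \<open>B\<close> is empty and \<open>g = 0\<close>,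
  which is not irreducible.
\<close>

lemma casimir_contradiction:
  fixes g :: "('m::{finite,zero} square_matrix) set"
  assumes g: "subspace g" "g \<subseteq> so1" and br: "\<And>X Y. X \<in> g \<Longrightarrow> Y \<in> g \<Longrightarrow> commutator X Y \<in> g"
    and irr: "acts_irreducibly g" and card: "CARD('m) \<ge> 2"
    and neg: "\<And>X. X \<in> g \<Longrightarrow> X \<noteq> 0 \<Longrightarrow> trace (X ** X) < 0"
  shows False
proof -
  obtain B where B: "finite B" "B \<subseteq> g" "\<And>b. b \<in> B \<Longrightarrow> - trace (b ** b) = 1"
    and expand: "\<And>Y. Y \<in> g \<Longrightarrow> Y = (\<Sum>b\<in>B. - trace (Y ** b) *\<^sub>R b)"
    using exists_orthonormal_basis_bilinear[OF bilinear_trace_form _ g(1)] neg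
      trace_mul_sym by (smt (verit, best))
  define C where "C = (\<Sum>b\<in>B. b ** b)"
  have comm: "Y ** C = C ** Y" if Y: "Y \<in> g" for Y
  proof -
    define a where "a b c = - trace (commutator Y b ** c)" for b c
    have anti: "a c b = - a b c" for b c
      using trace_commutator[of Y b c] trace_mul_sym[of b "commutator Y c"] by (simp add: a_def)
    have Yb: "commutator Y b = (\<Sum>c\<in>B. a b c *\<^sub>R c)" if "b \<in> B" for b
      unfolding a_def using that B(2) Y by (intro expand br) auto
    have "Y ** C - C ** Y = (\<Sum>b\<in>B. commutator Y b ** b + b ** commutator Y b)"
      unfolding C_def
      by (simp add: bounded_bilinear.sum_left[OF bounded_bilinear_matrix_mult]
          bounded_bilinear.sum_right[OF bounded_bilinear_matrix_mult] sum_subtractf[symmetric]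
          commutator_def matrix_mult_simps matrix_mul_assoc)
    also have "\<dots> = (\<Sum>b\<in>B. \<Sum>c\<in>B. a b c *\<^sub>R (c ** b)) + (\<Sum>b\<in>B. \<Sum>c\<in>B. a b c *\<^sub>R (b ** c))"
      by (simp add: Yb sum.distrib bounded_bilinear.sum_left[OF bounded_bilinear_matrix_mult]
          bounded_bilinear.sum_right[OF bounded_bilinear_matrix_mult] matrix_mult_simps)
    also have "(\<Sum>b\<in>B. \<Sum>c\<in>B. a b c *\<^sub>R (c ** b)) = (\<Sum>b\<in>B. \<Sum>c\<in>B. a c b *\<^sub>R (b ** c))"
      by (rule sum.swap)
    also have "(\<Sum>b\<in>B. \<Sum>c\<in>B. a c b *\<^sub>R (b ** c)) = - (\<Sum>b\<in>B. \<Sum>c\<in>B. a b c *\<^sub>R (b ** c))"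
      unfolding sum_negf[symmetric] by (intro sum.cong refl, subst anti) simp
    finally show ?thesis by simp
  qed
  have "\<not> (\<exists>v. v \<noteq> 0 \<and> lorentz v v = 0 \<and> (\<forall>b\<in>B. \<exists>r. b *v v = r *\<^sub>R v))"
  proof clarify
    fix v assume v: "v \<noteq> 0" "\<forall>b\<in>B. \<exists>r. b *v v = r *\<^sub>R v"
    then obtain r where r: "\<And>b. b \<in> B \<Longrightarrow> b *v v = r b *\<^sub>R v" by metis
    have "\<exists>r. Y *v v = r *\<^sub>R v" if "Y \<in> g" for Y
    proof -
      have "Y *v v = (\<Sum>b\<in>B. - trace (Y ** b) *\<^sub>R b) *v v"
        using expand[OF that] by simp
      also have "\<dots> = (\<Sum>b\<in>B. (- trace (Y ** b) * r b) *\<^sub>R v)"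
        unfolding matrix_vector_mult_sum_left by (rule sum.cong) (simp_all add: matvec_simps r)
      also have "\<dots> = (\<Sum>b\<in>B. - trace (Y ** b) * r b) *\<^sub>R v"
        by (rule scaleR_sum_left[symmetric])
      finally show ?thesis by blast
    qed
    then show False using irreducible_no_common_eigenvector[OF irr card v(1)] by blast
  qed
  then obtain x c where x: "lorentz x x < 0" "0 \<le> c" "(\<Sum>b\<in>B. b *v (b *v x)) = c *\<^sub>R x"
    using causal_minimum[OF B(1), of "\<lambda>b. b"] B(2) g(2) by blast
  have Cx: "C *v x = c *\<^sub>R x"
    using x(3) by (simp add: C_def matrix_vector_mult_sum_left matvec_simps)
  define S where "S = {y. C *v y = c *\<^sub>R y}"
  have "subspace S" by (auto simp: S_def subspace_def matvec_simps scaleR_add_right)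
  moreover have "Y *v y \<in> S" if "Y \<in> g" "y \<in> S" for Y y
  proof -
    have "C *v (Y *v y) = Y *v (C *v y)" using comm[OF that(1)] by (simp add: matrix_vector_mul_assoc)
    then show ?thesis using that(2) by (simp add: S_def matvec_simps)
  qed
  ultimately have "S = {0} \<or> S = UNIV" using irr unfolding acts_irreducibly_def by blast
  moreover have "x \<in> S" "x \<noteq> 0" using Cx x(1) by (auto simp: S_def lorentz_simps)
  ultimately have "S = UNIV" by blast
  then have "C = c *\<^sub>R mat 1"
    by (auto simp: S_def matrix_eq matvec_simps)
  then have "trace C = c * CARD('m)" by (simp add: trace_scaleR trace_I)
  moreover have "trace C = (\<Sum>b\<in>B. - 1)"
    unfolding C_def trace_sum using B(3) by (intro sum.cong) force+
  ultimately have "c * CARD('m) = - real (card B)" by simp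
  moreover have "c * CARD('m) \<ge> 0" using x(2) by simp
  ultimately have "B = {}" using B(1) by simp
  then have "Y = 0" if "Y \<in> g" for Y using expand[OF that] by simp
  then have "\<exists>r. Y *v x = r *\<^sub>R x" if "Y \<in> g" for Y using that by (metis matrix_vector_mult_0 scaleR_zero_left)
  then show False using irreducible_no_common_eigenvector[OF irr card \<open>x \<noteq> 0\<close>] by blast
qed

lemma wedge_null_cube:
  assumes "lorentz n n = 0" "lorentz n w = 0"
  shows "wedge n w *v (wedge n w *v (wedge n w *v x)) = 0"
  using assms lorentz_commute[of w n] by (simp add: wedge_mult_vec lorentz_simps)

text \<open>
  If \<open>n\<close> and \<open>p\<close> are not parallel, \<open>w\<close> and \<open>z\<close> may be replaced by vectors \<open>w'\<close> and \<open>z'\<close> orthogonal to both, since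
  adding a multiple of \<open>n\<close> to \<open>w\<close> does not change \<open>n \<and> w\<close>.  The cube of the sum then sends \<open>n\<close> to a
  nonzero multiple of \<open>\<langle>w', z'\<rangle> z' + \<langle>z', z'\<rangle> w'\<close>, which is not
  zero: pairing it with \<open>z'\<close> would give \<open>\<langle>w', z'\<rangle> = 0\<close> and then \<open>w' = 0\<close>.
\<close>

lemma wedge_null_parallel:
  assumes n: "n \<noteq> 0" "lorentz n n = 0" "lorentz n w = 0" "lorentz w w > 0"
    and p: "lorentz p p = 0" "lorentz p z = 0" "lorentz z z > 0"
    and cube: "\<And>x. (wedge n w + wedge p z) *v ((wedge n w + wedge p z) *v ((wedge n w + wedge p z) *v x)) = 0"
  shows "\<exists>r. p = r *\<^sub>R n"
proof (rule ccontr)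
  assume "\<nexists>r. p = r *\<^sub>R n"
  then have k: "lorentz n p \<noteq> 0" (is "?k \<noteq> 0")
    using causal_orthogonal_null[OF n(1), of p] n(2) p(1) by auto
  define w' where "w' = w - (lorentz w p / ?k) *\<^sub>R n"
  define z' where "z' = z - (lorentz z n / ?k) *\<^sub>R p"
  have w': "lorentz n w' = 0" "lorentz w' n = 0" "lorentz w' p = 0" "lorentz p w' = 0" "lorentz w' w' > 0"
    using n k by (simp_all add: w'_def lorentz_simps lorentz_commute[of p w] lorentz_commute[of p n] lorentz_commute[of w n])
  have z': "lorentz n z' = 0" "lorentz z' n = 0" "lorentz z' p = 0" "lorentz p z' = 0" "lorentz z' z' > 0"
    using p k by (simp_all add: z'_def lorentz_simps lorentz_commute[of n z] lorentz_commute[of p n] lorentz_commute[of z p])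
  have "wedge n n = 0" "wedge p p = 0" by (simp_all add: matrix_eq wedge_mult_vec)
  then have M: "wedge n w + wedge p z = wedge n w' + wedge p z'" (is "?M = _")
    by (simp add: w'_def z'_def wedge_simps)
  have "?M *v n = ?k *\<^sub>R z'"
    unfolding M using n w' z' lorentz_commute[of p n]
    by (simp add: matvec_simps wedge_mult_vec)
  moreover have Mz: "?M *v z' = - (lorentz w' z' *\<^sub>R n) - lorentz z' z' *\<^sub>R p"
    unfolding M using w' z' by (simp add: matvec_simps wedge_mult_vec)
  moreover have "?M *v p = ?k *\<^sub>R w'"
    unfolding M using p w' z' by (simp add: matvec_simps wedge_mult_vec)
  moreover have "?M *v (r *\<^sub>R x) = r *\<^sub>R (?M *v x)" "?M *v (- x - y) = - (?M *v x) - ?M *v y" for r x y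
    by (simp_all add: matvec_simps algebra_simps)
  ultimately have "?M *v (?M *v (?M *v n)) = - ((?k * ?k) *\<^sub>R (lorentz w' z' *\<^sub>R z' + lorentz z' z' *\<^sub>R w'))"
    by (simp only:) (simp add: algebra_simps)
  then have 0: "lorentz w' z' *\<^sub>R z' + lorentz z' z' *\<^sub>R w' = 0" using cube[of n] k by simp
  then have "lorentz (lorentz w' z' *\<^sub>R z' + lorentz z' z' *\<^sub>R w') z' = 0" by (simp add: lorentz_simps)
  then have "lorentz w' z' = 0" using z' by (simp add: lorentz_simps)
  then have "w' = 0" using 0 z' by simp
  then show False using w' by (simp add: lorentz_simps)
qed

text \<open>
  Without such an element the trace form is negative semidefinite on \<open>g\<close>, and by
  \<open>casimir_contradiction\<close> it is degenerate.  Its radical is an ideal of matrices \<open>X = n \<and> w\<close> with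
  \<open>X\<^sup>3 = 0\<close>, so they all have the same null direction \<open>n\<close>.  For \<open>Y \<in> g\<close> the commutator
  \<open>[Y, X]\<close> is again of the form \<open>n \<and> z\<close>; evaluating it at \<open>n\<close> and at \<open>w\<close> shows that \<open>Y n\<close> is a multiple of
  \<open>n\<close>, which contradicts irreducibility.
\<close>

lemma irreducible_exists_eigenvector:
  fixes g :: "('m::{finite,zero} square_matrix) set"
  assumes g: "subspace g" "g \<subseteq> so1" and br: "\<And>X Y. X \<in> g \<Longrightarrow> Y \<in> g \<Longrightarrow> commutator X Y \<in> g"
    and irr: "acts_irreducibly g" and card: "CARD('m) \<ge> 2"
  shows "\<exists>X\<in>g. \<exists>v r. v \<noteq> 0 \<and> r \<noteq> 0 \<and> X *v v = r *\<^sub>R v"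
proof (rule ccontr)
  assume "\<not> ?thesis"
  then have kernel: "\<exists>v. v \<noteq> 0 \<and> lorentz v v \<le> 0 \<and> X *v v = 0" if "X \<in> g" for X
    using so1_eigenvector_or_causal_kernel[of X] that g(2) by blast
  then have nonpos: "trace (X ** X) \<le> 0" if "X \<in> g" for X
    using trace_square_nonpos that g(2) by blast
  have parabolic: "\<exists>n w. X = wedge n w \<and> n \<noteq> 0 \<and> lorentz n n = 0 \<and> lorentz n w = 0 \<and> lorentz w w > 0"
    if "X \<in> g" "trace (X ** X) = 0" "X \<noteq> 0" for X
    using trace_square_eq_0 that kernel[OF that(1)] g(2) by blast
  have cube: "X *v (X *v (X *v x)) = 0" if "X \<in> g" "trace (X ** X) = 0" for X x
    using parabolic[OF that] wedge_null_cube by (cases "X = 0") auto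
  have expand: "trace ((Y + t *\<^sub>R X) ** (Y + t *\<^sub>R X)) =
      trace (Y ** Y) + 2 * t * trace (X ** Y) + t\<^sup>2 * trace (X ** X)" for X Y :: "((real,'m) vec, 'm) vec" and t
    using trace_mul_sym[of Y X]
    by (simp add: matrix_mult_simps trace_add trace_scaleR power2_eq_square algebra_simps)
  have rad: "trace (X ** Y) = 0" if "X \<in> g" "trace (X ** X) = 0" "Y \<in> g" for X Y
  proof (rule ccontr)
    assume ne: "trace (X ** Y) \<noteq> 0"
    \<comment> \<open>the value of \<open>t\<close> for which \<open>tr (Y + t X)\<^sup>2\<close> would be \<open>1\<close>\<close>
    define t where "t = (1 - trace (Y ** Y)) / (2 * trace (X ** Y))"
    have "Y + t *\<^sub>R X \<in> g" using that g(1) by (simp add: subspace_add subspace_scale)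
    then have "trace (Y ** Y) + 2 * t * trace (X ** Y) \<le> 0"
      using nonpos expand[of Y t X] that(2) by force
    moreover have "2 * t * trace (X ** Y) = 1 - trace (Y ** Y)" using ne by (simp add: t_def)
    ultimately show False by simp
  qed
  have "\<exists>X\<in>g. X \<noteq> 0 \<and> trace (X ** X) = 0"
    using casimir_contradiction[OF g br irr card] nonpos by (metis less_le)
  then obtain X where X: "X \<in> g" "X \<noteq> 0" "trace (X ** X) = 0" by blast
  then obtain n w where nw: "X = wedge n w" "n \<noteq> 0" "lorentz n n = 0" "lorentz n w = 0" "lorentz w w > 0"
    using parabolic by blast
  have "\<exists>r. Y *v n = r *\<^sub>R n" if Y: "Y \<in> g" for Y
  proof -
    define Z where "Z = commutator Y X"
    have Z: "Z \<in> g" using br Y X by (simp add: Z_def)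
    have "trace (Z ** Z) = 0"
      using trace_commutator[of Y X Z] rad[OF X(1,3) br[OF Y Z]] by (simp add: Z_def)
    have "\<exists>z. Z = wedge n z \<and> lorentz n z = 0"
    proof (cases "Z = 0")
      case True
      then show ?thesis by (intro exI[of _ 0]) (simp add: matrix_eq wedge_mult_vec lorentz_simps)
    next
      case False
      then obtain p z where pz: "Z = wedge p z" "p \<noteq> 0" "lorentz p p = 0" "lorentz p z = 0" "lorentz z z > 0"
        using parabolic[OF Z \<open>trace (Z ** Z) = 0\<close>] by blast
      have "X + Z \<in> g" using X Z g(1) by (simp add: subspace_add)
      moreover have "trace ((X + Z) ** (X + Z)) = 0"
        using expand[of X 1 Z] X(3) \<open>trace (Z ** Z) = 0\<close> rad[OF Z \<open>trace (Z ** Z) = 0\<close> X(1)] by simp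
      ultimately have "\<exists>r. p = r *\<^sub>R n"
        using cube[of "X + Z"] unfolding nw(1) pz(1)
        by (intro wedge_null_parallel[OF nw(2-5) pz(3-5)]) blast
      then obtain r where r: "p = r *\<^sub>R n" by blast
      then have "r \<noteq> 0" using pz(2) by auto
      then have "lorentz n z = 0" using pz(4) r by (simp add: lorentz_simps)
      then show ?thesis
        using pz(1) r by (intro exI[of _ "r *\<^sub>R z"]) (simp add: wedge_simps lorentz_simps)
    qed
    then obtain z where z: "Z = wedge n z" "lorentz n z = 0" by blast
    have wn: "lorentz w n = 0" using nw(4) lorentz_commute by metis
    have "Z *v w = (- lorentz z w) *\<^sub>R n"
      using nw(4) by (simp add: z wedge_mult_vec)
    moreover have "Z *v w = - (lorentz w w *\<^sub>R (Y *v n)) - lorentz n (Y *v w) *\<^sub>R w + lorentz w (Y *v w) *\<^sub>R n"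
      using nw(4) by (simp add: Z_def nw(1) commutator_mult_vec wedge_mult_vec matvec_simps)
    moreover have "lorentz n (Y *v w) = 0"
    proof -
      have "Z *v n = 0" using nw(3) z(2) lorentz_commute[of z n] by (simp add: z wedge_mult_vec)
      moreover have "Z *v n = lorentz w (Y *v n) *\<^sub>R n"
        using nw(3) wn so1_orthogonal[of Y n] Y g(2)
        by (auto simp: Z_def nw(1) commutator_mult_vec wedge_mult_vec)
      ultimately have "lorentz w (Y *v n) = 0" using nw(2) by simp
      then show ?thesis using so1_skew[of Y n w] Y g(2) lorentz_commute[of w "Y *v n"] by auto
    qed
    ultimately have "lorentz w w *\<^sub>R (Y *v n) = (lorentz z w + lorentz w (Y *v w)) *\<^sub>R n"
      by (simp add: algebra_simps)
    then have "Y *v n = ((lorentz z w + lorentz w (Y *v w)) / lorentz w w) *\<^sub>R n"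
      using nw(5) by (metis divide_inverse_commute inverse_eq_divide less_irrefl scaleR_one
          scaleR_scaleR left_inverse)
    then show ?thesis by blast
  qed
  then show False using irreducible_no_common_eigenvector[OF irr card nw(2)] by blast
qed

section \<open>Invariance under the symmetric part of a normal operator\<close>

lemma orthonormal_spanning_set:
  fixes S :: "'a::euclidean_space set"
  assumes S: "subspace S"
  obtains B where "finite B" "B \<subseteq> S" "span B = S"
    "\<And>b c. b \<in> B \<Longrightarrow> c \<in> B \<Longrightarrow> b \<bullet> c = (if b = c then 1 else 0)"
proof -
  obtain B where B: "B \<subseteq> S" "pairwise orthogonal B" "\<And>b. b \<in> B \<Longrightarrow> norm b = 1"
    "independent B" "span B = S"
    using orthonormal_basis_subspace[OF S] by metis
  show ?thesis
  proof (rule that[OF finiteI_independent[OF B(4)] B(1,5)])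
    show "b \<bullet> c = (if b = c then 1 else 0)" if "b \<in> B" "c \<in> B" for b c
      using B(2,3) that by (auto simp: pairwise_def orthogonal_def norm_eq_1)
  qed
qed

text \<open>
  In an orthonormal basis \<open>B\<close> of \<open>S\<close>, normality gives \<open>\<Sum> |N b|\<^sup>2 = \<Sum> |N' b|\<^sup>2\<close>.  The left side is the squared Frobenius norm of
  the compression of \<open>N\<close> to \<open>S\<close>, which agrees with that of \<open>N'\<close>; so the components of the \<open>N' b\<close>
  orthogonal to \<open>S\<close> vanish.
\<close>

lemma normal_operator_invariant_subspace:
  fixes N N' :: "'a::euclidean_space \<Rightarrow> 'a"
  assumes lin: "linear N'" and adj: "\<And>x y. N x \<bullet> y = x \<bullet> N' y"
    and normal: "\<And>x. norm (N x) = norm (N' x)"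
    and S: "subspace S" and inv: "\<And>x. x \<in> S \<Longrightarrow> N x \<in> S" and x: "x \<in> S"
  shows "N' x \<in> S"
proof -
  obtain B where fin: "finite B" and B: "B \<subseteq> S" "span B = S"
    and orth: "\<And>b c. b \<in> B \<Longrightarrow> c \<in> B \<Longrightarrow> b \<bullet> c = (if b = c then 1 else 0)"
    using orthonormal_spanning_set[OF S] by blast
  define P where "P y = (\<Sum>b\<in>B. (y \<bullet> b) *\<^sub>R b)" for y
  have P_S: "P y \<in> S" for y
    unfolding P_def using B(1) S by (auto intro!: subspace_sum subspace_scale)
  have Pc: "(y - P y) \<bullet> c = 0" if "c \<in> B" for y c
    using that fin by (simp add: P_def inner_diff_left inner_sum_left orth if_distrib[of "\<lambda>x. _ * x"] cong: if_cong)
  have PP: "P y \<bullet> P y = (\<Sum>b\<in>B. (y \<bullet> b)\<^sup>2)" for y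
    using fin by (simp add: P_def inner_sum_left inner_sum_right orth power2_eq_square
        if_distrib[of "\<lambda>x. _ * x"] cong: if_cong)
  have cross: "(y - P y) \<bullet> P z = 0" for y z
    using Pc by (simp add: P_def[of z] inner_sum_right)
  have pyth: "(norm y)\<^sup>2 = (\<Sum>b\<in>B. (y \<bullet> b)\<^sup>2) + (norm (y - P y))\<^sup>2" for y
  proof -
    have "(norm y)\<^sup>2 = (P y + (y - P y)) \<bullet> (P y + (y - P y))" by (simp add: power2_norm_eq_inner)
    also have "\<dots> = P y \<bullet> P y + (y - P y) \<bullet> (y - P y)"
      using cross[of y y] by (simp only: inner_add_left inner_add_right) (simp add: inner_commute)
    finally show ?thesis by (simp add: PP power2_norm_eq_inner)
  qed
  have P_id: "P y = y" if "y \<in> S" for y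
  proof -
    have "orthogonal (y - P y) z" if "z \<in> span B" for z
      using that by (rule orthogonal_to_span) (simp add: orthogonal_def Pc)
    moreover have "y - P y \<in> span B" using that P_S S B(2) by (simp add: subspace_diff)
    ultimately have "orthogonal (y - P y) (y - P y)" by blast
    then show ?thesis by (simp add: orthogonal_self)
  qed
  have "(\<Sum>b\<in>B. (norm (N b))\<^sup>2) = (\<Sum>b\<in>B. \<Sum>c\<in>B. (N b \<bullet> c)\<^sup>2)"
    using P_id inv B(1) by (intro sum.cong refl) (subst pyth, auto)
  also have "\<dots> = (\<Sum>c\<in>B. \<Sum>b\<in>B. (N' c \<bullet> b)\<^sup>2)"
  proof -
    have "N b \<bullet> c = N' c \<bullet> b" for b c using adj[of b c] inner_commute[of b "N' c"] by simp
    then show ?thesis by (subst sum.swap) simp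
  qed
  finally have "(\<Sum>b\<in>B. (norm (N' b))\<^sup>2) = (\<Sum>b\<in>B. \<Sum>c\<in>B. (N' b \<bullet> c)\<^sup>2)"
    by (simp add: normal)
  then have "(\<Sum>b\<in>B. (norm (N' b - P (N' b)))\<^sup>2) = 0"
    by (subst (asm) pyth) (simp add: sum.distrib)
  then have "N' b \<in> S" if "b \<in> B" for b
    using that fin P_S[of "N' b"] by (simp add: sum_nonneg_eq_0_iff)
  then have "N' ` B \<subseteq> S" by blast
  then have "span (N' ` B) \<subseteq> S" using S by (rule span_minimal)
  then show ?thesis using x B(2) linear_span_image[OF lin, of B] by blast
qed

lemma inner_matrix_mult_left: "(A ** X) \<bullet> Y = X \<bullet> (transpose A ** Y)"
  for X Y :: "real^'n^'n"
proof -
  have inner: "U \<bullet> V = trace (transpose U ** V)" for U V :: "real^'n^'n"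
    unfolding trace_def matrix_matrix_mult_def transpose_def inner_vec_def
    by (simp, subst sum.swap) simp
  show ?thesis by (simp add: inner matrix_transpose_mul matrix_mul_assoc)
qed

lemma inner_matrix_mult_right: "(X ** A) \<bullet> Y = X \<bullet> (Y ** transpose A)"
  for X Y :: "real^'n^'n"
proof -
  have inner: "U \<bullet> V = trace (U ** transpose V)" for U V :: "real^'n^'n"
    unfolding trace_def matrix_matrix_mult_def transpose_def inner_vec_def
    by simp
  show ?thesis by (simp add: inner matrix_transpose_mul matrix_mul_assoc)
qed

text \<open>
  For the Frobenius inner product the adjoint of \<open>ad h\<close> is \<open>ad h\<^sup>T\<close>, and \<open>ad h\<close> is normal if \<open>h\<close> is.
\<close>

lemma commutator_normal_invariant:
  assumes normal: "h ** transpose h = transpose h ** h"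
    and g: "subspace g" and inv: "\<And>X. X \<in> g \<Longrightarrow> commutator h X \<in> g" and X: "X \<in> g"
  shows "commutator (transpose h) X \<in> g"
proof -
  have lin: "linear (commutator A)" for A :: "real^'n^'n"
    by (rule linearI) (simp_all add: commutator_def matrix_mult_simps scaleR_diff_right)
  have adj: "commutator A Y \<bullet> Z = Y \<bullet> commutator (transpose A) Z" for A Y Z :: "real^'n^'n"
    using inner_matrix_mult_left[of A Y Z] inner_matrix_mult_right[of Y A Z]
    by (simp add: commutator_def inner_diff_left inner_diff_right)
  have comm: "commutator h (commutator (transpose h) Y) = commutator (transpose h) (commutator h Y)" for Y
  proof -
    have "h ** (transpose h ** Z) = transpose h ** (h ** Z)"
      "Z ** transpose h ** h = Z ** h ** transpose h" for Z
      using normal by (metis matrix_mul_assoc)+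
    then show ?thesis
      by (simp add: commutator_def matrix_mult_simps matrix_mul_assoc[symmetric] normal)
  qed
  have "norm (commutator h Y) = norm (commutator (transpose h) Y)" for Y
  proof -
    have "commutator h Y \<bullet> commutator h Y = Y \<bullet> commutator (transpose h) (commutator h Y)"
      by (simp add: adj)
    also have "\<dots> = Y \<bullet> commutator h (commutator (transpose h) Y)"
      by (simp add: comm)
    also have "\<dots> = commutator (transpose h) Y \<bullet> commutator (transpose h) Y"
      by (simp add: adj)
    finally show ?thesis by (simp add: norm_eq)
  qed
  then show ?thesis
    using normal_operator_invariant_subspace[OF lin adj _ g inv X] by blast
qed

lemma so1_fixes_axis_transpose:
  assumes X: "X \<in> so1" and kernel: "X *v axis 0 1 = 0"
  shows "transpose X = - X"
proof -
  have "(X *v x) $ 0 = 0" for x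
    using so1_skew[OF X, of "axis 0 1" x] kernel by (simp add: lorentz_simps lorentz_axis)
  then have "(X *v x) \<bullet> y = x \<bullet> (- X *v y)" for x y
    using so1_skew[OF X, of x y] by (simp add: lorentz_eq_inner matvec_simps)
  then have "transpose X *v x = - X *v x" for x
    by (metis dot_lmul_matrix transpose_matrix_vector inner_commute vector_eq_rdot)
  then show ?thesis by (simp only: matrix_eq) blast
qed

text \<open>
  Here \<open>h\<close> is the sum of the symmetric matrix \<open>- r s\<close>, \<open>s = e \<and> f\<close>, and a skew matrix \<open>k\<close> that kills \<open>e\<close>
  and \<open>f\<close>; since \<open>k s = s k = 0\<close>, \<open>h\<close> is normal, and \<open>h + h\<^sup>T = - 2 r s\<close>.
\<close>

lemma boost_part_invariant_axis:
  fixes g :: "('m::{finite,zero} square_matrix) set"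
  assumes h: "h \<in> so1" and f: "f $ 0 = 0" "f \<bullet> f = 1"
    and he: "h *v axis 0 1 = r *\<^sub>R f" "h *v f = r *\<^sub>R axis 0 1" and r: "r \<noteq> 0"
    and g: "subspace g" and inv: "\<And>X. X \<in> g \<Longrightarrow> commutator h X \<in> g" and X: "X \<in> g"
  shows "commutator (wedge (axis 0 1) f) X \<in> g"
proof -
  define e :: "(real, 'm) vec" where "e = axis 0 1"
  define s where "s = wedge e f"
  define k where "k = h + r *\<^sub>R s"
  have s: "s *v x = - (x $ 0) *\<^sub>R f - (f \<bullet> x) *\<^sub>R e" for x
  proof -
    have "lorentz e x = - x $ 0" "lorentz f x = f \<bullet> x"
      using f(1) by (simp add: e_def lorentz_axis) (simp add: lorentz_eq_inner f(1))
    then show ?thesis by (simp add: s_def wedge_mult_vec)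
  qed
  have k: "k \<in> so1"
    unfolding k_def s_def by (intro subspace_add subspace_scale subspace_so1 h wedge_so1)
  have "f \<bullet> e = 0" "e $ 0 = 1" using f(1) by (simp_all add: e_def inner_axis)
  then have ke: "k *v e = 0" and kf: "k *v f = 0"
    using he f by (simp_all add: k_def e_def[symmetric] matvec_simps s)
  have kT: "transpose k = - k" using so1_fixes_axis_transpose k ke by (simp add: e_def)
  have sT: "transpose s = s"
  proof -
    have "(s *v x) \<bullet> y = x \<bullet> (s *v y)" for x y
    proof -
      have "e \<bullet> z = z $ 0" "z \<bullet> e = z $ 0" for z by (simp_all add: e_def inner_axis' inner_axis)
      then show ?thesis
        by (simp add: s inner_diff_left inner_diff_right inner_commute[of x f])
    qed
    then have "transpose s *v x = s *v x" for x
      by (metis dot_lmul_matrix transpose_matrix_vector inner_commute vector_eq_rdot)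
    then show ?thesis by (simp only: matrix_eq) blast
  qed
  have ks: "k ** s = 0"
    by (simp add: matrix_eq matvec_simps s ke kf)
  have sk: "s ** k = 0"
  proof -
    have "transpose (k ** s) = - (s ** k)"
      by (simp add: matrix_transpose_mul sT kT matrix_mult_simps)
    moreover have "transpose (k ** s) = 0" by (simp add: ks transpose_def vec_eq_iff)
    ultimately show ?thesis by simp
  qed
  have hk: "h = k - r *\<^sub>R s" by (simp add: k_def)
  have hT: "transpose h = - k - r *\<^sub>R s"
  proof -
    have "transpose (A - r *\<^sub>R B) = transpose A - r *\<^sub>R transpose B" for A B :: "'m square_matrix"
      by (simp add: transpose_def vec_eq_iff)
    then show ?thesis by (simp only: hk kT sT)
  qed
  have "h ** transpose h = transpose h ** h"
    unfolding hT unfolding hk by (simp add: matrix_mult_simps ks sk)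
  then have "commutator (transpose h) X \<in> g"
    using g inv X by (rule commutator_normal_invariant)
  then have "(- 1 / (2 * r)) *\<^sub>R (commutator h X + commutator (transpose h) X) \<in> g"
    using g inv[OF X] by (simp add: subspace_add subspace_scale subspace_neg)
  also have "commutator h X + commutator (transpose h) X = - 2 *\<^sub>R (r *\<^sub>R commutator s X)"
    unfolding hT commutator_def scaleR_minus_left scaleR_2 unfolding hk
    by (simp add: matrix_mult_simps scaleR_diff_right)
  finally show ?thesis using r by (simp add: s_def e_def)
qed

section \<open>Irreducible subalgebras of so(1,n)\<close>

text \<open>
  The normalisation \<open>\<langle>p, q\<rangle> = - 1/2\<close> makes \<open>p + q\<close> a unit timelike and \<open>p - q\<close> a unit spacelike vector.
\<close>

definition hyperbolic_pair :: "real^'m::{finite,zero} \<Rightarrow> real^'m::{finite,zero} \<Rightarrow> bool" where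
  "hyperbolic_pair p q \<longleftrightarrow> lorentz p p = 0 \<and> lorentz q q = 0 \<and> lorentz p q = -1/2"

lemma hyperbolic_pair_simps:
  assumes "hyperbolic_pair p q"
  shows "lorentz p p = 0" "lorentz q q = 0" "lorentz p q = -1/2" "lorentz q p = -1/2"
  using assms lorentz_commute[of q p] by (auto simp: hyperbolic_pair_def)

lemma hyperbolic_pair_swap: "hyperbolic_pair p q \<Longrightarrow> hyperbolic_pair q p"
  by (simp add: hyperbolic_pair_def lorentz_commute)

lemma hyperbolic_pair_orthogonal_spacelike:
  assumes pq: "hyperbolic_pair p q" and u: "lorentz p u = 0" "lorentz q u = 0" "u \<noteq> 0"
  shows "lorentz u u > 0"
proof -
  note pq' = hyperbolic_pair_simps[OF pq]
  have t: "lorentz (p + q) (p + q) = -1" by (simp add: lorentz_simps pq')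
  have "p + q \<noteq> 0"
  proof
    assume "p + q = 0"
    with t show False by (simp only: lorentz_zero_left)
  qed
  note orth = causal_orthogonal[OF this, of u]
  have "lorentz (p + q) u = 0" using u by (simp add: lorentz_simps)
  then have "lorentz u u \<ge> 0" and "lorentz u u = 0 \<Longrightarrow> \<exists>r. u = r *\<^sub>R (p + q)"
    using orth t by auto
  moreover have "u \<noteq> r *\<^sub>R (p + q)" for r
    using u pq' by (auto simp: lorentz_simps)
  ultimately show ?thesis by force
qed

lemma half_sum:
  fixes a b :: "'a::real_vector"
  shows "a = (1/2) *\<^sub>R ((a + b) + (a - b))" "b = (1/2) *\<^sub>R ((a + b) - (a - b))"
proof -
  have "(a + b) + (a - b) = 2 *\<^sub>R a" "(a + b) - (a - b) = 2 *\<^sub>R b" by (simp_all add: scaleR_2)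
  then show "a = (1/2) *\<^sub>R ((a + b) + (a - b))" "b = (1/2) *\<^sub>R ((a + b) - (a - b))"
    by (simp_all only: scaleR_scaleR) simp_all
qed

lemma half_scaleR_sum:
  fixes a b :: "'a::real_vector"
  shows "(c / 2) *\<^sub>R a + (1/2) *\<^sub>R (c *\<^sub>R a - d *\<^sub>R b) = c *\<^sub>R a - (d / 2) *\<^sub>R b"
proof -
  have "c *\<^sub>R a = (c / 2) *\<^sub>R a + (c / 2) *\<^sub>R a" by (simp flip: scaleR_left_distrib)
  then show ?thesis by (simp add: scaleR_diff_right)
qed

lemma commutator_wedge_wedge:
  assumes pq: "hyperbolic_pair p q" and u: "lorentz p u = 0" "lorentz q u = 0"
    and w: "lorentz p w = 0" "lorentz q w = 0"
  shows "commutator (wedge p u) (wedge q w) = lorentz u w *\<^sub>R wedge p q - (1/2) *\<^sub>R wedge u w"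
proof -
  have "wedge p u *v q = (- 1/2) *\<^sub>R u" "wedge p u *v w = (- lorentz u w) *\<^sub>R p"
    using hyperbolic_pair_simps[OF pq] u w lorentz_commute[of u q] by (simp_all add: wedge_mult_vec)
  then show ?thesis
    by (simp add: commutator_wedge[OF wedge_so1] wedge_simps wedge_swap[of q p])
qed

text \<open>
  The bracket \<open>[[p \<and> u, q \<and> w], p \<and> u]\<close> equals \<open>\<langle>u, w\<rangle> p \<and> u - (\<langle>u, u\<rangle> / 2) p \<and> w\<close>, and \<open>\<langle>u, u\<rangle> > 0\<close>.
\<close>

lemma root_space_transfer:
  assumes pq: "hyperbolic_pair p q" and g: "subspace g"
    and br: "\<And>X Y. X \<in> g \<Longrightarrow> Y \<in> g \<Longrightarrow> commutator X Y \<in> g"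
    and u: "lorentz p u = 0" "lorentz q u = 0" "u \<noteq> 0" "wedge p u \<in> g"
    and w: "lorentz p w = 0" "lorentz q w = 0" "wedge q w \<in> g"
  shows "wedge p w \<in> g"
proof -
  note pq' = hyperbolic_pair_simps[OF pq]
  define Z where "Z = commutator (wedge p u) (wedge q w)"
  have Zeq: "Z = lorentz u w *\<^sub>R wedge p q - (1/2) *\<^sub>R wedge u w"
    unfolding Z_def using pq u(1,2) w(1,2) by (rule commutator_wedge_wedge)
  have uu: "lorentz u u > 0" using pq u by (intro hyperbolic_pair_orthogonal_spacelike)
  have "Z \<in> g" unfolding Z_def using u(4) w(3) by (rule br)
  have "Z \<in> so1" unfolding Z_def by (intro commutator_so1 wedge_so1)
  have 1: "commutator Z (wedge p u) \<in> g" using \<open>Z \<in> g\<close> u(4) by (rule br)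
  have "Z *v p = (lorentz u w / 2) *\<^sub>R p"
    using pq' u w lorentz_commute[of u p] lorentz_commute[of w p]
    by (simp add: Zeq matvec_simps wedge_mult_vec)
  note Zp = this
  have Zu: "Z *v u = (1/2) *\<^sub>R (lorentz u w *\<^sub>R u - lorentz u u *\<^sub>R w)"
    using pq' u w lorentz_commute[of w u]
    by (simp add: Zeq matvec_simps wedge_mult_vec algebra_simps)
  have "commutator Z (wedge p u) = lorentz u w *\<^sub>R wedge p u - (lorentz u u / 2) *\<^sub>R wedge p w"
    unfolding commutator_wedge[OF \<open>Z \<in> so1\<close>] Zp Zu wedge_simps by (rule half_scaleR_sum)
  then have "lorentz u w *\<^sub>R wedge p u - commutator Z (wedge p u) = (lorentz u u / 2) *\<^sub>R wedge p w"
    by simp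
  moreover have "lorentz u w *\<^sub>R wedge p u - commutator Z (wedge p u) \<in> g"
    using g 1 u by (simp add: subspace_diff subspace_scale)
  ultimately have "(2 / lorentz u u) *\<^sub>R ((lorentz u u / 2) *\<^sub>R wedge p w) \<in> g"
    using g by (metis subspace_scale)
  then show ?thesis using uu by simp
qed

text \<open>
  Stability under \<open>ad (p \<and> q)\<close> splits \<open>X \<in> g\<close> into its components for the eigenvalues \<open>1/2\<close>, \<open>0\<close>, \<open>-1/2\<close>, and each
  of them lies in \<open>g\<close> (the fact \<open>decomp\<close>).  The spaces \<open>P\<close> and \<open>M\<close> record the components for \<open>1/2\<close> and
  \<open>-1/2\<close>.  If one of them were zero, \<open>q\<close> or \<open>p\<close> would be a common eigenvector; as both are nonzero, \<open>root_space_transfer\<close>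
  gives \<open>P = M\<close>.  The span \<open>U\<close> of \<open>p\<close>, \<open>q\<close> and \<open>P\<close> is then stable under \<open>g\<close>, hence everything, so \<open>P\<close> is the
  whole orthogonal complement \<open>E\<close> of \<open>p\<close> and \<open>q\<close>.  Brackets of the outer pieces produce the remaining wedges.
\<close>

lemma boost_invariant_irreducible_eq_so1:
  fixes g :: "('m::{finite,zero} square_matrix) set"
  assumes pq: "hyperbolic_pair p q" and g: "subspace g" "g \<subseteq> so1"
    and br: "\<And>X Y. X \<in> g \<Longrightarrow> Y \<in> g \<Longrightarrow> commutator X Y \<in> g"
    and irr: "acts_irreducibly g" and card: "CARD('m) \<ge> 2"
    and boost: "\<And>X. X \<in> g \<Longrightarrow> commutator (wedge p q) X \<in> g"
  shows "g = so1"
proof -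
  note pq' = hyperbolic_pair_simps[OF pq]
  have pq0: "p \<noteq> 0" "q \<noteq> 0" using pq' by (auto simp: lorentz_simps)
  define E where "E = {w. lorentz p w = 0 \<and> lorentz q w = 0}"
  have E: "subspace E" by (auto simp: E_def subspace_def lorentz_simps)
  define P where "P = {w \<in> E. wedge p w \<in> g}"
  define M where "M = {w \<in> E. wedge q w \<in> g}"
  have P: "subspace P" and M: "subspace M"
    using g(1) E by (auto simp: P_def M_def subspace_def wedge_simps)
  have decomp: "\<exists>a. \<exists>w1\<in>M. \<exists>w2\<in>P. X *v p = a *\<^sub>R p + w1 \<and> X *v q = - a *\<^sub>R q + w2 \<and>
      X + 2 *\<^sub>R wedge q w1 + 2 *\<^sub>R wedge p w2 \<in> g" if X: "X \<in> g" for X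
  proof -
    have Xso: "X \<in> so1" using X g(2) by blast
    define a where "a = - 2 * lorentz (X *v p) q"
    define w1 where "w1 = X *v p - a *\<^sub>R p"
    define w2 where "w2 = X *v q + a *\<^sub>R q"
    have qp: "lorentz (X *v q) p = a / 2"
      using so1_skew[OF Xso, of q p] lorentz_commute[of q "X *v p"] by (simp add: a_def)
    have w1: "lorentz p w1 = 0" "lorentz q w1 = 0"
      using so1_orthogonal[OF Xso, of p] pq' lorentz_commute[of q "X *v p"]
      by (simp_all add: w1_def lorentz_simps a_def)
    have w2: "lorentz p w2 = 0" "lorentz q w2 = 0"
      using so1_orthogonal[OF Xso, of q] pq' lorentz_commute[of p "X *v q"] qp
      by (simp_all add: w2_def lorentz_simps)
    define X0 where "X0 = X + 2 *\<^sub>R wedge q w1 + 2 *\<^sub>R wedge p w2"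
    have X0so: "X0 \<in> so1"
      unfolding X0_def by (intro subspace_add subspace_scale subspace_so1 wedge_so1 Xso)
    have X0p: "X0 *v p = a *\<^sub>R p"
      using w1 w2 pq' lorentz_commute[of w1 p] lorentz_commute[of w2 p]
      by (simp add: X0_def matvec_simps wedge_mult_vec w1_def)
    have X0q: "X0 *v q = - a *\<^sub>R q"
      using w1 w2 pq' lorentz_commute[of w1 q] lorentz_commute[of w2 q]
      by (simp add: X0_def matvec_simps wedge_mult_vec w2_def)
    have H: "wedge p q *v p = (1/2) *\<^sub>R p" "wedge p q *v q = (- 1/2) *\<^sub>R q"
      "wedge p q *v w1 = 0" "wedge p q *v w2 = 0"
      using pq' w1 w2 by (simp_all add: wedge_mult_vec)
    have ad1: "commutator (wedge p q) (wedge q w1) = (- 1/2) *\<^sub>R wedge q w1"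
      and ad2: "commutator (wedge p q) (wedge p w2) = (1/2) *\<^sub>R wedge p w2"
      by (simp_all add: commutator_wedge[OF wedge_so1] H wedge_simps)
    have "commutator X0 (wedge p q) = 0"
      unfolding commutator_wedge[OF X0so] X0p X0q wedge_simps by simp
    then have ad0: "commutator (wedge p q) X0 = 0" by (simp add: commutator_def)
    have lin: "commutator A (Y + Z) = commutator A Y + commutator A Z"
      "commutator A (Y - Z) = commutator A Y - commutator A Z"
      "commutator A (r *\<^sub>R Y) = r *\<^sub>R commutator A Y" for A Y Z :: "'m square_matrix" and r
      by (simp_all add: commutator_def matrix_mult_simps scaleR_diff_right)
    have "X = X0 - 2 *\<^sub>R wedge q w1 - 2 *\<^sub>R wedge p w2" by (simp add: X0_def)
    then have adX: "commutator (wedge p q) X = wedge q w1 - wedge p w2"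
      by (simp only: lin ad0 ad1 ad2) simp
    then have adadX: "commutator (wedge p q) (commutator (wedge p q) X) = (- 1/2) *\<^sub>R (wedge q w1 + wedge p w2)"
      by (simp only: lin ad0 ad1 ad2) (simp add: algebra_simps)
    have m: "commutator (wedge p q) X \<in> g" using boost X by blast
    then have "(- 2) *\<^sub>R commutator (wedge p q) (commutator (wedge p q) X) \<in> g"
      using boost g(1) subspace_scale by blast
    then have pl: "wedge q w1 + wedge p w2 \<in> g" by (simp add: adadX add.commute)
    have "(1/2) *\<^sub>R ((wedge q w1 + wedge p w2) + (wedge q w1 - wedge p w2)) \<in> g"
      "(1/2) *\<^sub>R ((wedge q w1 + wedge p w2) - (wedge q w1 - wedge p w2)) \<in> g"
      using pl m[unfolded adX] g(1) by (blast intro: subspace_add subspace_diff subspace_scale)+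
    then have wg: "wedge q w1 \<in> g" "wedge p w2 \<in> g"
      by (simp_all only: half_sum[symmetric])
    then have "w1 \<in> M" "w2 \<in> P" using w1 w2 by (auto simp: M_def P_def E_def)
    moreover have "X0 \<in> g"
      unfolding X0_def using g(1) X wg by (intro subspace_add subspace_scale)
    ultimately show ?thesis
      unfolding X0_def using w1_def w2_def by (intro exI[of _ a] bexI[of _ w1] bexI[of _ w2]) auto
  qed
  have "\<exists>u\<in>M. u \<noteq> 0"
  proof (rule ccontr)
    assume "\<not> ?thesis"
    then have "\<exists>r. X *v p = r *\<^sub>R p" if "X \<in> g" for X using decomp[OF that] by force
    then show False using irreducible_no_common_eigenvector[OF irr card pq0(1)] by blast
  qed
  then obtain m where m: "m \<in> M" "m \<noteq> 0" by blast
  have "\<exists>u\<in>P. u \<noteq> 0"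
  proof (rule ccontr)
    assume "\<not> ?thesis"
    then have "\<exists>r. X *v q = r *\<^sub>R q" if "X \<in> g" for X
      using decomp[OF that] by (metis add.right_neutral)
    then show False using irreducible_no_common_eigenvector[OF irr card pq0(2)] by blast
  qed
  then obtain u where u: "u \<in> P" "u \<noteq> 0" by blast
  have "M \<subseteq> P"
    using root_space_transfer[OF pq g(1) br, of u] u by (auto simp: P_def M_def E_def)
  moreover have "P \<subseteq> M"
    using root_space_transfer[OF hyperbolic_pair_swap[OF pq] g(1) br, of m] m
    by (auto simp: P_def M_def E_def)
  ultimately have PM: "M = P" by blast
  define U where "U = {x. \<exists>a b. \<exists>w\<in>P. x = a *\<^sub>R p + b *\<^sub>R q + w}"
  have U_iff: "x \<in> U \<longleftrightarrow> (\<exists>a b. \<exists>w\<in>P. x = a *\<^sub>R p + b *\<^sub>R q + w)" for x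
    by (simp add: U_def)
  have UI: "a *\<^sub>R p + b *\<^sub>R q + w \<in> U" if "w \<in> P" for a b w using that U_iff by blast
  have subU: "subspace U"
    unfolding subspace_def
  proof (intro conjI allI ballI)
    show "0 \<in> U" using UI[OF subspace_0[OF P], of 0 0] by simp
  next
    fix x y assume "x \<in> U" "y \<in> U"
    then obtain a b w a' b' w' where xy: "w \<in> P" "x = a *\<^sub>R p + b *\<^sub>R q + w" "w' \<in> P" "y = a' *\<^sub>R p + b' *\<^sub>R q + w'"
      using U_iff by meson
    then have "x + y = (a + a') *\<^sub>R p + (b + b') *\<^sub>R q + (w + w')" by (simp add: algebra_simps)
    then show "x + y \<in> U" using UI subspace_add[OF P xy(1,3)] by simp
  next
    fix c x assume "x \<in> U"
    then obtain a b w where x: "w \<in> P" "x = a *\<^sub>R p + b *\<^sub>R q + w" using U_iff by meson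
    then have "c *\<^sub>R x = (c * a) *\<^sub>R p + (c * b) *\<^sub>R q + c *\<^sub>R w" by (simp add: algebra_simps)
    then show "c *\<^sub>R x \<in> U" using UI subspace_scale[OF P x(1)] by simp
  qed
  have invU: "X *v x \<in> U" if X: "X \<in> g" and x: "x \<in> U" for X x
  proof -
    obtain c w1 w2 where d: "w1 \<in> P" "w2 \<in> P" "X *v p = c *\<^sub>R p + w1" "X *v q = - c *\<^sub>R q + w2"
      "X + 2 *\<^sub>R wedge q w1 + 2 *\<^sub>R wedge p w2 \<in> g" (is "?X0 \<in> g")
      using decomp[OF X] PM by blast
    have X0: "?X0 \<in> so1" using d(5) g(2) by blast
    have w12: "lorentz p w1 = 0" "lorentz q w1 = 0" "lorentz p w2 = 0" "lorentz q w2 = 0"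
      using d(1,2) by (auto simp: P_def E_def)
    have X0p: "?X0 *v p = c *\<^sub>R p"
      using d(3) w12 pq' lorentz_commute[of w1 p] lorentz_commute[of w2 p]
      by (simp add: matvec_simps wedge_mult_vec)
    have X0q: "?X0 *v q = - c *\<^sub>R q"
      using d(4) w12 pq' lorentz_commute[of w1 q] lorentz_commute[of w2 q]
      by (simp add: matvec_simps wedge_mult_vec)
    have Xp: "X *v p \<in> U" using UI[OF d(1), of c 0] d(3) by simp
    have Xq: "X *v q \<in> U" using UI[OF d(2), of 0 "- c"] d(4) by simp
    have Xw: "X *v w \<in> U" if w: "w \<in> P" for w
    proof -
      have wE: "lorentz p w = 0" "lorentz q w = 0" "wedge p w \<in> g" using w by (auto simp: P_def E_def)
      have "wedge p (?X0 *v w) = commutator ?X0 (wedge p w) - c *\<^sub>R wedge p w"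
        unfolding commutator_wedge[OF X0] X0p wedge_simps by simp
      also have "\<dots> \<in> g" using br[OF d(5) wE(3)] wE(3) g(1) by (simp add: subspace_diff subspace_scale)
      finally have "wedge p (?X0 *v w) \<in> g" .
      moreover have "lorentz p (?X0 *v w) = 0" "lorentz q (?X0 *v w) = 0"
        using so1_skew[OF X0, of p w] so1_skew[OF X0, of q w] wE
        unfolding X0p X0q by (simp_all add: lorentz_simps)
      ultimately have "?X0 *v w \<in> P" by (simp add: P_def E_def)
      moreover have "X *v w = (2 * lorentz w2 w) *\<^sub>R p + (2 * lorentz w1 w) *\<^sub>R q + ?X0 *v w"
        using wE by (simp add: matvec_simps wedge_mult_vec)
      ultimately show ?thesis using UI by simp
    qed
    obtain a b w where "w \<in> P" "x = a *\<^sub>R p + b *\<^sub>R q + w" using x U_iff by meson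
    then show ?thesis
      using Xp Xq Xw subU by (simp add: matvec_simps subspace_add subspace_scale)
  qed
  have "p \<in> U" using UI[OF subspace_0[OF P], of 1 0] by simp
  then have "U = UNIV"
    using irr subU invU pq0 unfolding acts_irreducibly_def by blast
  have "E \<subseteq> P"
  proof
    fix x assume x: "x \<in> E"
    obtain a b w where w: "w \<in> P" "x = a *\<^sub>R p + b *\<^sub>R q + w" using \<open>U = UNIV\<close> U_iff by blast
    have "lorentz p x = - b / 2" "lorentz q x = - a / 2"
      using w pq' by (simp_all add: lorentz_simps P_def E_def)
    then have "a = 0" "b = 0" using x by (auto simp: E_def)
    then show "x \<in> P" using w by simp
  qed
  then have pw: "wedge p w \<in> g" "wedge q w \<in> g" if "w \<in> E" for w
    using that PM by (auto simp: P_def M_def)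
  have Z: "lorentz v w *\<^sub>R wedge p q - (1/2) *\<^sub>R wedge v w \<in> g" if "v \<in> E" "w \<in> E" for v w
    using br[OF pw(1)[OF that(1)] pw(2)[OF that(2)]] that commutator_wedge_wedge[OF pq, of v w]
    by (simp add: E_def)
  have wpq: "wedge p q \<in> g"
  proof -
    have uE: "u \<in> E" using u by (auto simp: P_def)
    then have "lorentz u u > 0" using hyperbolic_pair_orthogonal_spacelike[OF pq] u by (auto simp: E_def)
    moreover have "wedge u u = 0" by (simp add: matrix_eq wedge_mult_vec)
    ultimately show ?thesis
      using subspace_scale[OF g(1) Z[OF uE uE], of "1 / lorentz u u"] by simp
  qed
  have ww: "wedge v w \<in> g" if "v \<in> E" "w \<in> E" for v w
  proof -
    have "wedge v w = 2 *\<^sub>R (lorentz v w *\<^sub>R wedge p q - (lorentz v w *\<^sub>R wedge p q - (1/2) *\<^sub>R wedge v w))"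
      by simp
    also have "\<dots> \<in> g" by (rule subspace_scale[OF g(1) subspace_diff[OF g(1) subspace_scale[OF g(1) wpq] Z[OF that]]])
    finally show ?thesis .
  qed
  have "wedge x y \<in> g" for x y
  proof -
    obtain a b w where w: "w \<in> P" "x = a *\<^sub>R p + b *\<^sub>R q + w" using \<open>U = UNIV\<close> U_iff by blast
    obtain a' b' w' where w': "w' \<in> P" "y = a' *\<^sub>R p + b' *\<^sub>R q + w'" using \<open>U = UNIV\<close> U_iff by blast
    have E': "w \<in> E" "w' \<in> E" using w w' by (auto simp: P_def)
    have sw: "wedge p p = 0" "wedge q q = 0" by (simp_all add: matrix_eq wedge_mult_vec)
    have "wedge x y = (a * b') *\<^sub>R wedge p q + a *\<^sub>R wedge p w' - (b * a') *\<^sub>R wedge p q + b *\<^sub>R wedge q w'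
        - a' *\<^sub>R wedge p w - b' *\<^sub>R wedge q w + wedge w w'"
      unfolding w w'
      by (simp add: wedge_simps sw wedge_swap[of q p] wedge_swap[of w p] wedge_swap[of w q] algebra_simps)
    also have "\<dots> \<in> g"
      using g(1) pw E' wpq ww by (intro subspace_add subspace_diff subspace_scale)
    finally show ?thesis .
  qed
  then have "X \<in> g" if "X \<in> so1" for X
    by (subst so1_eq_sum_wedge[OF that], intro subspace_scale subspace_sum g(1)) auto
  then show ?thesis using g(2) by blast
qed

text \<open>
  An eigenvector \<open>v\<close> for \<open>r \<noteq> 0\<close> is null.  The range of \<open>h + r\<close> is orthogonal to \<open>v\<close>, so \<open>h + r\<close> is not
  injective and there is an eigenvector for \<open>- r\<close>; it is also null, and it is not orthogonal to \<open>v\<close>.  The sign condition on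
  \<open>p + q\<close> is arranged by changing both signs; it is what the reflection in \<open>boost_part_invariant\<close> needs.
\<close>

lemma so1_eigenvector_hyperbolic_pair:
  assumes h: "h \<in> so1" and v: "v \<noteq> 0" "h *v v = r *\<^sub>R v" "r \<noteq> 0"
  shows "\<exists>p q. hyperbolic_pair p q \<and> h *v p = r *\<^sub>R p \<and> h *v q = - r *\<^sub>R q \<and> (p + q) $ 0 < 0"
proof -
  have vv: "lorentz v v = 0"
    using so1_orthogonal[OF h, of v] v by (simp add: lorentz_simps)
  define N where "N = h + r *\<^sub>R mat 1"
  have N: "N *v x = h *v x + r *\<^sub>R x" for x by (simp add: N_def matvec_simps)
  have "\<exists>w. w \<noteq> 0 \<and> N *v w = 0"
  proof (rule ccontr)
    assume "\<not> ?thesis"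
    then have "inj ((*v) N)"
      by (subst linear_injective_0) auto
    then have "surj ((*v) N)" by (intro linear_injective_imp_surjective) auto
    have "lorentz v z = 0" for z
    proof -
      obtain y where "z = N *v y" using \<open>surj ((*v) N)\<close> by (metis surjD)
      then show ?thesis
        using so1_skew[OF h, of v y] v by (simp add: N lorentz_simps)
    qed
    then show False using lorentz_nondegenerate v(1) by blast
  qed
  then obtain w where w: "w \<noteq> 0" "h *v w = - r *\<^sub>R w" by (auto simp: N eq_neg_iff_add_eq_0)
  have ww: "lorentz w w = 0"
    using so1_orthogonal[OF h, of w] w v(3) by (simp add: lorentz_simps)
  have "lorentz v w \<noteq> 0" (is "?k \<noteq> 0")
  proof
    assume "lorentz v w = 0"
    then obtain c where c: "w = c *\<^sub>R v" using causal_orthogonal_null[OF v(1), of w] vv ww by auto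
    then have "(c * r) *\<^sub>R v = - (c * r) *\<^sub>R v" using w v(2) by (simp add: matvec_simps algebra_simps)
    then have "(2 * (c * r)) *\<^sub>R v = 0" by (simp add: algebra_simps scaleR_2 eq_neg_iff_add_eq_0 flip: scaleR_scaleR)
    then show False using c w(1) v by simp
  qed
  define q where "q = (- 1 / (2 * ?k)) *\<^sub>R w"
  have hp: "hyperbolic_pair v q" "hyperbolic_pair (- v) (- q)"
    using vv ww \<open>?k \<noteq> 0\<close> by (simp_all add: hyperbolic_pair_def q_def lorentz_simps)
  have hq: "h *v q = - r *\<^sub>R q" using w by (simp add: q_def matvec_simps)
  have "lorentz (v + q) (v + q) = -1"
    using hyperbolic_pair_simps[OF hp(1)] by (simp add: lorentz_simps)
  then have "(v + q) $ 0 \<noteq> 0" using causal_component_0[of "v + q"]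
    by (metis lorentz_zero_left neg_le_0_iff_le zero_le_one zero_neq_neg_one)
  then consider "(v + q) $ 0 < 0" | "(- v + - q) $ 0 < 0" by fastforce
  then show ?thesis
  proof cases
    case 1
    then show ?thesis using hp hq v by blast
  next
    case 2
    moreover have "h *v (- v) = r *\<^sub>R (- v)" "h *v (- q) = - r *\<^sub>R (- q)"
      using v hq by (simp_all add: matvec_simps)
    ultimately show ?thesis using hp(2) by blast
  qed
qed

text \<open>
  The Lorentz reflection \<open>R\<close> along \<open>e - (p + q)\<close> exchanges the time axis \<open>e\<close> and \<open>p + q\<close>.  Conjugation by \<open>R\<close>
  puts \<open>h\<close> into the form treated in \<open>boost_part_invariant_axis\<close>.  Since \<open>p + q\<close> points into the
  past, \<open>e - (p + q)\<close> is timelike, so the reflection exists.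
\<close>

lemma boost_part_invariant:
  fixes g :: "('m::{finite,zero} square_matrix) set"
  assumes h: "h \<in> so1" and pq: "hyperbolic_pair p q" and past: "(p + q) $ 0 < 0"
    and hpq: "h *v p = r *\<^sub>R p" "h *v q = - r *\<^sub>R q" and r: "r \<noteq> 0"
    and g: "subspace g" and inv: "\<And>X. X \<in> g \<Longrightarrow> commutator h X \<in> g" and X: "X \<in> g"
  shows "commutator (wedge p q) X \<in> g"
proof -
  note pq' = hyperbolic_pair_simps[OF pq]
  define e :: "(real, 'm) vec" where "e = axis 0 1"
  define a where "a = e - (p + q)"
  have e: "lorentz e x = - x $ 0" "lorentz x e = - x $ 0" for x
    using lorentz_axis[of 0 x] lorentz_commute[of x e] by (simp_all add: e_def)
  have e0: "e $ 0 = 1" by (simp add: e_def)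
  have ae: "lorentz a e = -1 + (p + q) $ 0" by (simp add: e a_def e0)
  have aa: "lorentz a a = 2 * lorentz a e"
    using e0 pq' by (simp add: e a_def lorentz_simps)
  have ne: "lorentz a e \<noteq> 0" using past ae by simp
  define R where "R = matrix (\<lambda>x. x - (lorentz a x / lorentz a e) *\<^sub>R a)"
  have R: "R *v x = x - (lorentz a x / lorentz a e) *\<^sub>R a" for x
  proof -
    have "linear (\<lambda>x. x - (lorentz a x / lorentz a e) *\<^sub>R a)"
      by (intro linearI) (simp_all add: lorentz_simps algebra_simps add_divide_distrib)
    then show ?thesis
      unfolding R_def linear_matrix_vector_mul_eq[symmetric] by (rule matrix_works)
  qed
  have RR: "R *v (R *v x) = x" for x
  proof -
    have "lorentz a (R *v x) = - lorentz a x" using ne by (simp add: R lorentz_simps aa)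
    then have "R *v (R *v x) = R *v x + (lorentz a x / lorentz a e) *\<^sub>R a" by (simp add: R[of "R *v x"])
    then show ?thesis by (simp add: R)
  qed
  have Rsym: "lorentz (R *v x) y = lorentz x (R *v y)" for x y
    using lorentz_commute[of x a] by (simp add: R lorentz_simps)
  have Re: "R *v e = p + q" using ne by (simp add: R) (simp add: a_def)
  have Rt: "R *v (p + q) = e" using RR[of e] Re by simp
  define f where "f = R *v (p - q)"
  define K where "K Y = R ** Y ** R" for Y
  have KK: "K (K Y) = Y" for Y by (simp add: K_def matrix_eq matvec_simps RR)
  have linK: "linear K" by (rule linearI) (simp_all add: K_def matrix_mult_simps)
  have Kcomm: "commutator (K Y) (K Z) = K (commutator Y Z)" for Y Z
    by (simp add: matrix_eq commutator_mult_vec K_def matvec_simps RR)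
  have Kw: "K (wedge x y) = wedge (R *v x) (R *v y)" for x y
    by (simp add: matrix_eq K_def matvec_simps wedge_mult_vec Rsym)
  have Kso: "K h \<in> so1"
    using so1_skew[OF h] by (simp add: so1_def K_def matvec_simps Rsym)
  have f0: "f $ 0 = 0"
  proof -
    have "lorentz e f = 0" unfolding f_def Rsym[symmetric] Re using pq' by (simp add: lorentz_simps)
    then show ?thesis by (simp add: e)
  qed
  have "lorentz f f = 1" unfolding f_def Rsym RR using pq' by (simp add: lorentz_simps)
  then have ff: "f \<bullet> f = 1" using f0 by (simp add: lorentz_eq_inner)
  have he: "K h *v axis 0 1 = r *\<^sub>R f"
    using Re hpq by (simp add: K_def matvec_simps e_def f_def scaleR_diff_right)
  have hf: "K h *v f = r *\<^sub>R axis 0 1"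
  proof -
    have "K h *v f = R *v (h *v (p - q))" by (simp add: K_def matvec_simps f_def RR)
    also have "h *v (p - q) = r *\<^sub>R (p + q)" using hpq by (simp add: matvec_simps scaleR_add_right)
    finally show ?thesis using Rt by (simp add: matrix_vector_mult_scaleR e_def)
  qed
  have "commutator (K h) Y \<in> K ` g" if "Y \<in> K ` g" for Y
    using that inv Kcomm by auto
  then have "commutator (wedge e f) (K X) \<in> K ` g"
    unfolding e_def using X
    by (intro boost_part_invariant_axis[OF Kso f0 ff he hf r linear_subspace_image[OF linK g]]) auto
  also have "commutator (wedge e f) (K X) = K (commutator (K (wedge e f)) X)"
    using Kcomm[of "K (wedge e f)" X] by (simp add: KK)
  finally have "commutator (K (wedge e f)) X \<in> g" using KK by (metis image_iff)
  also have "K (wedge e f) = - 2 *\<^sub>R wedge p q"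
  proof -
    have "wedge p p = 0" "wedge q q = 0" by (simp_all add: matrix_eq wedge_mult_vec)
    then show ?thesis
      unfolding Kw Re f_def RR by (simp add: wedge_simps wedge_swap[of q p] scaleR_2)
  qed
  also have "commutator (- 2 *\<^sub>R wedge p q) X = - 2 *\<^sub>R commutator (wedge p q) X"
    by (simp add: commutator_def matrix_mult_simps scaleR_diff_right)
  finally have "(- 1/2) *\<^sub>R (- 2 *\<^sub>R commutator (wedge p q) X) \<in> g" using g by (metis subspace_scale)
  then show ?thesis by simp
qed

text \<open>
  For \<open>n \<ge> 1\<close> the previous results combine; for \<open>n = 0\<close> the algebra \<open>so(1,n)\<close> is zero.
\<close>

theorem irreducible_subalgebra_eq_so1:
  fixes g :: "('m::{finite,zero} square_matrix) set"
  assumes g: "subspace g" "g \<subseteq> so1"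
    and br: "\<And>X Y. X \<in> g \<Longrightarrow> Y \<in> g \<Longrightarrow> commutator X Y \<in> g"
    and irr: "acts_irreducibly g"
  shows "g = so1"
proof (cases "CARD('m) \<ge> 2")
  case True
  obtain h v r where h: "h \<in> g" "v \<noteq> 0" "r \<noteq> 0" "h *v v = r *\<^sub>R v"
    using irreducible_exists_eigenvector[OF g br irr True] by blast
  then have hso: "h \<in> so1" using g(2) by blast
  obtain p q where pq: "hyperbolic_pair p q" "h *v p = r *\<^sub>R p" "h *v q = - r *\<^sub>R q" "(p + q) $ 0 < 0"
    using so1_eigenvector_hyperbolic_pair[OF hso h(2,4,3)] by blast
  show ?thesis
    using boost_invariant_irreducible_eq_so1[OF pq(1) g br irr True]
      boost_part_invariant[OF hso pq(1,4,2,3) h(3) g(1) br[OF h(1)]] by blast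
next
  case False
  then have "card (UNIV :: 'm set) \<le> 1" by simp
  then have index: "i = 0" for i :: 'm by (metis UNIV_I card_le_Suc0_iff_eq finite One_nat_def)
  have vec0: "x = 0" if "x $ 0 = 0" for x :: "(real, 'm) vec"
  proof (subst vec_eq_iff, rule allI)
    show "x $ i = 0 $ i" for i using that index[of i] by simp
  qed
  have "X = 0" if X: "X \<in> so1" for X :: "'m square_matrix"
  proof -
    have "X *v x = 0" for x
    proof -
      have "x $ 0 * (X *v x) $ 0 = 0"
      proof -
        have "UNIV - {0 :: 'm} = {}" using index by blast
        then have "lorentz x (X *v x) = - (x $ 0 * (X *v x) $ 0)" by (simp only: lorentz_def sum.empty)
        then show ?thesis using so1_orthogonal[OF X, of x] by simp
      qed
      then show ?thesis using vec0[of x] vec0[of "X *v x"] by auto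
    qed
    then show ?thesis by (simp add: matrix_eq)
  qed
  then show ?thesis using g subspace_0[OF g(1)] subspace_0[OF subspace_so1] by blast
qed

section \<open>Calculus of continuously differentiable maps\<close>

lemma frechet_derivative_eqI: "(f has_derivative f') (at x) \<Longrightarrow> frechet_derivative f (at x) v = f' v"
  using frechet_derivative_at by metis

lemma Ck_on_cong:
  assumes "open V" "\<And>x. x \<in> V \<Longrightarrow> f x = g x" "Ck_on k V f"
  shows "Ck_on k V g"
  using assms(2,3)
proof (induction k arbitrary: f g)
  case 0
  then show ?case using continuous_on_cong by (metis Ck_on.simps(1))
next
  case (Suc k)
  have f: "f differentiable at x" if "x \<in> V" for x using Suc.prems(2) that by simp
  have "g differentiable at x" if "x \<in> V" for x
  proof -
    have "f differentiable at x" using f[OF that] .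
    then obtain D where "(f has_derivative D) (at x)" by (auto simp: differentiable_def)
    then have "(g has_derivative D) (at x)"
      by (rule has_derivative_transform_within_open[OF _ assms(1) that Suc.prems(1)])
    then show ?thesis by (auto simp: differentiable_def)
  qed
  moreover have "Ck_on k V (\<lambda>x. frechet_derivative g (at x) v)" for v
  proof (rule Suc.IH)
    show "Ck_on k V (\<lambda>x. frechet_derivative f (at x) v)" using Suc.prems(2) by simp
    show "frechet_derivative f (at x) v = frechet_derivative g (at x) v" if "x \<in> V" for x
      using frechet_derivative_transform_within_open[OF f[OF that] assms(1) that Suc.prems(1)] by simp
  qed
  ultimately show ?case by simp
qed

lemma Ck_on_SucD: "Ck_on (Suc k) V f \<Longrightarrow> Ck_on k V f"
proof (induction k arbitrary: f)
  case 0
  then have "\<forall>x\<in>V. isCont f x" by (auto intro: differentiable_imp_continuous_within)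
  then show ?case by (simp add: continuous_at_imp_continuous_on)
next
  case (Suc k)
  then show ?case by (metis Ck_on.simps(2))
qed

text \<open>
  Allows the derivative to be given by any formula that is valid on the open set.
\<close>

lemma Ck_on_SucI:
  assumes "open V" "\<And>x. x \<in> V \<Longrightarrow> (f has_derivative f' x) (at x)"
    and "\<And>v. Ck_on k V (\<lambda>x. f' x v)"
  shows "Ck_on (Suc k) V f"
proof -
  have "Ck_on k V (\<lambda>x. frechet_derivative f (at x) v)" for v
    by (rule Ck_on_cong[OF assms(1) _ assms(3)]) (simp add: frechet_derivative_eqI[OF assms(2)])
  moreover have "f differentiable at x" if "x \<in> V" for x
    using assms(2)[OF that] by (auto simp: differentiable_def)
  ultimately show ?thesis by simp
qed

lemma Ck_on_SucE:
  assumes "Ck_on (Suc k) V f" "x \<in> V"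
  shows "(f has_derivative frechet_derivative f (at x)) (at x)"
  using assms frechet_derivative_works by auto

lemma Ck_on_const: "Ck_on k V (\<lambda>x. c)"
  by (induction k arbitrary: c) (simp_all add: frechet_derivative_const)

lemma Ck_on_bounded_linear:
  assumes "bounded_linear L" "open V"
  shows "Ck_on k V L"
proof (cases k)
  case 0
  then show ?thesis using assms by (simp add: linear_continuous_on)
next
  case (Suc j)
  have "(L has_derivative L) (at x)" for x using assms(1) by (rule bounded_linear_imp_has_derivative)
  then show ?thesis unfolding Suc by (intro Ck_on_SucI[where f' = "\<lambda>_. L"] Ck_on_const assms(2))
qed

lemma Ck_on_add:
  assumes "open V" "Ck_on k V f" "Ck_on k V g"
  shows "Ck_on k V (\<lambda>x. f x + g x)"
  using assms(2,3)
proof (induction k arbitrary: f g)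
  case (Suc k)
  have "((\<lambda>x. f x + g x) has_derivative
      (\<lambda>v. frechet_derivative f (at x) v + frechet_derivative g (at x) v)) (at x)" if "x \<in> V" for x
    using Suc.prems that by (intro has_derivative_add Ck_on_SucE)
  then show ?case using Suc by (intro Ck_on_SucI[OF assms(1)]) auto
qed (simp add: continuous_on_add)

lemma Ck_on_bilinear:
  assumes B: "bounded_bilinear B" and "open V" "Ck_on k V f" "Ck_on k V g"
  shows "Ck_on k V (\<lambda>x. B (f x) (g x))"
  using assms(3,4)
proof (induction k arbitrary: f g)
  case 0
  then show ?case by (simp add: bounded_bilinear.continuous_on[OF B])
next
  case (Suc k)
  have "((\<lambda>x. B (f x) (g x)) has_derivative
      (\<lambda>v. B (f x) (frechet_derivative g (at x) v) + B (frechet_derivative f (at x) v) (g x))) (at x)"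
    if "x \<in> V" for x
    using Suc.prems that by (intro bounded_bilinear.FDERIV[OF B] Ck_on_SucE)
  moreover have "Ck_on k V (\<lambda>x. B (f x) (frechet_derivative g (at x) v) + B (frechet_derivative f (at x) v) (g x))" for v
    using Suc.prems Ck_on_SucD[OF Suc.prems(1)] Ck_on_SucD[OF Suc.prems(2)]
    by (intro Ck_on_add Suc.IH assms(2)) auto
  ultimately show ?case by (intro Ck_on_SucI[OF assms(2)])
qed

lemma Ck_on_scaleR:
  "open V \<Longrightarrow> Ck_on k V f \<Longrightarrow> Ck_on k V (\<lambda>x. c *\<^sub>R f x)"
  by (rule Ck_on_bilinear[OF bounded_bilinear_scaleR _ Ck_on_const])

lemma Ck_on_diff:
  assumes "open V" "Ck_on k V f" "Ck_on k V g"
  shows "Ck_on k V (\<lambda>x. f x - g x)"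
  using Ck_on_add[OF assms(1,2) Ck_on_scaleR[OF assms(1,3), of "-1"]] by simp

lemma matrix_inv_works:
  fixes A :: "real^'n^'n"
  assumes "invertible A"
  shows "A ** matrix_inv A = mat 1" "matrix_inv A ** A = mat 1"
  using someI_ex[of "\<lambda>A'. A ** A' = mat 1 \<and> A' ** A = mat 1"] assms
  unfolding invertible_def matrix_inv_def by auto

lemma matrix_inv_eqI:
  fixes A :: "real^'n^'n"
  assumes "A ** B = mat 1"
  shows "invertible A" "matrix_inv A = B"
proof -
  have "B ** A = mat 1" using assms by (simp add: matrix_left_right_inverse)
  then show inv: "invertible A" using assms by (auto simp: invertible_def)
  have "matrix_inv A = matrix_inv A ** (A ** B)" by (simp add: assms)
  also have "\<dots> = B" by (simp add: matrix_mul_assoc matrix_inv_works[OF inv])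
  finally show "matrix_inv A = B" .
qed

lemma continuous_on_det:
  fixes f :: "'a::topological_space \<Rightarrow> real^'n^'n"
  assumes "continuous_on S f"
  shows "continuous_on S (\<lambda>x. det (f x))"
  unfolding det_def using assms by (intro continuous_intros)

lemma open_invertible: "open {A :: real^'n^'n. invertible A}"
proof -
  have "open ((\<lambda>A :: real^'n^'n. det A) -` (- {0}))"
    by (intro open_vimage continuous_on_det continuous_on_id open_Compl closed_singleton)
  then show ?thesis by (simp add: invertible_det_nz vimage_def)
qed

text \<open>
  By Cramer's rule the entries of the inverse are quotients of determinants.
\<close>

lemma continuous_on_matrix_inv: "continuous_on {A :: real^'n^'n. invertible A} matrix_inv"
proof -
  define c :: "real^'n^'n \<Rightarrow> real^'n^'n" where
    "c A = (\<chi> k j. det (\<chi> i l. if l = k then axis j 1 $ i else A $ i $ l) / det A)" for A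
  have "matrix_inv A = c A" if "invertible A" for A :: "real^'n^'n"
  proof -
    have "det A \<noteq> 0" using that by (simp add: invertible_det_nz)
    moreover have "A *v (matrix_inv A *v axis j 1) = axis j 1" for j
      by (simp add: matrix_vector_mul_assoc matrix_inv_works[OF that])
    ultimately have "matrix_inv A *v axis j 1 = (\<chi> k. det (\<chi> i l. if l = k then axis j 1 $ i else A $ i $ l) / det A)" for j
      using cramer by blast
    then have "(matrix_inv A *v axis j 1) $ k = c A $ k $ j" for j k by (simp add: c_def)
    then show ?thesis by (simp add: vec_eq_iff matrix_vector_mult_basis column_def)
  qed
  moreover have "continuous_on {A :: real^'n^'n. invertible A} c"
  proof -
    have "continuous_on S (\<lambda>A :: real^'n^'n. if l = k then axis j 1 $ i else A $ i $ l)" for S and i j k l :: 'n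
      by (cases "l = k") (auto intro!: continuous_intros)
    then show ?thesis
      unfolding c_def
      by (intro continuous_on_vec_lambda continuous_on_divide continuous_on_det continuous_on_id)
        (auto simp: invertible_det_nz)
  qed
  ultimately show ?thesis using continuous_on_cong by (metis (no_types, lifting) mem_Collect_eq)
qed

lemma isCont_matrix_inv: "invertible A \<Longrightarrow> isCont matrix_inv (A :: real^'n^'n)"
  using continuous_on_matrix_inv open_invertible continuous_on_eq_continuous_at by blast

text \<open>
  From \<open>B\<^sup>-\<^sup>1 - A\<^sup>-\<^sup>1 = - B\<^sup>-\<^sup>1 (B - A) A\<^sup>-\<^sup>1\<close>, the remainder is \<open>- (B\<^sup>-\<^sup>1 - A\<^sup>-\<^sup>1) (B - A) A\<^sup>-\<^sup>1\<close>, which is of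
  smaller order than \<open>B - A\<close> by continuity of the inverse.
\<close>

lemma has_derivative_matrix_inv:
  fixes A :: "real^'n^'n"
  assumes A: "invertible A"
  shows "(matrix_inv has_derivative (\<lambda>H. - (matrix_inv A ** H ** matrix_inv A))) (at A)"
proof -
  let ?I = "matrix_inv :: real^'n^'n \<Rightarrow> real^'n^'n"
  obtain K where K: "K > 0" "\<And>(X :: real^'n^'n) (Y :: real^'n^'n). norm (X ** Y) \<le> norm X * norm Y * K"
    using bounded_bilinear.pos_bounded[OF bounded_bilinear_matrix_mult] by blast
  have lin: "bounded_linear (\<lambda>H. - (?I A ** H ** ?I A))"
    by (intro bounded_linear_minus
        bounded_linear_compose[OF bounded_bilinear.bounded_linear_left[OF bounded_bilinear_matrix_mult]]
        bounded_bilinear.bounded_linear_right[OF bounded_bilinear_matrix_mult])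
  have "((\<lambda>B. norm (?I B - ?I A - - (?I A ** (B - A) ** ?I A)) / norm (B - A)) \<longlongrightarrow> 0) (at A)"
  proof (rule Lim_null_comparison)
    have "\<forall>\<^sub>F B in at A. invertible B"
      using open_invertible A eventually_at_topological by blast
    moreover have "\<forall>\<^sub>F B in at A. B \<noteq> A" by (simp add: eventually_at_filter)
    ultimately show "\<forall>\<^sub>F B in at A. norm (norm (?I B - ?I A - - (?I A ** (B - A) ** ?I A)) / norm (B - A))
        \<le> norm (?I B - ?I A) * (K * K * norm (?I A))"
    proof eventually_elim
      case (elim B)
      have diff: "?I B - ?I A = - (?I B ** (B - A) ** ?I A)"
        using matrix_inv_works[OF A] matrix_inv_works[OF elim(1)]
        by (simp add: matrix_mult_simps matrix_mul_assoc[symmetric])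
      have "?I B - ?I A - - (?I A ** (B - A) ** ?I A) = - ((?I B - ?I A) ** (B - A) ** ?I A)"
        by (subst diff) (simp add: matrix_mult_simps)
      then have "norm (?I B - ?I A - - (?I A ** (B - A) ** ?I A)) \<le> norm ((?I B - ?I A) ** (B - A)) * norm (?I A) * K"
        using K(2)[of "(?I B - ?I A) ** (B - A)" "?I A"] by simp
      also have "\<dots> \<le> norm (?I B - ?I A) * norm (B - A) * K * norm (?I A) * K"
        using K by (intro mult_right_mono) auto
      finally show ?case using elim(2) by (simp add: divide_simps mult_ac)
    qed
    have "((\<lambda>B. norm (?I B - ?I A) * (K * K * norm (?I A))) \<longlongrightarrow> norm (?I A - ?I A) * (K * K * norm (?I A))) (at A)"
      using isCont_matrix_inv[OF A] unfolding isCont_def by (intro tendsto_intros)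
    then show "((\<lambda>B. norm (?I B - ?I A) * (K * K * norm (?I A))) \<longlongrightarrow> 0) (at A)" by simp
  qed
  then show ?thesis using lin by (simp add: has_derivative_iff_norm)
qed

lemma Ck_on_matrix_inv:
  fixes f :: "'a::euclidean_space \<Rightarrow> real^'n^'n"
  assumes V: "open V" and f: "Ck_on k V f" and inv: "\<And>x. x \<in> V \<Longrightarrow> invertible (f x)"
  shows "Ck_on k V (\<lambda>x. matrix_inv (f x))"
  using f
proof (induction k)
  case 0
  then show ?case
    using continuous_on_compose2[OF continuous_on_matrix_inv, of V f] inv by auto
next
  case (Suc k)
  have "((\<lambda>x. matrix_inv (f x)) has_derivative
      (\<lambda>v. - (matrix_inv (f x) ** frechet_derivative f (at x) v ** matrix_inv (f x)))) (at x)" if "x \<in> V" for x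
    by (rule has_derivative_compose[OF Ck_on_SucE[OF Suc.prems that] has_derivative_matrix_inv[OF inv[OF that]]])
  moreover have "Ck_on k V (\<lambda>x. - (matrix_inv (f x) ** frechet_derivative f (at x) v ** matrix_inv (f x)))" for v
  proof -
    have "Ck_on k V (\<lambda>x. (-1) *\<^sub>R (matrix_inv (f x) ** frechet_derivative f (at x) v ** matrix_inv (f x)))"
      using Suc.IH[OF Ck_on_SucD[OF Suc.prems]] Suc.prems
      by (intro Ck_on_scaleR V Ck_on_bilinear[OF bounded_bilinear_matrix_mult]) auto
    then show ?thesis by simp
  qed
  ultimately show ?case by (intro Ck_on_SucI[OF V])
qed

section \<open>The Cayley transform\<close>

text \<open>
  The Cayley transform \<open>(1 - X)\<^sup>-\<^sup>1 (1 + X)\<close>, written so that a single inverse occurs.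
\<close>

definition cayley :: "real^'n^'n \<Rightarrow> real^'n^'n" where
  "cayley X = 2 *\<^sub>R matrix_inv (mat 1 - X) - mat 1"

definition cayley_inv :: "real^'n^'n \<Rightarrow> real^'n^'n" where
  "cayley_inv Y = mat 1 - 2 *\<^sub>R matrix_inv (mat 1 + Y)"

lemma cayley_inv_cayley:
  fixes X :: "real^'n^'n"
  assumes "invertible (mat 1 - X)"
  shows "invertible (mat 1 + cayley X)" "cayley_inv (cayley X) = X"
proof -
  have "(mat 1 + cayley X) ** ((1/2) *\<^sub>R (mat 1 - X)) = mat 1"
    using matrix_inv_works[OF assms] by (simp add: cayley_def matrix_mult_simps(9,10))
  note inv = matrix_inv_eqI[OF this]
  show "invertible (mat 1 + cayley X)" by (rule inv)
  show "cayley_inv (cayley X) = X" by (simp add: cayley_inv_def inv)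
qed

lemma cayley_cayley_inv:
  fixes Y :: "real^'n^'n"
  assumes "invertible (mat 1 + Y)"
  shows "invertible (mat 1 - cayley_inv Y)" "cayley (cayley_inv Y) = Y"
proof -
  have "(mat 1 - cayley_inv Y) ** ((1/2) *\<^sub>R (mat 1 + Y)) = mat 1"
    using matrix_inv_works[OF assms] by (simp add: cayley_inv_def matrix_mult_simps(9,10))
  note inv = matrix_inv_eqI[OF this]
  show "invertible (mat 1 - cayley_inv Y)" by (rule inv)
  show "cayley (cayley_inv Y) = Y" by (simp add: cayley_def inv)
qed

lemma matrix_inv_mult_vec:
  fixes A :: "real^'n^'n"
  assumes "invertible A"
  shows "A *v (matrix_inv A *v x) = x" "matrix_inv A *v (A *v x) = x"
  using matrix_inv_works[OF assms] by (simp_all add: matrix_vector_mul_assoc)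

lemma cayley_in_O1:
  assumes X: "X \<in> so1" and inv: "invertible (mat 1 - X)"
  shows "cayley X \<in> O1"
proof -
  have C: "cayley X *v ((mat 1 - X) *v a) = a + X *v a" for a
  proof -
    have "cayley X *v z = 2 *\<^sub>R (matrix_inv (mat 1 - X) *v z) - z" for z
      by (simp add: cayley_def matrix_vector_mult_diff_rdistrib matrix_vector_mult_scaleR_left)
    then have "cayley X *v ((mat 1 - X) *v a) = 2 *\<^sub>R a - (mat 1 - X) *v a"
      by (simp only: matrix_inv_mult_vec(2)[OF inv])
    then show ?thesis by (simp add: scaleR_2 matrix_vector_mult_diff_rdistrib)
  qed
  have "lorentz (cayley X *v x) (cayley X *v y) = lorentz x y" for x y
  proof -
    define a b where "a = matrix_inv (mat 1 - X) *v x" and "b = matrix_inv (mat 1 - X) *v y"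
    have x: "x = (mat 1 - X) *v a" "y = (mat 1 - X) *v b"
      by (simp_all add: a_def b_def matrix_inv_mult_vec[OF inv])
    show ?thesis
      unfolding x C using so1_skew[OF X, of a b] by (simp add: lorentz_simps matvec_simps)
  qed
  then show ?thesis by (simp add: O1_def)
qed

lemma cayley_inv_in_so1:
  assumes Y: "Y \<in> O1" and inv: "invertible (mat 1 + Y)"
  shows "cayley_inv Y \<in> so1"
proof -
  have C: "cayley_inv Y *v ((mat 1 + Y) *v a) = Y *v a - a" for a
  proof -
    have "cayley_inv Y *v z = z - 2 *\<^sub>R (matrix_inv (mat 1 + Y) *v z)" for z
      by (simp add: cayley_inv_def matrix_vector_mult_diff_rdistrib matrix_vector_mult_scaleR_left)
    then have "cayley_inv Y *v ((mat 1 + Y) *v a) = (mat 1 + Y) *v a - 2 *\<^sub>R a"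
      by (simp only: matrix_inv_mult_vec(2)[OF inv])
    then show ?thesis by (simp add: scaleR_2 matrix_vector_mult_add_rdistrib)
  qed
  have "lorentz (cayley_inv Y *v x) y = - lorentz x (cayley_inv Y *v y)" for x y
  proof -
    define a b where "a = matrix_inv (mat 1 + Y) *v x" and "b = matrix_inv (mat 1 + Y) *v y"
    have x: "x = (mat 1 + Y) *v a" "y = (mat 1 + Y) *v b"
      by (simp_all add: a_def b_def matrix_inv_mult_vec[OF inv])
    have "lorentz (Y *v a) (Y *v b) = lorentz a b" using Y by (simp add: O1_def)
    then show ?thesis unfolding x C by (simp add: lorentz_simps matvec_simps)
  qed
  then show ?thesis by (simp add: so1_def)
qed

lemma O1_invertible:
  assumes "A \<in> O1"
  shows "invertible A"
proof -
  have "x = 0" if "A *v x = 0" for x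
  proof (rule lorentz_nondegenerate)
    show "lorentz x y = 0" for y
      using assms that by (simp add: O1_def lorentz_zero_left flip: lorentz_zero_left) (metis lorentz_zero_left)
  qed
  then show ?thesis by (simp add: invertible_left_inverse matrix_left_invertible_ker)
qed

lemma O1_mult: "A \<in> O1 \<Longrightarrow> B \<in> O1 \<Longrightarrow> A ** B \<in> O1"
  by (simp add: O1_def matvec_simps)

lemma O1_one: "mat 1 \<in> O1"
  by (simp add: O1_def)

lemma O1_inv:
  assumes "A \<in> O1"
  shows "matrix_inv A \<in> O1"
proof -
  have "lorentz (matrix_inv A *v x) (matrix_inv A *v y) = lorentz x y" for x y
    using assms matrix_inv_mult_vec(1)[OF O1_invertible[OF assms]]
    unfolding O1_def by (metis (mono_tags, lifting) mem_Collect_eq)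
  then show ?thesis by (simp add: O1_def)
qed

section \<open>The identity component as a connected Lie group\<close>

lemma smooth_on_extensionI:
  assumes "open V" "\<And>k. Ck_on k V g" "S \<subseteq> V" "\<And>x. x \<in> S \<Longrightarrow> g x = f x"
  shows "smooth_on S f"
  using assms unfolding smooth_on_def by (intro ballI exI[of _ V] exI[of _ g]) auto

lemma second_countable_euclidean: "second_countable (euclidean :: 'a::second_countable_topology topology)"
proof -
  obtain B :: "'a set set" where "countable B" "topological_basis B"
    using ex_countable_basis by blast
  then have "countable B" "\<And>V. V \<in> B \<Longrightarrow> open V"
    "\<And>U x. open U \<Longrightarrow> x \<in> U \<Longrightarrow> \<exists>V\<in>B. x \<in> V \<and> V \<subseteq> U"
    using topological_basis_open topological_basisE by metis+
  then show ?thesis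
    unfolding second_countable_def by (intro exI[of _ B]) simp
qed

lemma continuous_on_matrix_mult [continuous_intros]:
  fixes f :: "'a::topological_space \<Rightarrow> real^'n^'m" and g :: "'a \<Rightarrow> real^'p^'n"
  assumes "continuous_on S f" "continuous_on S g"
  shows "continuous_on S (\<lambda>x. f x ** g x)"
  using assms by (rule bounded_bilinear.continuous_on[OF bounded_bilinear_matrix_mult])

lemma Ck_on_imp_continuous_on: "(\<And>k. Ck_on k V f) \<Longrightarrow> continuous_on V f"
  using Ck_on.simps(1) by blast

lemma SO1_0_subset_O1: "SO1_0 \<subseteq> O1"
  by (simp add: SO1_0_def connected_component_subset)

lemma SO1_0_O1: "A \<in> SO1_0 \<Longrightarrow> A \<in> O1"
  using SO1_0_subset_O1 by blast

lemma SO1_0_one: "mat 1 \<in> SO1_0"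
  by (simp add: SO1_0_def O1_one)

lemma connected_SO1_0: "connected SO1_0"
  by (simp add: SO1_0_def)

text \<open>
  All closure properties of \<open>SO(1,n)\<^sub>0\<close> below come from here: a connected set that meets the
  component lies in it.
\<close>

lemma connected_subset_SO1_0:
  assumes "connected T" "T \<subseteq> O1" "A \<in> T" "A \<in> SO1_0"
  shows "T \<subseteq> SO1_0"
proof -
  have "connected_component_set O1 A = SO1_0"
    using assms(4) by (metis SO1_0_def connected_component_eq)
  then show ?thesis using connected_component_maximal[OF assms(3,1,2)] by simp
qed

lemma SO1_0_mult:
  assumes "A \<in> SO1_0" "B \<in> SO1_0"
  shows "A ** B \<in> SO1_0"
proof -
  have "(\<lambda>B. A ** B) ` SO1_0 \<subseteq> SO1_0"
  proof (rule connected_subset_SO1_0)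
    show "connected ((\<lambda>B. A ** B) ` SO1_0)"
      by (intro connected_continuous_image connected_SO1_0 continuous_intros)
    show "(\<lambda>B. A ** B) ` SO1_0 \<subseteq> O1" using O1_mult SO1_0_O1 assms(1) by blast
    show "A \<in> (\<lambda>B. A ** B) ` SO1_0" using SO1_0_one by (intro image_eqI[of _ _ "mat 1"]) auto
  qed (rule assms(1))
  then show ?thesis using assms(2) by blast
qed

lemma matrix_inv_one: "matrix_inv (mat 1) = (mat 1 :: real^'n^'n)"
  by (rule matrix_inv_eqI) simp

lemma SO1_0_inv:
  assumes "A \<in> SO1_0"
  shows "matrix_inv A \<in> SO1_0"
proof -
  have "matrix_inv ` SO1_0 \<subseteq> SO1_0"
  proof (rule connected_subset_SO1_0[OF _ _ _ SO1_0_one])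
    show "connected (matrix_inv ` SO1_0)"
      by (intro connected_continuous_image connected_SO1_0 continuous_on_subset[OF continuous_on_matrix_inv])
        (auto intro: O1_invertible SO1_0_O1)
    show "matrix_inv ` SO1_0 \<subseteq> O1" using O1_inv SO1_0_O1 by blast
    show "mat 1 \<in> matrix_inv ` SO1_0" using SO1_0_one matrix_inv_one by (metis image_iff)
  qed
  then show ?thesis using assms by blast
qed

lemma Ck_on_cayley:
  assumes V: "open V" and f: "Ck_on k V f" "\<And>x. x \<in> V \<Longrightarrow> invertible (mat 1 - f x)"
  shows "Ck_on k V (\<lambda>x. cayley (f x))"
  unfolding cayley_def
  using assms by (intro Ck_on_diff Ck_on_scaleR Ck_on_matrix_inv Ck_on_const)

lemma Ck_on_cayley_inv:
  assumes V: "open V" and f: "Ck_on k V f" "\<And>x. x \<in> V \<Longrightarrow> invertible (mat 1 + f x)"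
  shows "Ck_on k V (\<lambda>x. cayley_inv (f x))"
  unfolding cayley_inv_def
  using assms by (intro Ck_on_diff Ck_on_scaleR Ck_on_matrix_inv Ck_on_const Ck_on_add)

lemmas Ck_on_matrix_mult = Ck_on_bilinear[OF bounded_bilinear_matrix_mult]

lemma cayley_0: "cayley 0 = mat 1"
  by (simp add: cayley_def scaleR_2 matrix_inv_one)

lemma exists_cayley_radius:
  "\<exists>r>0. \<forall>X :: real^'n^'n. norm X < r \<longrightarrow> invertible (mat 1 - X)"
proof -
  have "open ((\<lambda>X :: real^'n^'n. mat 1 - X) -` {A. invertible A})"
    by (intro open_vimage open_invertible continuous_intros)
  moreover have "0 \<in> (\<lambda>X :: real^'n^'n. mat 1 - X) -` {A. invertible A}"
    using matrix_inv_eqI(1)[of "mat 1 :: real^'n^'n" "mat 1"] by simp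
  ultimately obtain r where "r > 0" "ball 0 r \<subseteq> (\<lambda>X :: real^'n^'n. mat 1 - X) -` {A. invertible A}"
    by (rule openE)
  then show ?thesis by (intro exI[of _ r]) (auto simp: subset_iff)
qed

definition cayley_chart :: "'m::{finite,zero} square_matrix \<Rightarrow> 'm::{finite,zero} square_matrix \<Rightarrow> 'm::{finite,zero} square_matrix" where
  "cayley_chart A X = A ** cayley X"

definition cayley_coord :: "'m::{finite,zero} square_matrix \<Rightarrow> 'm::{finite,zero} square_matrix \<Rightarrow> 'm::{finite,zero} square_matrix" where
  "cayley_coord A B = cayley_inv (matrix_inv A ** B)"

lemma cayley_coord_chart:
  assumes "A \<in> O1" "invertible (mat 1 - X)"
  shows "cayley_coord A (cayley_chart A X) = X"
  using cayley_inv_cayley[OF assms(2)] matrix_inv_works[OF O1_invertible[OF assms(1)]]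
  by (simp add: cayley_coord_def cayley_chart_def matrix_mul_assoc)

lemma cayley_chart_coord:
  assumes "A \<in> O1" "invertible (mat 1 + matrix_inv A ** B)"
  shows "cayley_chart A (cayley_coord A B) = B"
  using cayley_cayley_inv[OF assms(2)] matrix_inv_works[OF O1_invertible[OF assms(1)]]
  by (simp add: cayley_coord_def cayley_chart_def matrix_mul_assoc)

lemma open_coord_domain:
  fixes A :: "real^'n^'n"
  shows "open {B. invertible (mat 1 + matrix_inv A ** B)}"
proof -
  have "open ((\<lambda>B. mat 1 + matrix_inv A ** B) -` {C. invertible C})"
    by (intro open_vimage open_invertible continuous_intros)
  then show ?thesis by (simp add: vimage_def)
qed

lemma continuous_on_cayley_coord: "continuous_on {B. invertible (mat 1 + matrix_inv A ** B)} (cayley_coord A)"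
proof -
  have "Ck_on 0 {B. invertible (mat 1 + matrix_inv A ** B)} (\<lambda>B. cayley_inv (matrix_inv A ** B))"
    by (intro Ck_on_cayley_inv Ck_on_matrix_mult Ck_on_const Ck_on_bounded_linear open_coord_domain
        bounded_linear_ident) simp
  then show ?thesis by (simp add: cayley_coord_def[abs_def])
qed

text \<open>
  Every chart of \<open>SO(1,n)\<^sub>0\<close> is a translate of the Cayley transform on one and the same piece \<open>W\<close> of
  \<open>so(1,n)\<close>.  A ball is used because its intersection with \<open>so(1,n)\<close> is connected, which keeps the image of a chart inside the component.
\<close>

context
  fixes r :: real and W :: "('m::{finite,zero} square_matrix) set"
  assumes r: "r > 0" "\<And>X :: 'm::{finite,zero} square_matrix. norm X < r \<Longrightarrow> invertible (mat 1 - X)"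
    and W: "W = so1 \<inter> ball 0 r"
begin

lemma invertible_W: "X \<in> W \<Longrightarrow> invertible (mat 1 - X)"
  using r(2) by (simp add: W)

lemma Ck_on_cayley_chart:
  fixes f :: "'a::euclidean_space \<Rightarrow> 'm square_matrix"
  assumes "open V" "Ck_on k V f" "\<And>x. x \<in> V \<Longrightarrow> norm (f x) < r"
  shows "Ck_on k V (\<lambda>x. cayley_chart A (f x))"
  unfolding cayley_chart_def using assms r(2)
  by (intro Ck_on_matrix_mult Ck_on_cayley Ck_on_const) auto

lemma continuous_on_cayley_chart: "continuous_on W (cayley_chart A)"
proof -
  have "Ck_on 0 (ball 0 r) (\<lambda>X. cayley_chart A X)"
    by (intro Ck_on_cayley_chart Ck_on_bounded_linear bounded_linear_ident) auto
  then show ?thesis by (auto simp: W intro: continuous_on_subset)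
qed

lemma cayley_chart_in_SO1_0:
  assumes "A \<in> SO1_0" "X \<in> W"
  shows "cayley_chart A X \<in> SO1_0"
proof -
  have "cayley_chart A ` W \<subseteq> SO1_0"
  proof (rule connected_subset_SO1_0[OF _ _ _ assms(1)])
    have "convex W" unfolding W by (intro convex_Int convex_ball subspace_imp_convex subspace_so1)
    then show "connected (cayley_chart A ` W)"
      by (intro connected_continuous_image continuous_on_cayley_chart convex_connected)
    show "cayley_chart A ` W \<subseteq> O1"
      using invertible_W SO1_0_O1[OF assms(1)]
      by (auto simp: cayley_chart_def W intro!: O1_mult cayley_in_O1)
    show "A \<in> cayley_chart A ` W"
      using r(1) subspace_0[OF subspace_so1]
      by (intro image_eqI[of _ _ 0]) (auto simp: cayley_chart_def cayley_0 W)
  qed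
  then show ?thesis using assms(2) by blast
qed

lemma inj_cayley_chart: "A \<in> SO1_0 \<Longrightarrow> inj_on (cayley_chart A) W"
  using cayley_coord_chart SO1_0_O1 invertible_W by (metis inj_on_def)

lemma inv_into_cayley_chart:
  assumes "A \<in> SO1_0" "B \<in> cayley_chart A ` W"
  shows "inv_into W (cayley_chart A) B = cayley_coord A B"
  using assms inv_into_f_f[OF inj_cayley_chart[OF assms(1)]] cayley_coord_chart[OF SO1_0_O1[OF assms(1)]]
    invertible_W by auto

lemma coord_domain_cayley_chart:
  assumes "A \<in> SO1_0" "B \<in> cayley_chart A ` W"
  shows "invertible (mat 1 + matrix_inv A ** B)"
proof -
  obtain X where X: "X \<in> W" "B = A ** cayley X" using assms(2) by (auto simp: cayley_chart_def)
  then have "matrix_inv A ** B = cayley X"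
    using matrix_inv_works[OF O1_invertible[OF SO1_0_O1[OF assms(1)]]] by (simp add: matrix_mul_assoc)
  then show ?thesis using cayley_inv_cayley(1)[OF invertible_W[OF X(1)]] by simp
qed

text \<open>
  Describes the image by conditions that are open in the space of all matrices, whence \<open>openin_cayley_chart\<close>.
\<close>

lemma image_cayley_chart:
  assumes A: "A \<in> SO1_0"
  shows "cayley_chart A ` W =
    SO1_0 \<inter> ({B. invertible (mat 1 + matrix_inv A ** B)} \<inter> cayley_coord A -` ball 0 r)"
proof (intro equalityI subsetI)
  fix B assume B: "B \<in> cayley_chart A ` W"
  have "cayley_coord A B \<in> W"
    using B cayley_coord_chart[OF SO1_0_O1[OF A] invertible_W] by auto
  then have "cayley_coord A B \<in> ball 0 r" by (simp add: W)
  then show "B \<in> SO1_0 \<inter> ({B. invertible (mat 1 + matrix_inv A ** B)} \<inter> cayley_coord A -` ball 0 r)"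
    using coord_domain_cayley_chart[OF A B] B cayley_chart_in_SO1_0[OF A] by auto
next
  fix B assume B: "B \<in> SO1_0 \<inter> ({B. invertible (mat 1 + matrix_inv A ** B)} \<inter> cayley_coord A -` ball 0 r)"
  then have "matrix_inv A ** B \<in> O1" using O1_mult O1_inv SO1_0_O1 A by blast
  then have "cayley_coord A B \<in> W"
    using B cayley_inv_in_so1 by (auto simp: W cayley_coord_def)
  then show "B \<in> cayley_chart A ` W"
    using cayley_chart_coord[OF SO1_0_O1[OF A], of B] B by (metis IntD1 IntD2 image_eqI mem_Collect_eq)
qed

lemma openin_cayley_chart:
  assumes A: "A \<in> SO1_0"
  shows "openin (top_of_set SO1_0) (cayley_chart A ` W)"
  unfolding image_cayley_chart[OF A]
  by (intro openin_open_Int continuous_open_preimage[OF continuous_on_cayley_coord open_coord_domain open_ball])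

lemma homeomorphic_map_cayley_chart:
  assumes A: "A \<in> SO1_0"
  shows "homeomorphic_map (top_of_set W) (subtopology (top_of_set SO1_0) (cayley_chart A ` W)) (cayley_chart A)"
proof -
  have sub: "subtopology (top_of_set SO1_0) (cayley_chart A ` W) = top_of_set (cayley_chart A ` W)"
    using cayley_chart_in_SO1_0[OF A] by (simp add: subtopology_subtopology Int_absorb1 image_subset_iff)
  have "homeomorphic_maps (top_of_set W) (top_of_set (cayley_chart A ` W)) (cayley_chart A) (cayley_coord A)"
    unfolding homeomorphic_maps_def
    using continuous_on_cayley_chart cayley_coord_chart[OF SO1_0_O1[OF A] invertible_W]
      continuous_on_subset[OF continuous_on_cayley_coord, of "cayley_chart A ` W" A]
      coord_domain_cayley_chart[OF A]
    by auto
  then show ?thesis unfolding sub homeomorphic_map_maps by blast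
qed

text \<open>
  Transition maps, multiplication and inversion in coordinates all have this shape, with \<open>F\<close> a smooth map
  into the space of all matrices; the coordinate \<open>cayley_coord\<close> extends smoothly to an open set of matrices.
\<close>

lemma smooth_on_into_cayley_chart:
  assumes A: "A \<in> SO1_0" and V: "open V" and F: "\<And>k. Ck_on k V F"
    and S: "S \<subseteq> {x \<in> V. F x \<in> cayley_chart A ` W}"
  shows "smooth_on S (\<lambda>x. inv_into W (cayley_chart A) (F x))"
proof (rule smooth_on_extensionI)
  let ?V = "V \<inter> F -` {B. invertible (mat 1 + matrix_inv A ** B)}"
  show V': "open ?V"
    using Ck_on_imp_continuous_on[OF F] V open_coord_domain by (rule continuous_open_preimage)
  have sub: "Ck_on k ?V F" for k
  proof -
    have "Ck_on k V G \<Longrightarrow> V' \<subseteq> V \<Longrightarrow> Ck_on k V' G" for k V' and G :: "'a \<Rightarrow> 'm square_matrix"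
      by (induction k arbitrary: G) (auto intro: continuous_on_subset)
    then show ?thesis using F by blast
  qed
  show "Ck_on k ?V (\<lambda>x. cayley_coord A (F x))" for k
    unfolding cayley_coord_def
    using sub V' by (intro Ck_on_cayley_inv Ck_on_matrix_mult Ck_on_const) auto
  show "S \<subseteq> ?V" using S coord_domain_cayley_chart[OF A] by blast
  show "cayley_coord A (F x) = inv_into W (cayley_chart A) (F x)" if "x \<in> S" for x
    using that S inv_into_cayley_chart[OF A] by auto
qed

text \<open>
  The derivative of the chart at \<open>X\<close> is \<open>H \<mapsto> 2 A (1 - X)\<^sup>-\<^sup>1 H (1 - X)\<^sup>-\<^sup>1\<close>, which can be undone by multiplication.
\<close>

lemma immersion_cayley_chart:
  assumes A: "A \<in> SO1_0" and X: "X \<in> W"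
  shows "\<exists>D. (cayley_chart A has_derivative D) (at X within W) \<and> inj_on D so1"
proof -
  define M where "M = matrix_inv (mat 1 - X)"
  have inv: "invertible (mat 1 - X)" using X by (rule invertible_W)
  have MM: "M ** (mat 1 - X) = mat 1" "(mat 1 - X) ** M = mat 1"
    using matrix_inv_works[OF inv] by (simp_all add: M_def)
  define D where "D H = A ** (2 *\<^sub>R (M ** H ** M))" for H
  have "((\<lambda>X. mat 1 - X) has_derivative (\<lambda>H. - H)) (at X)"
    by (auto intro!: derivative_eq_intros)
  from has_derivative_compose[OF this has_derivative_matrix_inv[OF inv]]
  have "((\<lambda>X. matrix_inv (mat 1 - X)) has_derivative (\<lambda>H. M ** H ** M)) (at X)"
    by (simp add: M_def matrix_mult_simps)
  then have "((\<lambda>X. 2 *\<^sub>R matrix_inv (mat 1 - X) - mat 1) has_derivative (\<lambda>H. 2 *\<^sub>R (M ** H ** M))) (at X)"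
    by (auto intro!: derivative_eq_intros)
  then have "((\<lambda>X. A ** cayley X) has_derivative D) (at X)"
    unfolding cayley_def D_def
    by (rule bounded_linear.has_derivative[OF bounded_bilinear.bounded_linear_right[OF bounded_bilinear_matrix_mult]])
  then have "(cayley_chart A has_derivative D) (at X within W)"
    unfolding cayley_chart_def[abs_def] by (rule has_derivative_at_withinI)
  moreover have "inj_on D so1"
  proof (rule inj_on_inverseI)
    fix H
    have "matrix_inv A ** (A ** Y) = Y" "(mat 1 - X) ** (M ** Y) = Y" "Y ** M ** (mat 1 - X) = Y" for Y
      using matrix_inv_works[OF O1_invertible[OF SO1_0_O1[OF A]]] MM
      by (simp_all add: matrix_mul_assoc) (simp add: matrix_mul_assoc[symmetric])
    then show "(1/2) *\<^sub>R ((mat 1 - X) ** (matrix_inv A ** D H) ** (mat 1 - X)) = H"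
      by (simp add: D_def matrix_mult_simps(9,10) matrix_mul_assoc[symmetric])
  qed
  ultimately show ?thesis by blast
qed

definition cayley_atlas :: "(('m::{finite,zero} square_matrix), ('m::{finite,zero} square_matrix)) parametrization set" where
  "cayley_atlas = (\<lambda>A. (W, cayley_chart A)) ` SO1_0"

lemma lie_subgroup_structure_SO1_0:
  "lie_subgroup_structure SO1_0 so1 (top_of_set SO1_0) cayley_atlas"
  unfolding lie_subgroup_structure_def
proof (intro conjI ballI)
  have chart_smooth: "Ck_on k (ball 0 r) (cayley_chart A)" for k and A :: "'m square_matrix"
    using Ck_on_cayley_chart[OF open_ball Ck_on_bounded_linear[OF bounded_linear_ident], of 0 r k A] by simp
  have WB: "W \<subseteq> ball 0 r" by (simp add: W)
  show "smooth_manifold so1 (top_of_set SO1_0) cayley_atlas"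
    unfolding smooth_manifold_def
  proof (intro conjI)
    show "subspace so1" by (rule subspace_so1)
    show "Hausdorff_space (top_of_set SO1_0)" by (simp add: Hausdorff_space_subtopology)
    show "second_countable (top_of_set SO1_0)"
      by (rule second_countable_subtopology[OF second_countable_euclidean])
    have "A \<in> cayley_chart A ` W" for A
      using r(1) subspace_0[OF subspace_so1]
      by (intro image_eqI[of _ _ 0]) (auto simp: cayley_chart_def cayley_0 W)
    then show "topspace (top_of_set SO1_0) = (\<Union>(W, p)\<in>cayley_atlas. p ` W)"
      using cayley_chart_in_SO1_0 by (auto simp: cayley_atlas_def)
    have "openin (top_of_set so1) W" unfolding W by (rule openin_open_Int[OF open_ball])
    then show "\<forall>(W, p)\<in>cayley_atlas. openin (top_of_set so1) W \<and> openin (top_of_set SO1_0) (p ` W) \<and>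
        homeomorphic_map (top_of_set W) (subtopology (top_of_set SO1_0) (p ` W)) p"
      using openin_cayley_chart homeomorphic_map_cayley_chart by (auto simp: cayley_atlas_def)
    have "smooth_on {x \<in> W. cayley_chart A x \<in> cayley_chart B ` W}
        (\<lambda>x. inv_into W (cayley_chart B) (cayley_chart A x))" if "B \<in> SO1_0" for A B
      using WB by (intro smooth_on_into_cayley_chart[OF that open_ball chart_smooth]) auto
    then show "\<forall>(W, p)\<in>cayley_atlas. \<forall>(W', p')\<in>cayley_atlas.
        smooth_on {x \<in> W. p x \<in> p' ` W'} (\<lambda>x. inv_into W' p' (p x))"
      by (auto simp: cayley_atlas_def)
  qed
  show "inclusion_is_immersion so1 cayley_atlas"
    unfolding inclusion_is_immersion_def cayley_atlas_def
    using immersion_cayley_chart smooth_on_extensionI[OF open_ball chart_smooth WB] by auto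
  show "smooth_map (prod_topology (top_of_set SO1_0) (top_of_set SO1_0)) (product_atlas cayley_atlas cayley_atlas)
      (top_of_set SO1_0) cayley_atlas (\<lambda>(A, B). A ** B)"
    unfolding smooth_map_def
  proof
    show "continuous_map (prod_topology (top_of_set SO1_0) (top_of_set SO1_0)) (top_of_set SO1_0) (\<lambda>(A, B). A ** B)"
      using SO1_0_mult by (auto simp: case_prod_unfold intro!: continuous_intros)
    have "smooth_on {x \<in> W \<times> W. cayley_chart A (fst x) ** cayley_chart B (snd x) \<in> cayley_chart C ` W}
        (\<lambda>x. inv_into W (cayley_chart C) (cayley_chart A (fst x) ** cayley_chart B (snd x)))"
      if "C \<in> SO1_0" for A B C
    proof (rule smooth_on_into_cayley_chart[OF that, of "ball 0 r \<times> ball 0 r"])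
      show "Ck_on k (ball 0 r \<times> ball 0 r) (\<lambda>x. cayley_chart A (fst x) ** cayley_chart B (snd x))" for k
        by (intro Ck_on_matrix_mult Ck_on_cayley_chart open_Times open_ball
            Ck_on_bounded_linear bounded_linear_fst bounded_linear_snd) auto
    qed (use WB in \<open>auto intro: open_Times\<close>)
    then show "\<forall>(V, p)\<in>product_atlas cayley_atlas cayley_atlas. \<forall>(W', p')\<in>cayley_atlas.
       smooth_on {x \<in> V. (case p x of (A, B) \<Rightarrow> A ** B) \<in> p' ` W'}
        (\<lambda>x. inv_into W' p' (case p x of (A, B) \<Rightarrow> A ** B))"
      by (auto simp: product_atlas_def cayley_atlas_def case_prod_unfold)
  qed
  show "smooth_map (top_of_set SO1_0) cayley_atlas (top_of_set SO1_0) cayley_atlas matrix_inv"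
    unfolding smooth_map_def
  proof
    show "continuous_map (top_of_set SO1_0) (top_of_set SO1_0) matrix_inv"
      using SO1_0_inv continuous_on_subset[OF continuous_on_matrix_inv, of SO1_0] O1_invertible SO1_0_O1
      by auto
    have "smooth_on {x \<in> W. matrix_inv (cayley_chart A x) \<in> cayley_chart C ` W}
        (\<lambda>x. inv_into W (cayley_chart C) (matrix_inv (cayley_chart A x)))"
      if A: "A \<in> SO1_0" and C: "C \<in> SO1_0" for A C
    proof -
      let ?V = "ball 0 r \<inter> cayley_chart A -` {B. invertible B}"
      have V: "open ?V"
        using Ck_on_imp_continuous_on[OF chart_smooth] open_ball open_invertible
        by (rule continuous_open_preimage)
      show ?thesis
      proof (rule smooth_on_into_cayley_chart[OF C V])
        have "Ck_on k ?V (cayley_chart A)" for k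
          using Ck_on_cayley_chart[OF V Ck_on_bounded_linear[OF bounded_linear_ident V], of k A] by simp
        then show "Ck_on k ?V (\<lambda>x. matrix_inv (cayley_chart A x))" for k
          using V by (intro Ck_on_matrix_inv) auto
        show "{x \<in> W. matrix_inv (cayley_chart A x) \<in> cayley_chart C ` W}
            \<subseteq> {x \<in> ?V. matrix_inv (cayley_chart A x) \<in> cayley_chart C ` W}"
          using WB cayley_chart_in_SO1_0[OF A] O1_invertible SO1_0_O1 by auto
      qed
    qed
    then show "\<forall>(W, p)\<in>cayley_atlas. \<forall>(W', p')\<in>cayley_atlas.
       smooth_on {x \<in> W. matrix_inv (p x) \<in> p' ` W'} (\<lambda>x. inv_into W' p' (matrix_inv (p x)))"
      by (auto simp: cayley_atlas_def)
  qed
qed (auto simp: SO1_0_subset_O1 SO1_0_one SO1_0_mult SO1_0_inv intro: SO1_0_O1)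

end

lemma connected_lie_subgroup_SO1_0: "connected_lie_subgroup (SO1_0 :: ('m::{finite,zero} square_matrix) set)"
proof -
  obtain r where "r > 0" "\<And>X :: 'm::{finite,zero} square_matrix. norm X < r \<Longrightarrow> invertible (mat 1 - X)"
    using exists_cayley_radius by metis
  from lie_subgroup_structure_SO1_0[OF this refl]
  show ?thesis
    unfolding connected_lie_subgroup_def
    using connected_SO1_0 by (metis connected_space_subconnected connectedin_iff_connected connected_space_subtopology)
qed

section \<open>Irreducibility of the identity component\<close>

text \<open>
  A subspace \<open>S\<close> stable under the Cayley transforms of small \<open>X \<in> so(1,n)\<close> is stable under \<open>(1 - X)\<^sup>-\<^sup>1\<close>, hence, by
  finite dimension, under \<open>X\<close>.  Applying \<open>u \<and> y\<close> to \<open>x \<in> S\<close> shows that \<open>S\<close> contains every \<open>y\<close> orthogonal to a nonzero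
  \<open>x \<in> S\<close>.  If \<open>S\<close> is proper, all its vectors are therefore null; but for \<open>n = 0\<close> no nonzero vector is
  null, and for \<open>n \<ge> 2\<close> there is a nonzero spatial vector orthogonal to \<open>x\<close>, which is not null.
\<close>

lemma acts_irreducibly_SO1_0:
  assumes card: "CARD('m) \<noteq> 2"
  shows "acts_irreducibly (SO1_0 :: ('m::{finite,zero} square_matrix) set)"
  unfolding acts_irreducibly_def
proof (intro allI impI)
  fix S :: "((real, 'm) vec) set"
  assume "subspace S \<and> (\<forall>A\<in>SO1_0. \<forall>x\<in>S. A *v x \<in> S)"
  then have S: "subspace S" and inv: "\<And>A x. A \<in> SO1_0 \<Longrightarrow> x \<in> S \<Longrightarrow> A *v x \<in> S" by auto
  obtain r where r: "r > 0" "\<And>X :: 'm::{finite,zero} square_matrix. norm X < r \<Longrightarrow> invertible (mat 1 - X)"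
    using exists_cayley_radius by metis
  have small: "X *v x \<in> S" if X: "X \<in> so1" "norm X < r" and x: "x \<in> S" for X x
  proof -
    define M where "M = matrix_inv (mat 1 - X)"
    note MX = matrix_inv_mult_vec[OF r(2)[OF X(2)], folded M_def]
    have "M *v s \<in> S" if "s \<in> S" for s
    proof -
      have "cayley_chart (mat 1) X \<in> SO1_0"
        using cayley_chart_in_SO1_0[OF r refl SO1_0_one] X by simp
      then have "(1/2) *\<^sub>R (cayley X *v s + s) \<in> S"
        using inv[of "cayley X"] that S by (simp add: cayley_chart_def subspace_add subspace_scale)
      then show ?thesis by (simp add: cayley_def M_def matvec_simps)
    qed
    then have sub: "(*v) M ` S \<subseteq> S" by blast
    have "inj ((*v) M)" using MX(1) by (metis injI)
    then have "dim ((*v) M ` S) = dim S"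
      by (intro dim_image_eq) (auto intro: inj_on_subset)
    then have "(*v) M ` S = S"
      using sub S by (intro subspace_dim_equal linear_subspace_image) auto
    then obtain y where "y \<in> S" "x = M *v y" using x by blast
    then have "(mat 1 - X) *v x \<in> S" using MX(1) by simp
    then have "x - (mat 1 - X) *v x \<in> S" using S x by (simp add: subspace_diff)
    then show ?thesis by (simp add: matvec_simps)
  qed
  have inv_so1: "X *v x \<in> S" if X: "X \<in> so1" and x: "x \<in> S" for X x
  proof -
    define c where "c = r / (2 * (norm X + 1))"
    have "norm X + 1 > 0" by (simp add: add_nonneg_pos)
    then have c: "c > 0" "norm (c *\<^sub>R X) < r"
      using r(1) by (auto simp: c_def field_simps) (smt (verit) mult_nonneg_nonneg norm_ge_zero)
    have "(c *\<^sub>R X) *v x \<in> S"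
      using small[OF subspace_scale[OF subspace_so1 X] c(2) x] .
    then have "(1 / c) *\<^sub>R ((c *\<^sub>R X) *v x) \<in> S" using S subspace_scale by blast
    then show ?thesis using c(1) by (simp add: matvec_simps)
  qed
  have orth: "y \<in> S" if x: "x \<in> S" "x \<noteq> 0" and y: "lorentz x y = 0" for x y
  proof -
    obtain u where u: "lorentz x u \<noteq> 0" using lorentz_nondegenerate x(2) by blast
    have "wedge u y *v x \<in> S" using inv_so1[OF wedge_so1 x(1)] .
    then have "lorentz u x *\<^sub>R y \<in> S" using y lorentz_commute[of y x] by (simp add: wedge_mult_vec)
    then have "(1 / lorentz u x) *\<^sub>R (lorentz u x *\<^sub>R y) \<in> S" using S subspace_scale by blast
    then show ?thesis using u lorentz_commute[of u x] by simp
  qed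
  show "S = {0} \<or> S = UNIV"
  proof (rule ccontr)
    assume "\<not> ?thesis"
    then obtain x where x: "x \<in> S" "x \<noteq> 0" and ne: "S \<noteq> UNIV" using subspace_0[OF S] by blast
    have null: "lorentz z z = 0" if z: "z \<in> S" for z
    proof (rule ccontr)
      assume nz: "lorentz z z \<noteq> 0"
      then have "z \<noteq> 0" by (auto simp: lorentz_simps)
      have "y \<in> S" for y
      proof -
        have "y - (lorentz z y / lorentz z z) *\<^sub>R z \<in> S"
          using nz by (intro orth[OF z \<open>z \<noteq> 0\<close>]) (simp add: lorentz_simps)
        then have "(y - (lorentz z y / lorentz z z) *\<^sub>R z) + (lorentz z y / lorentz z z) *\<^sub>R z \<in> S"
          using S z by (intro subspace_add subspace_scale)
        then show ?thesis by simp
      qed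
      then show False using ne by blast
    qed
    have x0: "x $ 0 \<noteq> 0" using causal_component_0[OF x(2)] null[OF x(1)] by simp
    have "\<exists>i. i \<noteq> (0 :: 'm)"
    proof (rule ccontr)
      assume "\<not> ?thesis"
      then have "UNIV - {0 :: 'm} = {}" by blast
      then have "lorentz x x = - (x $ 0 * x $ 0)" by (simp only: lorentz_def sum.empty)
      then show False using null[OF x(1)] x0 by simp
    qed
    then obtain i where i: "i \<noteq> (0 :: 'm)" by blast
    have "\<exists>j. j \<noteq> (0 :: 'm) \<and> j \<noteq> i"
    proof (rule ccontr)
      assume "\<not> ?thesis"
      then have "UNIV = {0, i}" by blast
      then have "CARD('m) = card {0, i}" by simp
      then show False using i card by simp
    qed
    then obtain j where j: "j \<noteq> (0 :: 'm)" "j \<noteq> i" by blast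
    \<comment> \<open>a nonzero spatial vector in the plane of the axes \<open>i\<close> and \<open>j\<close> that is orthogonal to \<open>x\<close>\<close>
    define y :: "(real, 'm) vec" where "y = (if x $ i = 0 \<and> x $ j = 0 then axis i 1 else x $ j *\<^sub>R axis i 1 - x $ i *\<^sub>R axis j 1)"
    have "y $ 0 = 0" using i j by (simp add: y_def axis_def)
    moreover have "y \<noteq> 0"
    proof -
      have "y $ i \<noteq> 0 \<or> y $ j \<noteq> 0" using i j by (simp add: y_def axis_def) blast
      then show ?thesis by auto
    qed
    moreover have "lorentz x y = 0"
      using i j by (simp add: y_def lorentz_commute[of x] lorentz_axis lorentz_simps)
    ultimately show False
      using null[OF orth[OF x]] spacelike_if_component_0[of y] by force
  qed
qed

section \<open>Tangent vectors of immersed manifolds\<close>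

text \<open>
  Velocities of curves that are continuous for the topology \<open>T\<close> at the base point only.  \<open>T\<close> may be finer than the norm
  topology, so the first condition is not implied by the third.  Asking for so little makes the set
  functorial under maps that are continuous for \<open>T\<close> and linear on the ambient space.
\<close>

definition tangent_vectors :: "'a::real_normed_vector topology \<Rightarrow> 'a \<Rightarrow> 'a set" where
  "tangent_vectors T B =
     {X. \<exists>c :: real \<Rightarrow> 'a. limitin T c B (at 0) \<and> c 0 = B \<and> (c has_vector_derivative X) (at 0)}"

lemma tangent_vectorsE:
  assumes "X \<in> tangent_vectors T B"
  obtains c :: "real \<Rightarrow> 'a::real_normed_vector"
  where "limitin T c B (at 0)" "c 0 = B" "(c has_vector_derivative X) (at 0)"
  using assms by (auto simp: tangent_vectors_def)

lemma tangent_vectors_bounded_linear_image: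
  assumes "continuous_map T T' L" "bounded_linear L" "X \<in> tangent_vectors T B"
  shows "L X \<in> tangent_vectors T' (L B)"
proof -
  from assms(3) obtain c where c: "limitin T c B (at 0)" "c 0 = B" "(c has_vector_derivative X) (at 0)"
    by (rule tangent_vectorsE)
  have "limitin T' (L \<circ> c) (L B) (at 0)"
    using assms(1) c(1) by (rule continuous_map_limit)
  moreover have "((\<lambda>t. L (c t)) has_vector_derivative L X) (at 0)"
    by (rule bounded_linear.has_vector_derivative[OF assms(2) c(3)])
  ultimately show ?thesis
    using c(2) unfolding tangent_vectors_def by (auto simp: o_def intro!: exI[of _ "\<lambda>t. L (c t)"])
qed

lemma has_vector_derivative_in_closed_subspace:
  fixes f :: "real \<Rightarrow> 'a::euclidean_space"
  assumes "subspace S" and der: "(f has_vector_derivative Z) (at 0)"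
    and "\<forall>\<^sub>F t in at 0. f t \<in> S" and "f 0 \<in> S"
  shows "Z \<in> S"
proof -
  have "((\<lambda>t. (f t - f 0 - t *\<^sub>R Z) /\<^sub>R norm t) \<longlongrightarrow> 0) (at 0)"
    using der unfolding has_vector_derivative_def has_derivative_at_within by simp
  then have "((\<lambda>t. norm ((f t - f 0 - t *\<^sub>R Z) /\<^sub>R norm t)) \<longlongrightarrow> 0) (at 0)"
    by (rule tendsto_norm_zero)
  moreover have "norm ((f t - f 0 - t *\<^sub>R Z) /\<^sub>R norm t) = norm ((1 / t) *\<^sub>R (f t - f 0) - Z)"
    if "t \<noteq> 0" for t
  proof -
    have "(1 / t) *\<^sub>R (f t - f 0) - Z = (1 / t) *\<^sub>R (f t - f 0 - t *\<^sub>R Z)"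
      using that by (simp add: scaleR_diff_right)
    then show ?thesis using that by (simp add: divide_inverse_commute)
  qed
  then have "\<forall>\<^sub>F t in at 0. norm ((f t - f 0 - t *\<^sub>R Z) /\<^sub>R norm t) = norm ((1 / t) *\<^sub>R (f t - f 0) - Z)"
    by (simp add: eventually_at_filter)
  ultimately have "((\<lambda>t. norm ((1 / t) *\<^sub>R (f t - f 0) - Z)) \<longlongrightarrow> 0) (at 0)"
    by (rule Lim_transform_eventually)
  then have lim: "((\<lambda>t. (1 / t) *\<^sub>R (f t - f 0)) \<longlongrightarrow> Z) (at 0)"
    using Lim_null tendsto_norm_zero_iff by blast
  have "\<forall>\<^sub>F t in at 0. (1 / t) *\<^sub>R (f t - f 0) \<in> S"
    using assms(3) by eventually_elim (use assms(1,4) in \<open>simp add: subspace_scale subspace_diff\<close>)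
  then show ?thesis
    using Lim_in_closed_set[OF closed_subspace[OF assms(1)] _ _ lim] by simp
qed

lemma chart_derivative_in_tangent_vectors:
  fixes p :: "'e::euclidean_space \<Rightarrow> 'a::real_normed_vector"
  assumes E: "subspace E" and W: "openin (top_of_set E) W" and x: "x \<in> W" and v: "v \<in> E"
    and p: "continuous_map (top_of_set W) T p" and D: "(p has_derivative D) (at x within W)"
  shows "D v \<in> tangent_vectors T (p x)"
proof -
  obtain U where U: "open U" "W = E \<inter> U" using W by (auto simp: openin_open)
  define l where "l t = x + t *\<^sub>R v" for t
  have "open (l -` U)" unfolding l_def by (intro open_vimage U continuous_intros)
  moreover have "0 \<in> l -` U" using x U by (simp add: l_def)
  ultimately obtain d where d: "d > 0" "ball 0 d \<subseteq> l -` U" by (rule openE)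
  have lW: "l t \<in> W" if "t \<in> ball 0 d" for t
    using that d x v E U by (auto simp: l_def subspace_add subspace_scale)
  have ev: "\<forall>\<^sub>F t in at 0. l t \<in> W"
    using lW d(1) by (auto simp: eventually_at dist_commute)
  have "(l \<longlongrightarrow> l 0) (at 0)"
    unfolding l_def by (intro tendsto_intros)
  moreover have "l 0 = x" by (simp add: l_def)
  ultimately have "limitin (top_of_set W) l x (at 0)"
    unfolding limitin_subtopology using x ev by simp
  then have lim: "limitin T (p \<circ> l) (p x) (at 0)" by (rule continuous_map_limit[OF p])
  have "(l has_derivative (\<lambda>t. t *\<^sub>R v)) (at 0 within ball 0 d)"
    unfolding l_def by (auto intro!: derivative_eq_intros)
  moreover have "(p has_derivative D) (at (l 0) within l ` ball 0 d)"
  proof -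
    have "l 0 = x" by (simp add: l_def)
    moreover have "l ` ball 0 d \<subseteq> W" using lW by blast
    ultimately show ?thesis using has_derivative_subset[OF D] by simp
  qed
  ultimately have "((\<lambda>t. p (l t)) has_derivative (\<lambda>t. D (t *\<^sub>R v))) (at 0 within ball 0 d)"
    by (rule has_derivative_in_compose)
  then have "((\<lambda>t. p (l t)) has_derivative (\<lambda>t. t *\<^sub>R D v)) (at 0)"
    using d(1) has_derivative_linear[OF D] by (simp add: at_within_open[of 0 "ball 0 d"] linear_cmul)
  then show ?thesis
    using lim unfolding tangent_vectors_def has_vector_derivative_def
    by (auto simp: o_def l_def intro!: exI[of _ "\<lambda>t. p (l t)"])
qed

text \<open>
  The curve \<open>c\<close> is lifted through the chart to a curve \<open>y\<close> in \<open>E\<close>.  As \<open>D\<close> is bounded below on \<open>E\<close>, \<open>|y(t) - x|\<close> is at most a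
  constant times \<open>|t|\<close>, even though nothing is known about differentiability of \<open>y\<close>.  So \<open>X\<close> is a limit of
  the vectors \<open>D ((y(t) - x) / t)\<close>, and \<open>D ` E\<close> is closed.
\<close>

lemma tangent_vectors_in_chart_derivative:
  fixes p :: "'e::euclidean_space \<Rightarrow> 'a::euclidean_space"
  assumes E: "subspace E" and W: "openin (top_of_set E) W" and x: "x \<in> W"
    and pW: "openin T (p ` W)"
    and hom: "homeomorphic_map (top_of_set W) (subtopology T (p ` W)) p"
    and D: "(p has_derivative D) (at x within W)" "inj_on D E"
    and X: "X \<in> tangent_vectors T (p x)"
  shows "X \<in> D ` E"
proof -
  obtain c where c: "limitin T c (p x) (at 0)" "c 0 = p x" "(c has_vector_derivative X) (at 0)"
    using X by (rule tangent_vectorsE)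
  obtain g where "homeomorphic_maps (top_of_set W) (subtopology T (p ` W)) p g"
    using hom by (auto simp: homeomorphic_map_maps)
  then have gcont: "continuous_map (subtopology T (p ` W)) (top_of_set W) g" and gp: "\<And>y. y \<in> W \<Longrightarrow> g (p y) = y"
    by (auto simp: homeomorphic_maps_def)
  have WE: "W \<subseteq> E" using W by (auto simp: openin_open)
  define y where "y t = g (c t)" for t
  have evc: "\<forall>\<^sub>F t in at 0. c t \<in> p ` W" using limitinD[OF c(1) pW] x by blast
  then have "limitin (subtopology T (p ` W)) c (p x) (at 0)"
    unfolding limitin_subtopology using c(1) x by blast
  then have "limitin (top_of_set W) (g \<circ> c) (g (p x)) (at 0)"
    by (rule continuous_map_limit[OF gcont])
  then have "((g \<circ> c) \<longlongrightarrow> g (p x)) (at 0)"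
    unfolding limitin_subtopology by simp
  moreover have "y = g \<circ> c" by (simp add: fun_eq_iff y_def)
  ultimately have ylim: "(y \<longlongrightarrow> x) (at 0)" using gp[OF x] by (simp only:)
  have evy: "\<forall>\<^sub>F t in at 0. y t \<in> W \<and> p (y t) = c t"
    using evc by eventually_elim (auto simp: y_def gp)
  have Dlin: "bounded_linear D" using D(1) by (rule has_derivative_bounded_linear)
  have "\<forall>v\<in>E. D v = 0 \<longrightarrow> v = 0"
  proof (intro ballI impI)
    fix v assume "v \<in> E" "D v = 0"
    then show "v = 0"
      using inj_onD[OF D(2), of v 0] subspace_0[OF E] linear_0[OF bounded_linear.linear[OF Dlin]] by simp
  qed
  then obtain m where m: "m > 0" "\<And>v. v \<in> E \<Longrightarrow> m * norm v \<le> norm (D v)"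
    using injective_imp_isometric[OF closed_subspace[OF E] E Dlin] by (auto simp: mult.commute)
  have approx: "\<forall>\<^sub>F t in at 0. norm (c t - c 0 - D (y t - x)) \<le> e * norm (y t - x)" if "e > 0" for e
  proof -
    obtain d where d: "d > 0" "\<And>z. z \<in> W \<Longrightarrow> norm (z - x) < d \<Longrightarrow> norm (p z - p x - D (z - x)) \<le> e * norm (z - x)"
      using conjunct2[OF D(1)[unfolded has_derivative_within_alt]] \<open>e > 0\<close> by blast
    have "\<forall>\<^sub>F t in at 0. norm (y t - x) < d"
      using tendstoD[OF ylim d(1)] by (simp add: dist_norm)
    then show ?thesis using evy 
    proof eventually_elim
      case (elim t)
      then show ?case using d(2)[of "y t"] c(2) by simp
    qed
  qed
  have cder: "\<forall>\<^sub>F t in at 0. norm (c t - c 0 - t *\<^sub>R X) \<le> e * \<bar>t\<bar>" if "e > 0" for e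
  proof -
    obtain d where d: "d > 0" "\<And>t. norm (t - 0) < d \<Longrightarrow> norm (c t - c 0 - (t - 0) *\<^sub>R X) \<le> e * norm (t - 0)"
      using conjunct2[OF c(3)[unfolded has_vector_derivative_def has_derivative_within_alt]] \<open>e > 0\<close>
      by blast
    then show ?thesis unfolding eventually_at by (intro exI[of _ d]) auto
  qed
  define C where "C = 2 * (norm X + 1) / m"
  have Cpos: "C > 0" using m(1) by (simp add: C_def add_nonneg_pos)
  have half: "m / 2 > 0" using m(1) by simp
  have ybound: "\<forall>\<^sub>F t in at 0. norm (y t - x) \<le> C * \<bar>t\<bar>"
    using approx[OF half] cder[OF zero_less_one] evy
  proof eventually_elim
    fix t assume t: "norm (c t - c 0 - D (y t - x)) \<le> m / 2 * norm (y t - x)"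
      "norm (c t - c 0 - t *\<^sub>R X) \<le> 1 * \<bar>t\<bar>" "y t \<in> W \<and> p (y t) = c t"
    have "y t - x \<in> E" using t(3) x WE E by (meson subsetD subspace_diff)
    then have "m * norm (y t - x) \<le> norm (D (y t - x))" by (rule m(2))
    also have "\<dots> \<le> norm (c t - c 0) + norm (c t - c 0 - D (y t - x))"
      using norm_triangle_ineq4[of "c t - c 0" "c t - c 0 - D (y t - x)"] by simp
    also have "\<dots> \<le> norm (c t - c 0) + m / 2 * norm (y t - x)" using t(1) by simp
    finally have "m / 2 * norm (y t - x) \<le> norm (c t - c 0)" by simp
    also have "\<dots> \<le> norm (t *\<^sub>R X) + norm (c t - c 0 - t *\<^sub>R X)"
      using norm_triangle_ineq[of "t *\<^sub>R X" "c t - c 0 - t *\<^sub>R X"] by simp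
    also have "\<dots> \<le> (norm X + 1) * \<bar>t\<bar>" using t(2) by (simp add: algebra_simps)
    finally show "norm (y t - x) \<le> C * \<bar>t\<bar>" using m(1) by (simp add: C_def field_simps)
  qed
  have "X \<in> closure (D ` E)"
    unfolding closure_approachable
  proof (intro allI impI)
    fix e :: real assume "e > 0"
    define e' where "e' = e / (2 * (C + 1))"
    have e': "e' > 0" "e' * (C + 1) < e" using \<open>e > 0\<close> Cpos by (auto simp: e'_def field_simps add_pos_pos)
    have "\<forall>\<^sub>F t in at 0. t \<noteq> 0" by (simp add: eventually_at_filter)
    with approx[OF e'(1)] cder[OF e'(1)] ybound evy
    have "\<forall>\<^sub>F t in at (0::real). \<exists>z\<in>D ` E. dist z X < e"
    proof eventually_elim
      fix t :: real
      assume t: "norm (c t - c 0 - D (y t - x)) \<le> e' * norm (y t - x)" "norm (c t - c 0 - t *\<^sub>R X) \<le> e' * \<bar>t\<bar>"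
        "norm (y t - x) \<le> C * \<bar>t\<bar>" "y t \<in> W \<and> p (y t) = c t" "t \<noteq> 0"
      have "norm (D (y t - x) - t *\<^sub>R X) \<le> norm (c t - c 0 - t *\<^sub>R X) + norm (c t - c 0 - D (y t - x))"
        using norm_triangle_ineq4[of "c t - c 0 - t *\<^sub>R X" "c t - c 0 - D (y t - x)"] by simp
      also have "\<dots> \<le> e' * \<bar>t\<bar> + e' * (C * \<bar>t\<bar>)"
        using t(1,2,3) e'(1) by (intro add_mono order_trans[OF t(1)] mult_left_mono) auto
      also have "\<dots> = e' * (C + 1) * \<bar>t\<bar>" by (simp add: algebra_simps)
      also have "\<dots> < e * \<bar>t\<bar>" using e'(2) t(5) by simp
      finally have "norm (D (y t - x) - t *\<^sub>R X) / \<bar>t\<bar> < e" using t(5) by (simp add: field_simps)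
      moreover have "D ((1 / t) *\<^sub>R (y t - x)) - X = (1 / t) *\<^sub>R (D (y t - x) - t *\<^sub>R X)"
        unfolding linear_cmul[OF bounded_linear.linear[OF Dlin]] using t(5) by (simp add: scaleR_diff_right[of _ "D _"])
      ultimately have "dist (D ((1 / t) *\<^sub>R (y t - x))) X < e"
        by (simp add: dist_norm divide_inverse_commute)
      moreover have "(1 / t) *\<^sub>R (y t - x) \<in> E" using t(4) x WE E by (auto intro!: subspace_scale subspace_diff)
      ultimately show "\<exists>z\<in>D ` E. dist z X < e" by blast
    qed
    then show "\<exists>z\<in>D ` E. dist z X < e"
      using eventually_happens[of _ "at (0::real)"] by force
  qed
  moreover have "closed (D ` E)"
    by (intro closed_subspace linear_subspace_image bounded_linear.linear[OF Dlin] E)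
  ultimately show ?thesis by simp
qed

text \<open>
  Expresses membership in \<open>S\<close> as the vanishing of a map that can be differentiated; it is the projection onto the orthogonal complement.
\<close>

lemma exists_complementary_projection:
  fixes S :: "'a::euclidean_space set"
  assumes S: "subspace S"
  shows "\<exists>Q :: 'a \<Rightarrow> 'a. bounded_linear Q \<and> (\<forall>y. y - Q y \<in> S) \<and> (\<forall>y\<in>S. Q y = 0)"
proof -
  obtain B where fin: "finite B" and B: "B \<subseteq> S" "span B = S"
    and orth: "\<And>b c. b \<in> B \<Longrightarrow> c \<in> B \<Longrightarrow> b \<bullet> c = (if b = c then 1 else 0)"
    using orthonormal_spanning_set[OF S] by blast
  define Q where "Q y = y - (\<Sum>b\<in>B. (y \<bullet> b) *\<^sub>R b)" for y
  have lin: "bounded_linear Q"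
    unfolding Q_def linear_conv_bounded_linear[symmetric]
    by (intro linearI) (simp_all add: inner_add_left scaleR_left_distrib sum.distrib
        scaleR_diff_right scaleR_sum_right algebra_simps)
  have "Q b = 0" if "b \<in> B" for b
  proof -
    have "(\<Sum>c\<in>B. (b \<bullet> c) *\<^sub>R c) = (\<Sum>c\<in>B. if c = b then c else 0)"
      using that by (intro sum.cong) (auto simp: orth)
    then show ?thesis using that fin by (simp add: Q_def)
  qed
  then have "Q y = 0" if "y \<in> S" for y
    using linear_eq_0_on_span[OF bounded_linear.linear[OF lin], of B y] that B(2) by blast
  moreover have "y - Q y \<in> S" for y
    unfolding Q_def using B(1) S by (auto intro!: subspace_sum subspace_scale)
  ultimately show ?thesis using lin by blast
qed

text \<open>
  At a point where \<open>|\<phi>|\<close> is maximal, the mean value inequality bounds this maximum by half of itself.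
\<close>

lemma gronwall_vanish:
  fixes \<phi> :: "real \<Rightarrow> 'a::real_inner"
  assumes der: "\<And>t. t \<in> {0..1} \<Longrightarrow> (\<phi> has_vector_derivative \<phi>' t) (at t)"
    and bound: "\<And>t. t \<in> {0..1} \<Longrightarrow> norm (\<phi>' t) \<le> norm (\<phi> t) / 2" and "\<phi> 0 = 0"
  shows "\<phi> 1 = 0"
proof -
  have cont: "continuous_on {0..1} \<phi>"
    using has_vector_derivative_continuous[OF der] by (intro continuous_at_imp_continuous_on) blast
  then have "continuous_on {0..1} (\<lambda>t. norm (\<phi> t))" by (rule continuous_on_norm)
  then obtain s where s: "s \<in> {0..1}" "\<And>t. t \<in> {0..1} \<Longrightarrow> norm (\<phi> t) \<le> norm (\<phi> s)"
    using continuous_attains_sup[of "{0..1::real}" "\<lambda>t. norm (\<phi> t)"] by auto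
  have "norm (\<phi> s) \<le> norm (\<phi> s) / 2"
  proof (cases "s = 0")
    case True
    then show ?thesis using \<open>\<phi> 0 = 0\<close> by simp
  next
    case False
    then have "0 < s" using s(1) by simp
    moreover have "continuous_on {0..s} \<phi>" using cont s(1) by (auto intro: continuous_on_subset)
    moreover have "(\<phi> has_derivative (\<lambda>h. h *\<^sub>R \<phi>' t)) (at t)" if "0 < t" "t < s" for t
      using der[of t] that s(1) by (simp add: has_vector_derivative_def)
    ultimately obtain t where t: "t \<in> {0<..<s}" "norm (\<phi> s - \<phi> 0) \<le> norm ((s - 0) *\<^sub>R \<phi>' t)"
      using mvt_general[of 0 s \<phi> "\<lambda>t h. h *\<^sub>R \<phi>' t"] by blast
    have t1: "t \<in> {0..1}" using t(1) s(1) by auto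
    have "norm (\<phi> s) \<le> s * norm (\<phi>' t)" using t(2) \<open>\<phi> 0 = 0\<close> \<open>0 < s\<close> by simp
    also have "\<dots> \<le> 1 * norm (\<phi>' t)" using s(1) by (intro mult_right_mono) auto
    also have "\<dots> \<le> norm (\<phi> t) / 2" using bound[OF t1] by simp
    also have "\<dots> \<le> norm (\<phi> s) / 2" using s(2)[OF t1] by simp
    finally show ?thesis .
  qed
  then have "\<phi> s = 0" by simp
  then show ?thesis using s(2)[of 1] by simp
qed

section \<open>Lie subgroups of O(1,n) and their Lie algebras\<close>

locale lie_subgroup =
  fixes G E :: "('m::{finite,zero} square_matrix) set"
    and T :: "('m::{finite,zero} square_matrix) topology"
    and \<A> :: "('m::{finite,zero} square_matrix, 'm::{finite,zero} square_matrix) parametrization set"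
  assumes lie: "lie_subgroup_structure G E T \<A>"
begin

lemma group:
  "A \<in> G \<Longrightarrow> A \<in> O1" "mat 1 \<in> G" "A \<in> G \<Longrightarrow> B \<in> G \<Longrightarrow> A ** B \<in> G"
  "A \<in> G \<Longrightarrow> matrix_inv A \<in> G" "topspace T = G" "subspace E"
  using lie unfolding lie_subgroup_structure_def smooth_manifold_def by blast+

lemma continuous_mult:
  assumes "continuous_map X T f" "continuous_map X T g"
  shows "continuous_map X T (\<lambda>x. f x ** g x)"
proof -
  have "continuous_map (prod_topology T T) T (\<lambda>(A, B). A ** B)"
    using lie by (simp add: lie_subgroup_structure_def smooth_map_def)
  then have "continuous_map X T ((\<lambda>(A, B). A ** B) \<circ> (\<lambda>x. (f x, g x)))"
    using assms by (intro continuous_map_compose) (auto simp: continuous_map_paired)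
  then show ?thesis by (simp add: o_def)
qed

lemma continuous_translation:
  assumes "M \<in> G" "N \<in> G"
  shows "continuous_map T T (\<lambda>A. M ** A ** N)"
  using assms group(5) by (intro continuous_mult) auto

lemma chart_at:
  assumes "B \<in> G"
  obtains W p x where "(W, p) \<in> \<A>" "x \<in> W" "p x = B"
proof -
  have "topspace T = (\<Union>(W, p)\<in>\<A>. p ` W)"
    using lie unfolding lie_subgroup_structure_def smooth_manifold_def by blast
  then have "B \<in> (\<Union>(W, p)\<in>\<A>. p ` W)" using assms group(5) by simp
  then obtain W p where "(W, p) \<in> \<A>" "B \<in> p ` W" by auto
  then show ?thesis using that by auto
qed

lemma chart:
  assumes "(W, p) \<in> \<A>"
  shows "openin (top_of_set E) W" "openin T (p ` W)"
    "homeomorphic_map (top_of_set W) (subtopology T (p ` W)) p" "smooth_on W p"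
    "\<And>x. x \<in> W \<Longrightarrow> \<exists>D. (p has_derivative D) (at x within W) \<and> inj_on D E"
  using lie assms
  unfolding lie_subgroup_structure_def smooth_manifold_def inclusion_is_immersion_def by blast+

lemma chart_in_G: "(W, p) \<in> \<A> \<Longrightarrow> x \<in> W \<Longrightarrow> p x \<in> G"
  using openin_subset[OF chart(2)] group(5) by blast

lemma chart_continuous: "(W, p) \<in> \<A> \<Longrightarrow> continuous_map (top_of_set W) T p"
  using homeomorphic_imp_continuous_map[OF chart(3)] by (simp add: continuous_map_in_subtopology)

lemma chart_continuous_on: "(W, p) \<in> \<A> \<Longrightarrow> continuous_on W p"
  using chart(5) has_derivative_continuous unfolding continuous_on_eq_continuous_within by blast

lemma chart_open_map:
  assumes "(W, p) \<in> \<A>" "openin (top_of_set W) V"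
  shows "openin T (p ` V)"
proof -
  have "openin (subtopology T (p ` W)) (p ` V)"
    using homeomorphic_imp_open_map[OF chart(3)[OF assms(1)]] assms(2) by (simp add: open_map_def)
  then show ?thesis using chart(2)[OF assms(1)] by (rule openin_trans_full)
qed

lemma continuous_inclusion: "continuous_map T euclidean (\<lambda>A. A)"
  unfolding continuous_map_def
proof (intro conjI allI impI)
  fix U :: "'m square_matrix set" assume "openin euclidean U"
  then have U: "open U" by simp
  show "openin T {A \<in> topspace T. A \<in> U}"
  proof (subst openin_subopen, intro ballI)
    fix A assume "A \<in> {A \<in> topspace T. A \<in> U}"
    then have A: "A \<in> G" "A \<in> U" using group(5) by auto
    obtain W p x where c: "(W, p) \<in> \<A>" "x \<in> W" "p x = A" using chart_at[OF A(1)] .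
    have "openin (top_of_set W) (W \<inter> p -` U)"
      using chart_continuous_on[OF c(1)] U by (rule continuous_openin_preimage_gen)
    then have "openin T (p ` (W \<inter> p -` U))" by (rule chart_open_map[OF c(1)])
    moreover have "A \<in> p ` (W \<inter> p -` U)" using c A by blast
    moreover have "p ` (W \<inter> p -` U) \<subseteq> {A \<in> topspace T. A \<in> U}"
      using chart_in_G[OF c(1)] group(5) by auto
    ultimately show "\<exists>V. openin T V \<and> A \<in> V \<and> V \<subseteq> {A \<in> topspace T. A \<in> U}" by blast
  qed
qed simp

lemma tangent_eq_chart_derivative:
  assumes c: "(W, p) \<in> \<A>" "x \<in> W" and D: "(p has_derivative D) (at x within W)" "inj_on D E"
  shows "tangent_vectors T (p x) = D ` E"
  using tangent_vectors_in_chart_derivative[OF group(6) chart(1)[OF c(1)] c(2) chart(2,3)[OF c(1)] D]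
    chart_derivative_in_tangent_vectors[OF group(6) chart(1)[OF c(1)] c(2) _ chart_continuous[OF c(1)] D(1)]
  by blast

definition lie_algebra :: "('m::{finite,zero} square_matrix) set" where
  "lie_algebra = tangent_vectors T (mat 1)"

lemma subspace_lie_algebra: "subspace lie_algebra"
proof -
  obtain W p x where c: "(W, p) \<in> \<A>" "x \<in> W" "p x = mat 1" using chart_at[OF group(2)] .
  obtain D where D: "(p has_derivative D) (at x within W)" "inj_on D E" using chart(5)[OF c(1,2)] by blast
  have "lie_algebra = D ` E" using tangent_eq_chart_derivative[OF c(1,2) D] c(3) by (simp add: lie_algebra_def)
  then show ?thesis using linear_subspace_image[OF has_derivative_linear[OF D(1)] group(6)] by simp
qed

lemma tangent_translation:
  assumes "M \<in> G" "N \<in> G" "X \<in> tangent_vectors T B"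
  shows "M ** X ** N \<in> tangent_vectors T (M ** B ** N)"
proof (rule tangent_vectors_bounded_linear_image[OF continuous_translation[OF assms(1,2)] _ assms(3)])
  show "bounded_linear (\<lambda>A. M ** A ** N)"
    by (intro bounded_linear_compose[OF bounded_bilinear.bounded_linear_left[OF bounded_bilinear_matrix_mult]]
        bounded_bilinear.bounded_linear_right[OF bounded_bilinear_matrix_mult])
qed

lemma curve_eventually_in_G:
  assumes "limitin T c B (at 0)"
  shows "\<forall>\<^sub>F t in at 0. c t \<in> G"
  using limitinD[OF assms openin_topspace limitin_topspace[OF assms]] group(5) by simp

lemma lie_algebra_so1: "lie_algebra \<subseteq> so1"
proof
  fix X assume "X \<in> lie_algebra"
  then obtain c where c: "limitin T c (mat 1) (at 0)" "c 0 = mat 1" "(c has_vector_derivative X) (at 0)"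
    unfolding lie_algebra_def by (rule tangent_vectorsE)
  have bil: "bounded_bilinear (lorentz :: (real, 'm) vec \<Rightarrow> _)"
    unfolding bilinear_conv_bounded_bilinear[symmetric] bilinear_def
    by (auto intro!: linearI simp: lorentz_simps)
  have "lorentz (X *v x) y = - lorentz x (X *v y)" for x y
  proof -
    have lin: "bounded_linear (\<lambda>A :: 'm square_matrix. A *v z)" for z
      unfolding linear_conv_bounded_linear[symmetric] by (intro linearI) (simp_all add: matvec_simps)
    have "((\<lambda>t. lorentz (c t *v x) (c t *v y)) has_vector_derivative
        lorentz (c 0 *v x) (X *v y) + lorentz (X *v x) (c 0 *v y)) (at 0)"
      by (intro bounded_bilinear.has_vector_derivative[OF bil] bounded_linear.has_vector_derivative[OF lin] c(3))
    moreover have "\<forall>\<^sub>F t in nhds 0. t \<in> UNIV \<longrightarrow> lorentz (c t *v x) (c t *v y) = lorentz x y"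
    proof -
      have "\<forall>\<^sub>F t in at 0. lorentz (c t *v x) (c t *v y) = lorentz x y"
        using curve_eventually_in_G[OF c(1)] by eventually_elim (use group(1) in \<open>auto simp: O1_def\<close>)
      then show ?thesis using c(2) by (simp add: eventually_at_filter) (auto elim!: eventually_mono)
    qed
    ultimately have "((\<lambda>t. lorentz x y) has_vector_derivative
        lorentz (c 0 *v x) (X *v y) + lorentz (X *v x) (c 0 *v y)) (at 0)"
      using c(2) by (subst (asm) has_vector_derivative_cong_ev) auto
    then have "lorentz (c 0 *v x) (X *v y) + lorentz (X *v x) (c 0 *v y) = 0"
      using vector_derivative_unique_at[OF _ has_vector_derivative_const] by blast
    then show ?thesis using c(2) by simp
  qed
  then show "X \<in> so1" by (simp add: so1_def)
qed

lemma lie_algebra_Ad: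
  assumes "A \<in> G" "X \<in> lie_algebra"
  shows "A ** X ** matrix_inv A \<in> lie_algebra"
  using tangent_translation[OF assms(1) group(4)[OF assms(1)] assms(2)[unfolded lie_algebra_def]]
    matrix_inv_works[OF O1_invertible[OF group(1)[OF assms(1)]]]
  by (simp add: lie_algebra_def)

text \<open>
  Differentiate \<open>c(t) Y c(t)\<^sup>-\<^sup>1\<close>, which stays in the closed subspace \<open>lie_algebra\<close>, along a curve \<open>c\<close> with velocity \<open>X\<close>.
\<close>

lemma lie_algebra_commutator:
  assumes "X \<in> lie_algebra" "Y \<in> lie_algebra"
  shows "commutator X Y \<in> lie_algebra"
proof -
  from assms(1) obtain c where c: "limitin T c (mat 1) (at 0)" "c 0 = mat 1" "(c has_vector_derivative X) (at 0)"
    unfolding lie_algebra_def by (rule tangent_vectorsE)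
  define f where "f t = c t ** Y ** matrix_inv (c t)" for t
  have ev: "\<forall>\<^sub>F t in at 0. f t \<in> lie_algebra"
    using curve_eventually_in_G[OF c(1)] by eventually_elim (simp add: f_def lie_algebra_Ad assms(2))
  have f0: "f 0 \<in> lie_algebra" using assms(2) by (simp add: f_def c(2) matrix_inv_one)
  have "invertible (c 0)" using c(2) matrix_inv_eqI(1)[of "mat 1" "mat 1"] by simp
  from has_derivative_compose[OF c(3)[unfolded has_vector_derivative_def] has_derivative_matrix_inv[OF this]]
  have inv: "((\<lambda>t. matrix_inv (c t)) has_vector_derivative - X) (at 0)"
    by (simp add: has_vector_derivative_def c(2) matrix_inv_one)
  have "((\<lambda>t. c t ** Y) has_vector_derivative X ** Y) (at 0)"
    by (rule bounded_linear.has_vector_derivative[OF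
        bounded_bilinear.bounded_linear_left[OF bounded_bilinear_matrix_mult] c(3)])
  from bounded_bilinear.has_vector_derivative[OF bounded_bilinear_matrix_mult this inv]
  have "(f has_vector_derivative commutator X Y) (at 0)"
    by (simp add: f_def[abs_def] c(2) matrix_inv_one commutator_def matrix_mult_simps)
  then show ?thesis
    using ev f0 by (rule has_vector_derivative_in_closed_subspace[OF subspace_lie_algebra])
qed

text \<open>
  Along the ray \<open>l\<close> from \<open>x0\<close> in a chart around \<open>1\<close>, the matrices \<open>M(t)\<close> satisfy \<open>M' = X M\<close> with \<open>X(t) \<in> g\<close>.  Let \<open>Q\<close> be a
  projection with kernel \<open>S\<close>.  Since \<open>X\<close> maps \<open>S\<close> to itself, \<open>\<phi> = Q M s\<close> satisfies \<open>\<phi>' = Q X \<phi>\<close>, and it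
  vanishes at the start if \<open>s \<in> S\<close>.  On short rays the coefficient is at most \<open>1/2\<close>, so \<open>\<phi>\<close>
  vanishes by \<open>gronwall_vanish\<close>.
\<close>

lemma invariant_near_one:
  assumes S: "subspace S" and inv: "\<And>X s. X \<in> lie_algebra \<Longrightarrow> s \<in> S \<Longrightarrow> X *v s \<in> S"
  shows "\<exists>N. openin T N \<and> mat 1 \<in> N \<and> (\<forall>B\<in>N. \<forall>s\<in>S. B *v s \<in> S)"
proof -
  obtain W p x0 where c: "(W, p) \<in> \<A>" "x0 \<in> W" "p x0 = mat 1" using chart_at[OF group(2)] .
  obtain U where U: "open U" "W = E \<inter> U" using chart(1)[OF c(1)] by (auto simp: openin_open)
  from bspec[OF chart(4)[OF c(1), unfolded smooth_on_def] c(2)]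
  obtain V h where "open V \<and> x0 \<in> V \<and> (\<forall>k. Ck_on k V h) \<and> (\<forall>y\<in>V \<inter> W. h y = p y)"
    by (elim exE)
  then have V: "open V" "x0 \<in> V" "\<And>k. Ck_on k V h" "\<And>y. y \<in> V \<inter> W \<Longrightarrow> h y = p y"
    by simp_all
  have "open (V \<inter> U)" "x0 \<in> V \<inter> U" using V U c(2) by auto
  then obtain e where e: "e > 0" "cball x0 e \<subseteq> V \<inter> U"
    unfolding open_contains_cball by blast
  define C where "C = cball x0 e \<inter> E"
  have C: "compact C" unfolding C_def
    by (intro compact_Int_closed compact_cball closed_subspace group(6))
  have CW: "C \<subseteq> V \<inter> W" using e U by (auto simp: C_def)
  have hp: "h x = p x" if "x \<in> C" for x using V(4) CW that by blast
  have hG: "h x \<in> G" if "x \<in> C" for x using hp[OF that] chart_in_G[OF c(1)] CW that by auto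
  have h1: "Ck_on (Suc 0) V h" by (rule V(3))
  define h' where "h' x v = frechet_derivative h (at x) v" for x v
  have der: "(h has_derivative h' x) (at x)" if "x \<in> C" for x
    using Ck_on_SucE[OF h1, of x] CW that unfolding h'_def by (auto simp: eta_contract_eq)
  have tangent: "h' x v ** matrix_inv (h x) \<in> lie_algebra" if x: "x \<in> C" "dist x0 x < e" and v: "v \<in> E" for x v
  proof -
    have xW: "x \<in> W" using CW x by blast
    obtain d where d: "d > 0" "ball x d \<subseteq> V" using V(1) CW x(1) openE by blast
    have "(h has_derivative h' x) (at x within W)" using der[OF x(1)] by (rule has_derivative_at_withinI)
    then have "(p has_derivative h' x) (at x within W)"
      using d(1) xW
    proof (rule has_derivative_transform_within)
      fix y assume "y \<in> W" "dist y x < d"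
      then show "h y = p y" using V(4) d(2) by (auto simp: dist_commute subset_iff)
    qed
    then have "h' x v \<in> tangent_vectors T (p x)"
      using chart_derivative_in_tangent_vectors[OF group(6) chart(1)[OF c(1)] xW v chart_continuous[OF c(1)]] by blast
    then have "mat 1 ** h' x v ** matrix_inv (h x) \<in> tangent_vectors T (mat 1 ** p x ** matrix_inv (h x))"
      by (intro tangent_translation group hG x)
    then show ?thesis
      using matrix_inv_works(1)[OF O1_invertible[OF group(1)[OF hG[OF x(1)]]]] hp[OF x(1)]
      by (simp add: lie_algebra_def)
  qed
  \<comment> \<open>\<open>h' h\<^sup>-\<^sup>1\<close> is bounded uniformly near \<open>x0\<close>, which is what makes short rays short enough\<close>
  have "\<exists>K\<ge>0. \<forall>x\<in>C. \<forall>v. norm (h' x v ** matrix_inv (h x)) \<le> K * norm v"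
  proof -
    have cont: "continuous_on C (\<lambda>x. h' x b ** matrix_inv (h x))" for b
    proof (intro continuous_on_matrix_mult)
      have "continuous_on V (\<lambda>x. h' x b)" using h1 by (simp add: h'_def)
      then show "continuous_on C (\<lambda>x. h' x b)" using CW by (auto intro: continuous_on_subset)
      have "continuous_on V h" using V(3)[of 0] by simp
      then have "continuous_on C h" using CW by (auto intro: continuous_on_subset)
      then show "continuous_on C (\<lambda>x. matrix_inv (h x))"
        by (rule continuous_on_compose2[OF continuous_on_matrix_inv]) (use hG group(1) O1_invertible in blast)
    qed
    have "\<exists>B. \<forall>x\<in>C. norm (h' x b ** matrix_inv (h x)) \<le> B" for b
      using compact_imp_bounded[OF compact_continuous_image[OF cont C], of b] by (auto simp: bounded_iff)
    then obtain B where B: "\<And>b x. x \<in> C \<Longrightarrow> norm (h' x b ** matrix_inv (h x)) \<le> B b" by metis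
    have B0: "B b \<ge> 0" for b
    proof -
      have "x0 \<in> C" using e(1) c(2) U by (auto simp: C_def)
      then show ?thesis using B[of x0 b] norm_ge_zero order_trans by blast
    qed
    have "norm (h' x v ** matrix_inv (h x)) \<le> (\<Sum>b\<in>Basis. B b) * norm v" if x: "x \<in> C" for x v
    proof -
      have lin: "linear (h' x)" using der[OF x] by (rule has_derivative_linear)
      have "h' x v = (\<Sum>b\<in>Basis. (v \<bullet> b) *\<^sub>R h' x b)"
        by (subst euclidean_representation[of v, symmetric]) (simp add: linear_sum[OF lin] linear_cmul[OF lin])
      then have "h' x v ** matrix_inv (h x) = (\<Sum>b\<in>Basis. (v \<bullet> b) *\<^sub>R (h' x b ** matrix_inv (h x)))"
        by (simp add: bounded_bilinear.sum_left[OF bounded_bilinear_matrix_mult] matrix_mult_simps)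
      also have "norm \<dots> \<le> (\<Sum>b\<in>Basis. norm v * B b)"
      proof (rule sum_norm_le)
        fix b :: "'m square_matrix" assume b: "b \<in> Basis"
        show "norm ((v \<bullet> b) *\<^sub>R (h' x b ** matrix_inv (h x))) \<le> norm v * B b"
          using Basis_le_norm[OF b, of v] B[OF x, of b] by (auto intro!: mult_mono)
      qed
      also have "\<dots> = (\<Sum>b\<in>Basis. B b) * norm v"
        by (simp add: sum_distrib_right mult.commute[of "norm v"])
      finally show ?thesis .
    qed
    moreover have "(\<Sum>b\<in>Basis. B b) \<ge> 0" by (intro sum_nonneg B0)
    ultimately show ?thesis by blast
  qed
  then obtain K where K: "K \<ge> 0" "\<And>x v. x \<in> C \<Longrightarrow> norm (h' x v ** matrix_inv (h x)) \<le> K * norm v" by blast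
  obtain Q :: "(real, 'm) vec \<Rightarrow> (real, 'm) vec" where
    Q: "bounded_linear Q" "\<And>y. y - Q y \<in> S" "\<And>y. y \<in> S \<Longrightarrow> Q y = 0"
    using exists_complementary_projection[OF S] by blast
  have bil: "bounded_bilinear (\<lambda>(X :: 'm square_matrix) z. Q (X *v z))"
    unfolding bilinear_conv_bounded_bilinear[symmetric] bilinear_def
    by (auto intro!: linearI simp: matvec_simps linear_add[OF bounded_linear.linear[OF Q(1)]]
        linear_cmul[OF bounded_linear.linear[OF Q(1)]])
  obtain L where L: "L > 0" "\<And>(X :: 'm square_matrix) z. norm (Q (X *v z)) \<le> norm X * norm z * L"
    using bounded_bilinear.pos_bounded[OF bil] by blast
  \<comment> \<open>\<open>d\<close> is chosen so that the coefficient in the differential inequality for \<open>\<phi>\<close> is at most \<open>1/2\<close>\<close>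
  define d where "d = min e (1 / (2 * L * (K + 1)))"
  have d: "d > 0" "d \<le> e" "d * K * L \<le> 1 / 2"
  proof -
    have pos: "2 * L * (K + 1) > 0" using L(1) K(1) by simp
    then show "d > 0" "d \<le> e" using e(1) by (simp_all add: d_def)
    have "d * (K * L) \<le> (1 / (2 * L * (K + 1))) * (K * L)"
      using K(1) L(1) by (intro mult_right_mono) (auto simp: d_def)
    also have "\<dots> = K / (K + 1) / 2" using L(1) by simp
    also have "\<dots> \<le> 1 / 2" using K(1) by (simp add: divide_le_eq)
    finally show "d * K * L \<le> 1 / 2" by (simp add: mult.assoc)
  qed
  have stable: "p x *v s \<in> S" if x: "x \<in> W" "dist x0 x < d" and s: "s \<in> S" for x s
  proof -
    define v where "v = x - x0"
    have vE: "v \<in> E" using x(1) c(2) U group(6) by (auto simp: v_def subspace_diff)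
    have nv: "norm v < d" using x(2) by (simp add: v_def dist_norm norm_minus_commute)
    define l where "l t = x0 + t *\<^sub>R v" for t
    have l: "l t \<in> C" "dist x0 (l t) < e" if "t \<in> {0..1}" for t
    proof -
      have "norm (t *\<^sub>R v) \<le> 1 * norm v" unfolding norm_scaleR using that by (intro mult_right_mono) auto
      then show 1: "dist x0 (l t) < e" using nv d(2) by (simp add: l_def dist_norm)
      have "x0 \<in> E" using c(2) U by blast
      then show "l t \<in> C" using 1 vE group(6) by (auto simp: C_def l_def subspace_add subspace_scale)
    qed
    define \<phi> where "\<phi> t = Q (h (l t) *v s)" for t
    have Qlin: "linear Q" using Q(1) by (rule bounded_linear.linear)
    have phi_der: "(\<phi> has_vector_derivative Q (h' (l t) v *v s)) (at t)" if "t \<in> {0..1}" for t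
    proof -
      have "(l has_derivative (\<lambda>r. r *\<^sub>R v)) (at t)"
        unfolding l_def by (auto intro!: derivative_eq_intros)
      from has_derivative_compose[OF this der[OF l(1)[OF that]]]
      have "((\<lambda>t. h (l t)) has_vector_derivative h' (l t) v) (at t)"
        using has_derivative_linear[OF der[OF l(1)[OF that]]]
        by (simp add: has_vector_derivative_def linear_cmul)
      then show ?thesis
        unfolding \<phi>_def by (rule bounded_linear.has_vector_derivative[OF bounded_bilinear.bounded_linear_left[OF bil]])
    qed
    have bound: "norm (Q (h' (l t) v *v s)) \<le> norm (\<phi> t) / 2" if t: "t \<in> {0..1}" for t
    proof -
      define X where "X = h' (l t) v ** matrix_inv (h (l t))"
      define y where "y = h (l t) *v s"
      have X: "X \<in> lie_algebra" unfolding X_def using tangent l[OF t] vE by blast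
      have "h' (l t) v *v s = X *v y"
        using matrix_inv_mult_vec(2)[OF O1_invertible[OF group(1)[OF hG[OF l(1)[OF t]]]]]
        by (simp add: X_def y_def matvec_simps)
      moreover have "Q (X *v y) = Q (X *v (y - Q y)) + Q (X *v Q y)"
        by (simp add: matvec_simps linear_diff[OF Qlin])
      moreover have "Q (X *v (y - Q y)) = 0" using Q(3) inv[OF X Q(2)] by blast
      ultimately have "norm (Q (h' (l t) v *v s)) = norm (Q (X *v Q y))" by simp
      also have "\<dots> \<le> norm X * norm (Q y) * L" by (rule L(2))
      also have "\<dots> \<le> (K * d) * norm (Q y) * L"
      proof -
        have "norm X \<le> K * norm v" unfolding X_def by (rule K(2)[OF l(1)[OF t]])
        also have "\<dots> \<le> K * d" using nv K(1) by (intro mult_left_mono) auto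
        finally show ?thesis using L(1) by (intro mult_right_mono) auto
      qed
      also have "\<dots> = (d * K * L) * norm (Q y)" by simp
      also have "\<dots> \<le> (1 / 2) * norm (Q y)" using d(3) by (intro mult_right_mono) auto
      finally show ?thesis by (simp add: \<phi>_def y_def)
    qed
    have x0C: "x0 \<in> C" using l(1)[of 0] by (simp add: l_def)
    have "\<phi> 0 = 0" using Q(3)[OF s] hp[OF x0C] c(3) by (simp add: \<phi>_def l_def)
    then have "\<phi> 1 = 0" using gronwall_vanish[OF phi_der bound] by blast
    then have "Q (p x *v s) = 0" using hp[OF l(1)[of 1]] by (simp add: \<phi>_def l_def v_def)
    then show ?thesis using Q(2)[of "p x *v s"] by simp
  qed
  have "openin (top_of_set W) (W \<inter> ball x0 d)" by (simp add: openin_open_Int)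
  then have "openin T (p ` (W \<inter> ball x0 d))" by (rule chart_open_map[OF c(1)])
  moreover have "mat 1 \<in> p ` (W \<inter> ball x0 d)" using c d(1) by (intro image_eqI[of _ _ x0]) auto
  ultimately show ?thesis using stable by (intro exI[of _ "p ` (W \<inter> ball x0 d)"]) auto
qed

text \<open>
  The stabiliser \<open>H\<close> of \<open>S\<close> in \<open>G\<close> contains a neighbourhood of \<open>1\<close>.  Hence \<open>H\<close> and its complement are open for \<open>T\<close>, and
  \<open>T\<close> is connected.
\<close>

lemma invariant_lie_algebra_imp_group:
  assumes conn: "connected_space T" and S: "subspace S"
    and inv: "\<And>X s. X \<in> lie_algebra \<Longrightarrow> s \<in> S \<Longrightarrow> X *v s \<in> S"
    and A: "A \<in> G" and s: "s \<in> S"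
  shows "A *v s \<in> S"
proof -
  obtain N where N: "openin T N" "mat 1 \<in> N" "\<And>B s. B \<in> N \<Longrightarrow> s \<in> S \<Longrightarrow> B *v s \<in> S"
    using invariant_near_one[OF S inv] by blast
  define H where "H = {A \<in> G. \<forall>s\<in>S. A *v s \<in> S}"
  have nbhd: "\<exists>V. openin T V \<and> A \<in> V \<and> (\<forall>B\<in>V. B \<in> G \<and> (B \<in> H \<longleftrightarrow> A \<in> H))" if A: "A \<in> G" for A
  proof -
    have invA: "invertible A" using O1_invertible[OF group(1)[OF A]] .
    define V where "V = {B \<in> topspace T. mat 1 ** B ** matrix_inv A \<in> N}"
    have "openin T V"
      unfolding V_def by (rule openin_continuous_map_preimage[OF continuous_translation[OF group(2) group(4)[OF A]] N(1)])
    moreover have "A \<in> V" using A group(5) N(2) matrix_inv_works[OF invA] by (simp add: V_def)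
    moreover have "B \<in> G \<and> (B \<in> H \<longleftrightarrow> A \<in> H)" if "B \<in> V" for B
    proof -
      define u where "u = B ** matrix_inv A"
      have B: "B \<in> G" and u: "u \<in> N" using that group(5) by (auto simp: V_def u_def)
      have Bu: "B *v z = u *v (A *v z)" for z
        using matrix_inv_mult_vec(2)[OF invA] by (simp add: u_def matvec_simps)
      have "u \<in> G" unfolding u_def using group A B by blast
      then have invu: "invertible u" using O1_invertible group(1) by blast
      have "inj ((*v) u)" by (rule inj_matrix_vector_mult[OF invu])
      then have "dim ((*v) u ` S) = dim S" by (intro dim_image_eq) (auto intro: inj_on_subset)
      moreover have "(*v) u ` S \<subseteq> S" using N(3)[OF u] by blast
      ultimately have uS: "(*v) u ` S = S"
        using S by (intro subspace_dim_equal linear_subspace_image) auto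
      have "u *v z \<in> S \<longleftrightarrow> z \<in> S" for z
        using uS \<open>inj ((*v) u)\<close> by (metis image_iff injD imageI)
      then show ?thesis using A B by (simp add: H_def Bu)
    qed
    ultimately show ?thesis by blast
  qed
  have "openin T H"
  proof (subst openin_subopen, intro ballI)
    fix A assume "A \<in> H"
    then show "\<exists>V. openin T V \<and> A \<in> V \<and> V \<subseteq> H" using nbhd[of A] by (auto simp: H_def)
  qed
  moreover have "openin T (topspace T - H)"
  proof (subst openin_subopen, intro ballI)
    fix A assume A: "A \<in> topspace T - H"
    then have "A \<in> G" using group(5) by simp
    then obtain V where V: "openin T V" "A \<in> V" "\<forall>B\<in>V. B \<in> G \<and> (B \<in> H \<longleftrightarrow> A \<in> H)"
      using nbhd by blast
    then have "V \<subseteq> topspace T - H" unfolding group(5) using A by blast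
    then show "\<exists>V. openin T V \<and> A \<in> V \<and> V \<subseteq> topspace T - H" using V by blast
  qed
  moreover have "H \<subseteq> topspace T" using group(5) by (auto simp: H_def)
  ultimately have "H = {} \<or> H = topspace T"
    using conn unfolding connected_space_clopen_in closedin_def by blast
  moreover have "mat 1 \<in> H" using group(2) by (simp add: H_def)
  ultimately have "H = G" using group(5) by auto
  then show ?thesis using A s by (auto simp: H_def)
qed

lemma G_subset_SO1_0:
  assumes conn: "connected_space T"
  shows "G \<subseteq> SO1_0"
proof (rule connected_subset_SO1_0[OF _ _ group(2) SO1_0_one])
  have "connectedin euclidean ((\<lambda>A. A) ` topspace T)"
    using conn by (intro connectedin_continuous_map_image[OF continuous_inclusion]) (simp add: connectedin_topspace)
  then show "connected G" by (simp add: group(5))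
qed (use group(1) in blast)

text \<open>
  In Cayley coordinates the chart of \<open>G\<close> at \<open>1\<close> becomes a continuous injective map from an open subset of \<open>E\<close> to \<open>so(1,n)\<close>.
  As \<open>dim E \<ge> dim so(1,n)\<close>, its image is open by invariance of domain.
\<close>

lemma full_lie_algebra_imp_neighbourhood:
  assumes full: "lie_algebra = so1"
  shows "\<exists>N. openin (top_of_set O1) N \<and> mat 1 \<in> N \<and> N \<subseteq> G"
proof -
  obtain W p x0 where c: "(W, p) \<in> \<A>" "x0 \<in> W" "p x0 = mat 1" using chart_at[OF group(2)] .
  obtain D where D: "(p has_derivative D) (at x0 within W)" "inj_on D E" using chart(5)[OF c(1,2)] by blast
  have "D ` E = so1" using tangent_eq_chart_derivative[OF c(1,2) D] c(3) full by (simp add: lie_algebra_def)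
  then have dim: "dim (so1 :: ('m square_matrix) set) \<le> dim E"
    using dim_image_le[OF has_derivative_linear[OF D(1)], of E] by simp
  let ?Dom = "{B :: 'm square_matrix. invertible (mat 1 + B)}"
  have dom: "?Dom = {B. invertible (mat 1 + matrix_inv (mat 1) ** B)}" by (simp add: matrix_inv_one)
  have openDom: "open ?Dom" unfolding dom by (rule open_coord_domain)
  have "cayley_coord (mat 1) = (cayley_inv :: 'm square_matrix \<Rightarrow> _)"
    by (simp add: cayley_coord_def fun_eq_iff matrix_inv_one)
  then have cont: "continuous_on ?Dom cayley_inv"
    using continuous_on_cayley_coord[of "mat 1 :: 'm square_matrix"] by (simp add: matrix_inv_one)
  define W1 where "W1 = W \<inter> p -` ?Dom"
  define F where "F x = cayley_inv (p x)" for x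
  have "openin (top_of_set W) W1"
    unfolding W1_def using chart_continuous_on[OF c(1)] openDom by (rule continuous_openin_preimage_gen)
  then have "openin (top_of_set E) W1" using chart(1)[OF c(1)] by (rule openin_trans)
  moreover have "continuous_on W1 F"
    unfolding F_def
    by (rule continuous_on_compose2[OF cont continuous_on_subset[OF chart_continuous_on[OF c(1)]]])
      (auto simp: W1_def)
  moreover have "F \<in> W1 \<rightarrow> so1"
    by (auto simp: F_def W1_def intro!: cayley_inv_in_so1 group(1) chart_in_G[OF c(1)])
  moreover have "inj_on F W1"
  proof (rule inj_onI)
    fix x y assume xy: "x \<in> W1" "y \<in> W1" "F x = F y"
    have "p x = cayley (F x)" "p y = cayley (F y)"
      using xy(1,2) by (simp_all add: F_def W1_def cayley_cayley_inv(2))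
    then have "p x = p y" using xy(3) by simp
    moreover have "inj_on p W"
      using homeomorphic_imp_injective_map[OF chart(3)[OF c(1)]] by simp
    ultimately show "x = y" using xy by (auto simp: W1_def dest: inj_onD)
  qed
  ultimately have "openin (top_of_set so1) (F ` W1)"
    using invariance_of_domain_subspaces[OF _ group(6) subspace_so1 dim] by blast
  then obtain O' where O': "open O'" "F ` W1 = so1 \<inter> O'" by (auto simp: openin_open)
  define N where "N = O1 \<inter> (?Dom \<inter> cayley_inv -` O')"
  have "openin (top_of_set O1) N"
    unfolding N_def by (intro openin_open_Int continuous_open_preimage cont openDom O')
  moreover have "mat 1 \<in> N"
  proof -
    have "(mat 1 + mat 1) ** ((1/2) *\<^sub>R mat 1) = (mat 1 :: 'm square_matrix)"
      by (simp add: matrix_mult_simps scaleR_2[symmetric])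
    then have "mat 1 \<in> ?Dom" using matrix_inv_eqI(1) by blast
    then have "x0 \<in> W1" using c by (simp add: W1_def)
    then have "F x0 \<in> O'" using O' by blast
    then show ?thesis using \<open>mat 1 \<in> ?Dom\<close> O1_one c(3) by (simp add: N_def F_def)
  qed
  moreover have "N \<subseteq> G"
  proof
    fix B assume "B \<in> N"
    then have B: "B \<in> O1" "invertible (mat 1 + B)" "cayley_inv B \<in> O'" by (auto simp: N_def)
    then have "cayley_inv B \<in> F ` W1" using cayley_inv_in_so1 O' by blast
    then obtain x where x: "x \<in> W1" "cayley_inv B = cayley_inv (p x)" by (auto simp: F_def)
    have "invertible (mat 1 + p x)" using x(1) by (simp add: W1_def)
    then have "B = p x"
      using cayley_cayley_inv(2)[OF B(2)] cayley_cayley_inv(2) x(2) by metis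
    then show "B \<in> G" using chart_in_G[OF c(1)] x(1) by (auto simp: W1_def)
  qed
  ultimately show ?thesis by blast
qed

text \<open>
  A subgroup that contains a neighbourhood of \<open>1\<close> in \<open>O(1,n)\<close> is open and closed in the connected set \<open>SO(1,n)\<^sub>0\<close>.
\<close>

lemma full_lie_algebra_imp_eq_SO1_0:
  assumes conn: "connected_space T" and full: "lie_algebra = so1"
  shows "G = SO1_0"
proof -
  obtain N where N: "openin (top_of_set O1) N" "mat 1 \<in> N" "N \<subseteq> G"
    using full_lie_algebra_imp_neighbourhood[OF full] by blast
  obtain U where U: "open U" "N = O1 \<inter> U" using N(1) by (auto simp: openin_open)
  have nbhd: "\<exists>V. openin (top_of_set SO1_0) V \<and> A \<in> V \<and> (\<forall>B\<in>V. B \<in> G \<longleftrightarrow> A \<in> G)" if A: "A \<in> SO1_0" for A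
  proof -
    have AO: "A \<in> O1" using A by (rule SO1_0_O1)
    note AA = matrix_inv_works[OF O1_invertible[OF AO]]
    define V where "V = SO1_0 \<inter> (\<lambda>B. matrix_inv A ** B) -` U"
    have "openin (top_of_set SO1_0) V"
      unfolding V_def by (intro openin_open_Int open_vimage U continuous_intros)
    moreover have "A \<in> V" using A AA N(2) U by (simp add: V_def)
    moreover have "B \<in> G \<longleftrightarrow> A \<in> G" if B: "B \<in> V" for B
    proof -
      define n where "n = matrix_inv A ** B"
      have "B \<in> O1" using B SO1_0_O1 by (auto simp: V_def)
      then have n: "n \<in> G" using B U N(3) O1_mult O1_inv AO by (auto simp: V_def n_def)
      have BA: "B = A ** n" by (simp add: n_def matrix_mul_assoc AA)
      have "A = B ** matrix_inv n"
        using matrix_inv_works(1)[OF O1_invertible[OF group(1)[OF n]]]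
        by (simp add: BA matrix_mul_assoc[symmetric])
      then show ?thesis using BA n group(3,4) by metis
    qed
    ultimately show ?thesis by blast
  qed
  have sub: "G \<subseteq> SO1_0" by (rule G_subset_SO1_0[OF conn])
  have "openin (top_of_set SO1_0) G"
  proof (subst openin_subopen, intro ballI)
    fix A assume "A \<in> G"
    then show "\<exists>V. openin (top_of_set SO1_0) V \<and> A \<in> V \<and> V \<subseteq> G" using nbhd[of A] sub by blast
  qed
  moreover have "openin (top_of_set SO1_0) (SO1_0 - G)"
  proof (subst openin_subopen, intro ballI)
    fix A assume A: "A \<in> SO1_0 - G"
    then obtain V where V: "openin (top_of_set SO1_0) V" "A \<in> V" "\<forall>B\<in>V. B \<in> G \<longleftrightarrow> A \<in> G" using nbhd[of A] by blast
    moreover have "V \<subseteq> SO1_0" using openin_imp_subset[OF V(1)] .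
    ultimately show "\<exists>V. openin (top_of_set SO1_0) V \<and> A \<in> V \<and> V \<subseteq> SO1_0 - G" using A by blast
  qed
  ultimately have "G = {} \<or> G = SO1_0"
    using connected_SO1_0 sub unfolding connected_clopen closedin_def topspace_euclidean_subtopology
    by blast
  then show ?thesis using group(2) by blast
qed

lemma irreducible_imp_eq_SO1_0:
  assumes conn: "connected_space T" and irr: "acts_irreducibly G"
  shows "G = SO1_0"
proof -
  have "acts_irreducibly lie_algebra"
    unfolding acts_irreducibly_def
  proof (intro allI impI)
    fix S assume "subspace S \<and> (\<forall>X\<in>lie_algebra. \<forall>x\<in>S. X *v x \<in> S)"
    then have "subspace S \<and> (\<forall>A\<in>G. \<forall>x\<in>S. A *v x \<in> S)"
      using invariant_lie_algebra_imp_group[OF conn] by blast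
    then show "S = {0} \<or> S = UNIV" using irr unfolding acts_irreducibly_def by blast
  qed
  then have "lie_algebra = so1"
    by (intro irreducible_subalgebra_eq_so1 subspace_lie_algebra lie_algebra_so1 lie_algebra_commutator)
  then show ?thesis by (rule full_lie_algebra_imp_eq_SO1_0[OF conn])
qed

end

theorem theorem2:
  shows "(\<forall>G :: (real^'m::{finite,zero}^'m::{finite,zero}) set.
            connected_lie_subgroup G \<and> acts_irreducibly G \<longrightarrow> G = SO1_0) \<and>
         (CARD('m) \<noteq> 2 \<longrightarrow>
            connected_lie_subgroup (SO1_0 :: (real^'m::{finite,zero}^'m::{finite,zero}) set) \<and>
            acts_irreducibly (SO1_0 :: (real^'m::{finite,zero}^'m::{finite,zero}) set))"
  using lie_subgroup.irreducible_imp_eq_SO1_0[OF lie_subgroup.intro]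
    connected_lie_subgroup_SO1_0 acts_irreducibly_SO1_0
  unfolding connected_lie_subgroup_def by blast

end
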